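(* Let $(M,g)$ be a compact $d$-dimensional Riemannian manifold without boundary. Suppose $A:[0,\infty)\to(0,\infty)$ is a nondecreasing function such that $\left(\sum_{\lambda_j=\lambda}|e_j(x)|^2\right)^{1/2}\le A(\lambda)$ for all $x\in M$ and all $\lambda\in\mathrm{spec}(\sqrt{-\Delta_g})$. Let $\psi\in\mathcal S(\mathbb R)$ be even with $\widehat\psi$ compactly supported, and let $C_\psi,c_\psi>0$ be constants such that $|\psi(t)|\ge c_\psi$ for $|t|\le C_\psi$. There exist constants $c_0,C_0>0$, depending only on $(M,g)$ and $\psi$, such that the following hold for every $R\ge1$ and every nonzero $f\in L^2(M)$ that is supported in a measurable set $E\subset M$ and satisfies $E_\lambda f=0$ whenever $|\lambda|>C_\psi R$. (i) Let $0<\eta<1$ and let $\Sigma_R\subset\mathrm{spec}(\sqrt{-\Delta_g})$ be a subset of spectral parameters. Assume the $L^1$ spectral concentration condition $$\sum_{\substack{\lambda:\,|\psi(\lambda/R)|\ne0\\ \lambda\notin\Sigma_R}}|\psi(\lambda/R)|\,\|E_\lambda f\|_{L^2(M)}\le\eta\sum_\lambda|\psi(\lambda/R)|\,\|E_\lambda f\|_{L^2(M)}.$$ Let $M_R(\Sigma_R)=\#\{\lambda\in\Sigma_R:|\psi(\lambda/R)|\ne0\}$ denote the number of localized spectral parameters in $\Sigma_R$. Then $$\mathrm{FR}_R(f)\le\frac{\sqrt{M_R(\Sigma_R)}}{1-\eta}.$$ (ii) Under the assumptions of (i), $$M_R(\Sigma_R)\,|E^{C_0/R}|\ge\frac{c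_0^2}{A_R^2R^d}(1-\eta)^2.$$
   Context: $\Delta_g$ is the Laplace--Beltrami operator (negative semidefinite); $L^2(M)$ is taken with respect to the Riemannian volume, and $|\cdot|$ of a subset of $M$ denotes Riemannian volume. $\{e_j\}_{j\ge1}$ is an orthonormal basis of $L^2(M)$ with $\Delta_ge_j=-\lambda_j^2e_j$, $\lambda_j\ge0$; the sum $\sum_{\lambda_j=\lambda}|e_j(x)|^2$ does not depend on the choice of basis. $\mathrm{spec}(\sqrt{-\Delta_g})$ is the set of distinct values $\lambda$ of the $\lambda_j$, $\sum_\lambda$ is the sum over this set, and $E_\lambda$ is the orthogonal projection onto the $-\lambda^2$ eigenspace of $\Delta_g$. For $E\subset M$ and $\delta>0$, $E^\delta$ is the $\delta$-neighborhood of $E$ in $M$. The localized Fourier ratio at scale $R$ is $$\mathrm{FR}_R(f):=\frac{\sum_\lambda|\psi(\lambda/R)|\,\|E_\lambda f\|_{L^2(M)}}{\left(\sum_\lambda|\psi(\lambda/R)|^2\,\|E_\lambda f\|_{L^2(M)}^2\right)^{1/2}},$$ and the eigenfunction growth parameter is $$A_R:=\sup\{A(\lambda):\lambda\in\mathrm{spec}(\sqrt{-\Delta_g}),\ |\lambda|\le C_\psi R\}.$$ The count $M_R(\Sigma_R)$ may be $+\infty$, in which case the inequalities are trivially true. *)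

theory Defs
  imports "HOL-Analysis.Analysis"
begin

section \<open>Smooth functions on open subsets of Euclidean space\<close>

definition partial :: "'n::finite \<Rightarrow> (real ^ 'n \<Rightarrow> 'b::real_normed_vector) \<Rightarrow> real ^ 'n \<Rightarrow> 'b" where
  "partial i f y = frechet_derivative f (at y) (axis i 1)"

text \<open>The next two notions are used on open sets only.\<close>

primrec Ck_on :: "nat \<Rightarrow> (real ^ 'n::finite) set \<Rightarrow> (real ^ 'n \<Rightarrow> 'b::real_normed_vector) \<Rightarrow> bool" where
  "Ck_on 0 S f \<longleftrightarrow> continuous_on S f"
| "Ck_on (Suc k) S f \<longleftrightarrow> f differentiable_on S \<and> (\<forall>i. Ck_on k S (partial i f))"

definition smooth_on :: "(real ^ 'n::finite) set \<Rightarrow> (real ^ 'n \<Rightarrow> 'b::real_normed_vector) \<Rightarrow> bool" where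
  "smooth_on S f \<longleftrightarrow> (\<forall>k. Ck_on k S f)"

section \<open>Closed Riemannian manifolds\<close>

text \<open>A chart is a pair \<open>(U, \<phi>)\<close> of its domain and its coordinate map; the values of \<open>\<phi>\<close> outside
  \<open>U\<close> are irrelevant, and the inverse of \<open>\<phi>\<close> is \<open>inv_into U \<phi>\<close>.  The manifold is the whole type \<open>'a\<close>.
  Connectedness is not required.\<close>

type_synonym ('a, 'n) chart = "'a set \<times> ('a \<Rightarrow> real ^ 'n)"

text \<open>A metric is given by its coordinate matrices: \<open>G (U, \<phi>) p\<close> is the Gram matrix, at \<open>p \<in> U\<close>, of the
  coordinate vector fields of \<open>\<phi>\<close>.\<close>

type_synonym ('a, 'n) riem_metric = "('a, 'n) chart \<Rightarrow> 'a \<Rightarrow> real ^ 'n ^ 'n"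

locale closed_riemannian_manifold =
  fixes \<A> :: "('a::{t2_space, second_countable_topology}, 'n::finite) chart set"
    and G :: "('a, 'n) riem_metric"
  assumes compact_space: "compact (UNIV :: 'a set)"
    and charts_cover: "(\<Union>(U, \<phi>)\<in>\<A>. U) = UNIV"
    and chart_homeomorphism: "(U, \<phi>) \<in> \<A> \<Longrightarrow>
          open U \<and> open (\<phi> ` U) \<and> homeomorphism U (\<phi> ` U) \<phi> (inv_into U \<phi>)"
    and transition_smooth: "(U, \<phi>) \<in> \<A> \<Longrightarrow> (V, \<phi>') \<in> \<A> \<Longrightarrow>
          smooth_on (\<phi> ` (U \<inter> V)) (\<phi>' \<circ> inv_into U \<phi>)"
    and metric_smooth: "(U, \<phi>) \<in> \<A> \<Longrightarrow> smooth_on (\<phi> ` U) (G (U, \<phi>) \<circ> inv_into U \<phi>)"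
    and metric_symmetric: "(U, \<phi>) \<in> \<A> \<Longrightarrow> p \<in> U \<Longrightarrow> transpose (G (U, \<phi>) p) = G (U, \<phi>) p"
    and metric_positive: "(U, \<phi>) \<in> \<A> \<Longrightarrow> p \<in> U \<Longrightarrow> v \<noteq> 0 \<Longrightarrow> v \<bullet> (G (U, \<phi>) p *v v) > 0"
    and metric_transformation: "(U, \<phi>) \<in> \<A> \<Longrightarrow> (V, \<phi>') \<in> \<A> \<Longrightarrow> p \<in> U \<inter> V \<Longrightarrow>
          J = matrix (frechet_derivative (\<phi>' \<circ> inv_into U \<phi>) (at (\<phi> p))) \<Longrightarrow>
          G (U, \<phi>) p = transpose J ** G (V, \<phi>') p ** J"

definition smooth_fun :: "('a, 'n::finite) chart set \<Rightarrow> ('a \<Rightarrow> complex) \<Rightarrow> bool" where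
  "smooth_fun \<A> u \<longleftrightarrow> (\<forall>(U, \<phi>)\<in>\<A>. smooth_on (\<phi> ` U) (u \<circ> inv_into U \<phi>))"

text \<open>The volume is the unique Borel measure with density \<open>sqrt (det g)\<close> in every chart.\<close>

definition is_riemannian_volume ::
    "('a::topological_space, 'n::finite) chart set \<Rightarrow> ('a, 'n) riem_metric \<Rightarrow> 'a measure \<Rightarrow> bool" where
  "is_riemannian_volume \<A> G \<mu> \<longleftrightarrow>
     sets \<mu> = sets borel \<and>
     (\<forall>(U, \<phi>)\<in>\<A>. \<forall>B\<in>sets borel. B \<subseteq> U \<longrightarrow>
        emeasure \<mu> B =
          (\<integral>\<^sup>+y\<in>\<phi> ` B. ennreal (sqrt (det (G (U, \<phi>) (inv_into U \<phi> y)))) \<partial>lborel))"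

section \<open>Riemannian distance and neighborhoods\<close>

definition piecewise_C1_curve ::
    "('a::topological_space, 'n::finite) chart set \<Rightarrow> (real \<Rightarrow> 'a) \<Rightarrow> bool" where
  "piecewise_C1_curve \<A> \<gamma> \<longleftrightarrow>
     path \<gamma> \<and>
     (\<forall>(U, \<phi>)\<in>\<A>. \<forall>a b. 0 \<le> a \<longrightarrow> a \<le> b \<longrightarrow> b \<le> 1 \<longrightarrow> \<gamma> ` {a..b} \<subseteq> U \<longrightarrow>
        (\<phi> \<circ> \<gamma>) piecewise_C1_differentiable_on {a..b})"

text \<open>The speed does not depend on the choice of a chart around \<open>\<gamma> t\<close>; it may be arbitrary at the
  finitely many points where \<open>\<gamma>\<close> is not differentiable.\<close>

definition speed :: "('a, 'n::finite) chart set \<Rightarrow> ('a, 'n) riem_metric \<Rightarrow> (real \<Rightarrow> 'a) \<Rightarrow> real \<Rightarrow> real" where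
  "speed \<A> G \<gamma> t =
     (let c = (SOME c. c \<in> \<A> \<and> \<gamma> t \<in> fst c);
          v = vector_derivative (snd c \<circ> \<gamma>) (at t)
      in sqrt (v \<bullet> (G c (\<gamma> t) *v v)))"

definition curve_length :: "('a, 'n::finite) chart set \<Rightarrow> ('a, 'n) riem_metric \<Rightarrow> (real \<Rightarrow> 'a) \<Rightarrow> ennreal" where
  "curve_length \<A> G \<gamma> = (\<integral>\<^sup>+t\<in>{0..1}. ennreal (speed \<A> G \<gamma> t) \<partial>lborel)"

text \<open>Points in different components have distance \<open>\<infinity>\<close>.\<close>

definition riemannian_dist ::
    "('a::topological_space, 'n::finite) chart set \<Rightarrow> ('a, 'n) riem_metric \<Rightarrow> 'a \<Rightarrow> 'a \<Rightarrow> ennreal" where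
  "riemannian_dist \<A> G x y =
     (INF \<gamma>\<in>{\<gamma>. piecewise_C1_curve \<A> \<gamma> \<and> pathstart \<gamma> = x \<and> pathfinish \<gamma> = y}. curve_length \<A> G \<gamma>)"

definition neighborhood ::
    "('a::topological_space, 'n::finite) chart set \<Rightarrow> ('a, 'n) riem_metric \<Rightarrow> real \<Rightarrow> 'a set \<Rightarrow> 'a set" where
  "neighborhood \<A> G \<delta> E = {x. \<exists>y\<in>E. riemannian_dist \<A> G x y < ennreal \<delta>}"

section \<open>The Laplace--Beltrami operator\<close>

text \<open>In coordinates:
  \<open>(det g)\<^bsup>-1/2\<^esup> \<Sum>\<^sub>i \<partial>\<^sub>i ((det g)\<^bsup>1/2\<^esup> \<Sum>\<^sub>j g\<^bsup>ij\<^esup> \<partial>\<^sub>j u)\<close>.\<close>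

definition chart_laplacian ::
    "('a, 'n::finite) riem_metric \<Rightarrow> ('a, 'n) chart \<Rightarrow> ('a \<Rightarrow> complex) \<Rightarrow> 'a \<Rightarrow> complex" where
  "chart_laplacian G c u p =
     (let U = fst c; \<phi> = snd c;
          F = u \<circ> inv_into U \<phi>;
          H = G c \<circ> inv_into U \<phi>
      in (\<Sum>i\<in>UNIV. partial i
            (\<lambda>y. sqrt (det (H y)) *\<^sub>R (\<Sum>j\<in>UNIV. (matrix_inv (H y) $ i $ j) *\<^sub>R partial j F y)) (\<phi> p))
         /\<^sub>R sqrt (det (H (\<phi> p))))"

text \<open>\<open>has_laplacian \<A> G u w\<close> says that \<open>\<Delta>u = w\<close>.  The coordinate expression does not depend on the
  chart, so that \<open>w\<close> exists and is unique for every smooth \<open>u\<close>.\<close>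

definition has_laplacian ::
    "('a, 'n::finite) chart set \<Rightarrow> ('a, 'n) riem_metric \<Rightarrow> ('a \<Rightarrow> complex) \<Rightarrow> ('a \<Rightarrow> complex) \<Rightarrow> bool" where
  "has_laplacian \<A> G u w \<longleftrightarrow> (\<forall>c\<in>\<A>. \<forall>p\<in>fst c. chart_laplacian G c u p = w p)"

text \<open>By elliptic regularity every eigenfunction in \<open>L\<^sup>2\<close> has a smooth representative, and the eigenspace
  is taken to consist of these.\<close>

definition eigenspace ::
    "('a, 'n::finite) chart set \<Rightarrow> ('a, 'n) riem_metric \<Rightarrow> real \<Rightarrow> ('a \<Rightarrow> complex) set" where
  "eigenspace \<A> G \<nu> = {u. smooth_fun \<A> u \<and> has_laplacian \<A> G u (\<lambda>p. - (\<nu>\<^sup>2 *\<^sub>R u p))}"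

section \<open>The space L2 and spectral projections\<close>

definition square_integrable :: "'a measure \<Rightarrow> ('a \<Rightarrow> complex) \<Rightarrow> bool" where
  "square_integrable \<mu> f \<longleftrightarrow> f \<in> borel_measurable \<mu> \<and> integrable \<mu> (\<lambda>x. (cmod (f x))\<^sup>2)"

definition L2_inner :: "'a measure \<Rightarrow> ('a \<Rightarrow> complex) \<Rightarrow> ('a \<Rightarrow> complex) \<Rightarrow> complex" where
  "L2_inner \<mu> f h = (LINT x|\<mu>. f x * cnj (h x))"

definition L2_norm :: "'a measure \<Rightarrow> ('a \<Rightarrow> complex) \<Rightarrow> real" where
  "L2_norm \<mu> f = sqrt (LINT x|\<mu>. (cmod (f x))\<^sup>2)"

definition orthonormal_eigenbasis ::
    "('a, 'n::finite) chart set \<Rightarrow> ('a, 'n) riem_metric \<Rightarrow> 'a measure \<Rightarrow>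
      (nat \<Rightarrow> 'a \<Rightarrow> complex) \<Rightarrow> (nat \<Rightarrow> real) \<Rightarrow> bool" where
  "orthonormal_eigenbasis \<A> G \<mu> e l \<longleftrightarrow>
     (\<forall>j. 0 \<le> l j \<and> e j \<in> eigenspace \<A> G (l j)) \<and>
     (\<forall>i j. L2_inner \<mu> (e i) (e j) = (if i = j then 1 else 0)) \<and>
     (\<forall>f. square_integrable \<mu> f \<longrightarrow>
        (\<lambda>n. L2_norm \<mu> (\<lambda>x. f x - (\<Sum>j<n. L2_inner \<mu> f (e j) * e j x))) \<longlonglongrightarrow> 0)"

definition eigenprojection ::
    "('a, 'n::finite) chart set \<Rightarrow> ('a, 'n) riem_metric \<Rightarrow> 'a measure \<Rightarrow> real \<Rightarrow>
      ('a \<Rightarrow> complex) \<Rightarrow> 'a \<Rightarrow> complex" where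
  "eigenprojection \<A> G \<mu> \<nu> f =
     (SOME u. u \<in> eigenspace \<A> G \<nu> \<and>
        (\<forall>v\<in>eigenspace \<A> G \<nu>. L2_inner \<mu> (\<lambda>x. f x - u x) v = 0))"

section \<open>Schwartz functions and the Fourier transform on the line\<close>

definition vderiv :: "(real \<Rightarrow> complex) \<Rightarrow> real \<Rightarrow> complex" where
  "vderiv \<psi> = (\<lambda>t. vector_derivative \<psi> (at t))"

definition schwartz :: "(real \<Rightarrow> complex) \<Rightarrow> bool" where
  "schwartz \<psi> \<longleftrightarrow>
     (\<forall>k. (\<forall>t. (vderiv ^^ k) \<psi> differentiable (at t)) \<and>
          (\<forall>m::nat. bounded (range (\<lambda>t. t ^ m *\<^sub>R (vderiv ^^ k) \<psi> t))))"

definition fourier_transform :: "(real \<Rightarrow> complex) \<Rightarrow> real \<Rightarrow> complex" where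
  "fourier_transform \<psi> \<xi> = (LINT t|lborel. cis (- (\<xi> * t)) * \<psi> t)"

section \<open>Localized Fourier ratio and spectral counts\<close>

text \<open>Sums of nonnegative numbers, and counts, are taken in \<open>[0, \<infinity>]\<close>, where they always exist.
  The set \<open>\<Lambda>\<close> is the spectrum of \<open>sqrt (-\<Delta>)\<close>.\<close>

definition ennreal_sqrt :: "ennreal \<Rightarrow> ennreal" where
  "ennreal_sqrt x = (if x = top then top else ennreal (sqrt (enn2real x)))"

text \<open>The mass \<open>\<Sum>\<^sub>\<nu> \<bar>\<psi>(\<nu>/R)\<bar> \<parallel>E\<^sub>\<nu> f\<parallel>\<close> over a set \<open>S\<close> of spectral parameters.\<close>

definition spectral_mass ::
    "('a, 'n::finite) chart set \<Rightarrow> ('a, 'n) riem_metric \<Rightarrow> 'a measure \<Rightarrow> (real \<Rightarrow> complex) \<Rightarrow> real \<Rightarrow>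
      ('a \<Rightarrow> complex) \<Rightarrow> real set \<Rightarrow> ennreal" where
  "spectral_mass \<A> G \<mu> \<psi> R f S =
     (\<Sum>\<^sub>\<infinity>\<nu>\<in>S. ennreal (cmod (\<psi> (\<nu> / R)) * L2_norm \<mu> (eigenprojection \<A> G \<mu> \<nu> f)))"

definition fourier_ratio ::
    "('a, 'n::finite) chart set \<Rightarrow> ('a, 'n) riem_metric \<Rightarrow> 'a measure \<Rightarrow> real set \<Rightarrow>
      (real \<Rightarrow> complex) \<Rightarrow> real \<Rightarrow> ('a \<Rightarrow> complex) \<Rightarrow> ennreal" where
  "fourier_ratio \<A> G \<mu> \<Lambda> \<psi> R f =
     spectral_mass \<A> G \<mu> \<psi> R f \<Lambda> /
     ennreal_sqrt (\<Sum>\<^sub>\<infinity>\<nu>\<in>\<Lambda>.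
       ennreal ((cmod (\<psi> (\<nu> / R)))\<^sup>2 * (L2_norm \<mu> (eigenprojection \<A> G \<mu> \<nu> f))\<^sup>2))"

definition localized_count :: "(real \<Rightarrow> complex) \<Rightarrow> real \<Rightarrow> real set \<Rightarrow> ennreal" where
  "localized_count \<psi> R \<Sigma> = emeasure (count_space UNIV) {\<nu>\<in>\<Sigma>. cmod (\<psi> (\<nu> / R)) \<noteq> 0}"

definition growth_parameter :: "(real \<Rightarrow> real) \<Rightarrow> real set \<Rightarrow> real \<Rightarrow> real \<Rightarrow> real" where
  "growth_parameter A \<Lambda> C R = (SUP \<nu>\<in>{\<nu>\<in>\<Lambda>. \<bar>\<nu>\<bar> \<le> C * R}. A \<nu>)"

end

theory Submission
  imports Defs
begin

text \<open>Let \<open>c\<close> be the lower bound of \<open>\<bar>\<psi>\<bar>\<close> on \<open>[-C\<^sub>\<psi>, C\<^sub>\<psi>]\<close>, let \<open>B\<close> be an upper bound of \<open>\<bar>\<psi>\<bar>\<close>, let \<open>P\<close> be the \<open>L1\<close>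
  spectral mass of \<open>f\<close>, that is the numerator of the Fourier ratio, and \<open>Q\<close> the square of its denominator.

  The first inequality is Cauchy--Schwarz: by concentration, \<open>(1 - \<eta>) P\<close> is at most the mass over the
  \<open>M\<close> localized parameters in \<open>\<Sigma>\<^sub>R\<close>, hence at most \<open>M\<^bsup>1/2\<^esup> Q\<^bsup>1/2\<^esup>\<close> (\<open>L1_concentration\<close>).  The second
  one combines this with an \<open>L\<^sup>\<infinity>\<close> bound.  Only eigenvalues \<open>\<nu> \<le> C\<^sub>\<psi> R\<close> contribute to \<open>f\<close>, and there
  \<open>\<bar>\<psi>(\<nu>/R)\<bar> \<ge> c\<close>, so that \<open>\<bar>f\<bar> \<le> \<Sum> A(\<nu>) \<parallel>E\<^sub>\<nu> f\<parallel> \<le> (A\<^sub>R / c) P\<close> almost everywhere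
  (\<open>band_limited_sup_bound\<close>).  As \<open>f\<close> lives on \<open>E\<close>, which lies in its open neighborhood \<open>O\<close>, this gives
  \<open>\<parallel>f\<parallel>\<^sup>2 \<le> (A\<^sub>R / c)\<^sup>2 P\<^sup>2 \<bar>O\<bar>\<close>.  Together with \<open>Q \<le> B\<^sup>2 \<parallel>f\<parallel>\<^sup>2\<close> and \<open>(1 - \<eta>)\<^sup>2 P\<^sup>2 \<le> M Q\<close> one may cancel
  \<open>P\<^sup>2\<close> and obtains \<open>M \<bar>O\<bar> \<ge> (c / B)\<^sup>2 (1 - \<eta>)\<^sup>2 / A\<^sub>R\<^sup>2\<close>, which is the claim with \<open>c\<^sub>0 = c / B\<close> and \<open>C\<^sub>0 = 1\<close>
  because \<open>R\<^sup>d \<ge> 1\<close>.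

  This argument rests on three facts of spectral geometry, which are proved first.
  Green's formula (\<open>green\<close>) makes eigenspaces of different eigenvalues orthogonal, so that \<open>E\<^sub>\<nu> f\<close> is the
  partial sum of the expansion of \<open>f\<close> over the \<open>e\<^sub>j\<close> with eigenvalue \<open>\<nu>\<close> (\<open>eigenprojection_expansion\<close>).
  Rellich compactness (\<open>weakly_null_imp_L2_null\<close>) shows that only finitely many eigenvalues, with
  multiplicity, lie below any bound (\<open>finite_eigenvalues_below\<close>); otherwise \<open>P\<close> could be infinite while
  \<open>Q\<close> is finite.  Finally, neighborhoods for the Riemannian distance are open, hence measurable
  (\<open>open_neighborhood\<close>).\<close>

section \<open>Continuously differentiable functions\<close>

abbreviation C1_on :: "(real ^ 'n::finite) set \<Rightarrow> (real ^ 'n \<Rightarrow> 'b::real_normed_vector) \<Rightarrow> bool" where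
  "C1_on \<equiv> Ck_on (Suc 0)"

lemma axis_expansion:
  fixes v :: "real ^ 'n"
  shows "v = (\<Sum>i\<in>UNIV. v $ i *\<^sub>R axis i 1)"
  using basis_expansion[of v] by (simp add: scalar_mult_eq_scaleR)

lemma has_derivative_expansion:
  fixes f :: "real ^ 'n::finite \<Rightarrow> 'b::real_normed_vector"
  assumes "(f has_derivative f') (at y)"
  shows "f' v = (\<Sum>i\<in>UNIV. v $ i *\<^sub>R partial i f y)"
proof -
  interpret bounded_linear f' using assms by (rule has_derivative_bounded_linear)
  have "f' v = f' (\<Sum>i\<in>UNIV. v $ i *\<^sub>R axis i 1)" using axis_expansion[of v] by simp
  then show ?thesis
    by (simp add: partial_def frechet_derivative_at[OF assms, symmetric] sum scaleR)
qed

lemma partial_eqI: "(f has_derivative f') (at y) \<Longrightarrow> partial i f y = f' (axis i 1)"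
  by (metis frechet_derivative_at partial_def)

lemma C1_onI:
  assumes "open S" "\<And>y. y \<in> S \<Longrightarrow> (f has_derivative f' y) (at y)"
    and "\<And>i. continuous_on S (\<lambda>y. f' y (axis i 1))"
  shows "C1_on S f"
proof -
  have "f differentiable_on S"
    using assms(2) by (meson differentiableI differentiable_at_imp_differentiable_on)
  moreover have "continuous_on S (partial i f)" for i
    using assms(3)[of i] by (rule continuous_on_eq) (simp add: partial_eqI[OF assms(2)])
  ultimately show ?thesis by simp
qed

lemma C1_on_has_derivative:
  assumes "open S" "C1_on S f" "y \<in> S"
  shows "(f has_derivative frechet_derivative f (at y)) (at y)"
  using assms by (simp add: differentiable_on_eq_differentiable_at frechet_derivative_works)

lemma C1_on_continuous_derivative:
  fixes f :: "real ^ 'n::finite \<Rightarrow> 'b::real_normed_vector"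
  assumes "open S" "C1_on S f" "continuous_on S g"
  shows "continuous_on S (\<lambda>y. frechet_derivative f (at y) (g y))"
proof -
  have c: "continuous_on S (\<lambda>y. \<Sum>i\<in>UNIV. (g y $ i) *\<^sub>R partial i f y)"
    using assms by (intro continuous_intros) auto
  show ?thesis
    using c by (rule continuous_on_eq)
      (rule has_derivative_expansion[OF C1_on_has_derivative[OF assms(1,2)], symmetric])
qed

lemma C1_on_continuous_partial: "C1_on S f \<Longrightarrow> continuous_on S (partial i f)"
  by simp

lemma C1_on_continuous: "C1_on S f \<Longrightarrow> continuous_on S f"
  by (simp add: differentiable_imp_continuous_on)

lemma partial_cong:
  assumes "open S" "\<And>y. y \<in> S \<Longrightarrow> f y = g y" "y \<in> S"
  shows "partial i f y = partial i g y"
proof -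
  have "(f has_derivative D) (at y) \<longleftrightarrow> (g has_derivative D) (at y)" for D
    using assms by (metis has_derivative_transform_within_open)
  then show ?thesis by (simp add: partial_def frechet_derivative_def)
qed

lemma Ck_on_cong:
  assumes "open S" "\<And>y. y \<in> S \<Longrightarrow> f y = g y"
  shows "Ck_on k S f \<longleftrightarrow> Ck_on k S g"
  using assms(2)
proof (induction k arbitrary: f g)
  case 0
  then show ?case by (simp cong: continuous_on_cong)
next
  case (Suc k)
  have "Ck_on k S (partial i f) \<longleftrightarrow> Ck_on k S (partial i g)" for i
    by (rule Suc.IH) (rule partial_cong[OF assms(1) Suc.prems])
  moreover have "f differentiable_on S \<longleftrightarrow> g differentiable_on S"
    unfolding differentiable_on_def
    by (intro ball_cong refl iffI; erule differentiable_transform_within[where d = 1])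
      (auto simp: Suc.prems)
  ultimately show ?case by simp
qed

lemma C1_on_open_Un:
  assumes "open S" "open T" "C1_on S f" "C1_on T f"
  shows "C1_on (S \<union> T) f"
  using assms by (auto simp: differentiable_on_eq_differentiable_at[OF open_Un]
      differentiable_on_eq_differentiable_at intro: continuous_on_open_Un)

lemma Ck_on_const: "Ck_on k S (\<lambda>y :: real ^ 'n::finite. c)"
proof (induction k arbitrary: c)
  case (Suc k)
  have "partial i (\<lambda>y :: real ^ 'n. c) = (\<lambda>y. 0)" for i
    by (rule ext) (simp add: partial_def frechet_derivative_const)
  then show ?case by (simp add: Suc)
qed simp

text \<open>One argument serves the real, the complex and the scalar product.\<close>

lemma (in bounded_bilinear) C1_on_prod:
  fixes f :: "real ^ 'n::finite \<Rightarrow> 'a" and g :: "real ^ 'n \<Rightarrow> 'b"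
  assumes "open S" "C1_on S f" "C1_on S g"
  shows "C1_on S (\<lambda>y. f y ** g y)"
proof (rule C1_onI[OF assms(1)])
  show "((\<lambda>y. f y ** g y) has_derivative
      (\<lambda>v. f y ** frechet_derivative g (at y) v + frechet_derivative f (at y) v ** g y)) (at y)"
    if "y \<in> S" for y
    by (rule FDERIV) (use C1_on_has_derivative assms that in blast)+
  show "continuous_on S (\<lambda>y. f y ** frechet_derivative g (at y) (axis i 1)
      + frechet_derivative f (at y) (axis i 1) ** g y)" for i
    using assms by (intro continuous_on_add continuous_on C1_on_continuous_derivative C1_on_continuous
        continuous_on_const)
qed

lemmas C1_on_mult = bounded_bilinear.C1_on_prod[OF bounded_bilinear_mult]
lemmas C1_on_scaleR = bounded_bilinear.C1_on_prod[OF bounded_bilinear_scaleR]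

lemma (in bounded_bilinear) partial_prod:
  fixes f :: "real ^ 'n::finite \<Rightarrow> 'a" and g :: "real ^ 'n \<Rightarrow> 'b"
  assumes "open S" "C1_on S f" "C1_on S g" "y \<in> S"
  shows "partial i (\<lambda>y. f y ** g y) y = f y ** partial i g y + partial i f y ** g y"
  unfolding partial_def[of i f] partial_def[of i g]
  by (rule partial_eqI, rule FDERIV) (use C1_on_has_derivative assms in blast)+

lemma C1_on_bounded_linear:
  fixes f :: "real ^ 'n::finite \<Rightarrow> 'a::real_normed_vector"
  assumes "bounded_linear L" "open S" "C1_on S f"
  shows "C1_on S (\<lambda>y. L (f y))"
    and "y \<in> S \<Longrightarrow> partial i (\<lambda>y. L (f y)) y = L (partial i f y)"
proof -
  interpret bounded_linear L by fact
  have d: "((\<lambda>y. L (f y)) has_derivative (\<lambda>v. L (frechet_derivative f (at y) v))) (at y)"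
    if "y \<in> S" for y
    by (rule has_derivative) (use C1_on_has_derivative assms that in blast)
  show "C1_on S (\<lambda>y. L (f y))"
    by (rule C1_onI[OF assms(2) d])
      (use assms in \<open>auto intro!: continuous_on C1_on_continuous_derivative continuous_on_const\<close>)
  show "y \<in> S \<Longrightarrow> partial i (\<lambda>y. L (f y)) y = L (partial i f y)"
    unfolding partial_def[of i f] by (rule partial_eqI) (rule d)
qed

lemma
  fixes f :: "'k \<Rightarrow> real ^ 'n::finite \<Rightarrow> 'a::real_normed_vector"
  assumes "open S" "\<And>k. k \<in> I \<Longrightarrow> C1_on S (f k)"
  shows C1_on_sum: "C1_on S (\<lambda>y. \<Sum>k\<in>I. f k y)"
    and partial_sum: "y \<in> S \<Longrightarrow> partial i (\<lambda>y. \<Sum>k\<in>I. f k y) y = (\<Sum>k\<in>I. partial i (f k) y)"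
proof -
  have d: "((\<lambda>y. \<Sum>k\<in>I. f k y) has_derivative (\<lambda>v. \<Sum>k\<in>I. frechet_derivative (f k) (at y) v)) (at y)"
    if "y \<in> S" for y
    by (rule has_derivative_sum) (use C1_on_has_derivative assms that in blast)
  show "C1_on S (\<lambda>y. \<Sum>k\<in>I. f k y)"
    by (rule C1_onI[OF assms(1) d])
      (use assms in \<open>auto intro!: continuous_on_sum C1_on_continuous_derivative continuous_on_const\<close>)
  show "y \<in> S \<Longrightarrow> partial i (\<lambda>y. \<Sum>k\<in>I. f k y) y = (\<Sum>k\<in>I. partial i (f k) y)"
    unfolding partial_def[of i "f _"] by (rule partial_eqI) (rule d)
qed

lemma C1_on_compose:
  fixes f :: "real ^ 'n::finite \<Rightarrow> real ^ 'm::finite" and g :: "real ^ 'm \<Rightarrow> 'b::real_normed_vector"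
  assumes "open S" "open T" "C1_on S f" "C1_on T g" "f ` S \<subseteq> T"
  shows "C1_on S (g \<circ> f)"
    and "y \<in> S \<Longrightarrow> partial i (g \<circ> f) y = (\<Sum>k\<in>UNIV. (partial i f y $ k) *\<^sub>R partial k g (f y))"
proof -
  have d: "(g \<circ> f has_derivative frechet_derivative g (at (f y)) \<circ> frechet_derivative f (at y)) (at y)"
    if "y \<in> S" for y
    by (rule diff_chain_at) (use C1_on_has_derivative assms that in blast)+
  have e: "frechet_derivative g (at (f y)) v = (\<Sum>k\<in>UNIV. (v $ k) *\<^sub>R partial k g (f y))"
    if "y \<in> S" for y v
    by (rule has_derivative_expansion) (use C1_on_has_derivative assms that in blast)
  show p: "y \<in> S \<Longrightarrow> partial i (g \<circ> f) y = (\<Sum>k\<in>UNIV. (partial i f y $ k) *\<^sub>R partial k g (f y))" for y i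
    using partial_eqI[OF d] e by (simp add: partial_def)
  have "continuous_on S (\<lambda>y. \<Sum>k\<in>UNIV. (partial i f y $ k) *\<^sub>R partial k g (f y))" for i
    using assms C1_on_continuous[OF assms(3)]
    by (intro continuous_intros continuous_on_compose2[of T "partial _ g" S f] C1_on_continuous_partial) auto
  then have "continuous_on S (partial i (g \<circ> f))" for i
    by (rule continuous_on_eq) (simp add: p)
  moreover have "(g \<circ> f) differentiable_on S"
    using d assms(1) by (auto simp: differentiable_on_eq_differentiable_at differentiable_def)
  ultimately show "C1_on S (g \<circ> f)" by simp
qed

lemma C1_on_compose_real:
  fixes f :: "real ^ 'n::finite \<Rightarrow> real" and g :: "real \<Rightarrow> real"
  assumes "open S" "C1_on S f" "\<And>y. y \<in> S \<Longrightarrow> (g has_field_derivative g' (f y)) (at (f y))"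
    and "continuous_on (f ` S) g'"
  shows "C1_on S (\<lambda>y. g (f y))"
proof (rule C1_onI[OF assms(1)])
  show "((\<lambda>y. g (f y)) has_derivative (\<lambda>v. g' (f y) * frechet_derivative f (at y) v)) (at y)"
    if "y \<in> S" for y
    using diff_chain_at[OF C1_on_has_derivative[OF assms(1,2) that]
        assms(3)[OF that, unfolded has_field_derivative_def]] by (simp add: o_def)
  show "continuous_on S (\<lambda>y. g' (f y) * frechet_derivative f (at y) (axis i 1))" for i
    by (intro continuous_on_mult C1_on_continuous_derivative assms continuous_on_const
        continuous_on_compose2[OF assms(4) C1_on_continuous[OF assms(2)]]) auto
qed

lemma C1_on_sqrt:
  fixes f :: "real ^ 'n::finite \<Rightarrow> real"
  assumes "open S" "C1_on S f" "\<And>y. y \<in> S \<Longrightarrow> f y > 0"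
  shows "C1_on S (\<lambda>y. sqrt (f y))"
proof (rule C1_on_compose_real[OF assms(1,2), where g' = "\<lambda>x. inverse (sqrt x) / 2"])
  show "(sqrt has_real_derivative inverse (sqrt (f y)) / 2) (at (f y))" if "y \<in> S" for y
    using assms(3)[OF that] by (rule DERIV_real_sqrt)
  have "x \<noteq> 0" if "x \<in> f ` S" for x
    using assms(3) that by fastforce
  then show "continuous_on (f ` S) (\<lambda>x. inverse (sqrt x) / 2)"
    by (intro continuous_intros) auto
qed

lemma C1_on_inverse:
  fixes f :: "real ^ 'n::finite \<Rightarrow> real"
  assumes "open S" "C1_on S f" "\<And>y. y \<in> S \<Longrightarrow> f y \<noteq> 0"
  shows "C1_on S (\<lambda>y. inverse (f y))"
proof (rule C1_on_compose_real[OF assms(1,2), where g' = "\<lambda>x. - (inverse x ^ Suc (Suc 0))"])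
  show "(inverse has_real_derivative - (inverse (f y) ^ Suc (Suc 0))) (at (f y))" if "y \<in> S" for y
    using assms(3)[OF that] by (rule DERIV_inverse)
  have "x \<noteq> 0" if "x \<in> f ` S" for x
    using assms(3) that by fastforce
  then show "continuous_on (f ` S) (\<lambda>x. - (inverse x ^ Suc (Suc 0)))"
    by (intro continuous_intros) auto
qed

lemma C1_on_prod_set:
  fixes f :: "'k \<Rightarrow> real ^ 'n::finite \<Rightarrow> real"
  assumes "open S" "\<And>k. k \<in> I \<Longrightarrow> C1_on S (f k)"
  shows "C1_on S (\<lambda>y. \<Prod>k\<in>I. f k y)"
  using assms(2)
proof (induction I rule: infinite_finite_induct)
  case (insert k I)
  then show ?case by (simp del: Ck_on.simps add: C1_on_mult[OF assms(1)])
qed (simp_all del: Ck_on.simps add: Ck_on_const)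

text \<open>Determinants are polynomials in the entries, and by Cramer's rule the entries of the inverse are
  quotients of determinants; so the coefficients of the Laplacian inherit the regularity of the metric.\<close>

lemma C1_on_det:
  fixes H :: "real ^ 'n::finite \<Rightarrow> real ^ 'm::finite ^ 'm"
  assumes "open S" "\<And>i j. C1_on S (\<lambda>y. H y $ i $ j)"
  shows "C1_on S (\<lambda>y. det (H y))"
  unfolding det_def
  by (intro C1_on_sum C1_on_mult C1_on_prod_set assms Ck_on_const)

lemma matrix_inv_inverse:
  fixes A :: "real ^ 'n::finite ^ 'n"
  assumes "det A \<noteq> 0"
  shows "A ** matrix_inv A = mat 1" "matrix_inv A ** A = mat 1"
proof -
  have "\<exists>B. A ** B = mat 1 \<and> B ** A = mat 1"
    using assms by (simp add: invertible_det_nz[symmetric] invertible_def)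
  from someI_ex[OF this] show "A ** matrix_inv A = mat 1" "matrix_inv A ** A = mat 1"
    unfolding matrix_inv_def by auto
qed

lemma matrix_inv_cramer:
  fixes A :: "real ^ 'n::finite ^ 'n"
  assumes "det A \<noteq> 0"
  shows "matrix_inv A $ i $ j = det (\<chi> a b. if b = i then axis j 1 $ a else A $ a $ b) / det A"
proof -
  have "A *v (matrix_inv A *v axis j 1) = axis j 1"
    using assms by (simp add: matrix_vector_mul_assoc matrix_inv_inverse)
  then have "matrix_inv A *v axis j 1 = (\<chi> k. det (\<chi> a b. if b = k then axis j 1 $ a else A $ a $ b) / det A)"
    using cramer[OF assms] by blast
  then show ?thesis
    by (metis (no_types, lifting) column_def matrix_vector_mul_component matrix_vector_mult_basis vec_lambda_beta)
qed

lemma C1_on_matrix_inv: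
  fixes H :: "real ^ 'n::finite \<Rightarrow> real ^ 'm::finite ^ 'm"
  assumes "open S" "\<And>i j. C1_on S (\<lambda>y. H y $ i $ j)" "\<And>y. y \<in> S \<Longrightarrow> det (H y) \<noteq> 0"
  shows "C1_on S (\<lambda>y. matrix_inv (H y) $ i $ j)"
proof -
  have "C1_on S (\<lambda>y. det (\<chi> a b. if b = i then axis j 1 $ a else H y $ a $ b) * inverse (det (H y)))"
  proof (intro C1_on_mult C1_on_inverse C1_on_det assms)
    show "C1_on S (\<lambda>y. (\<chi> a b. if b = i then axis j 1 $ a else H y $ a $ b) $ i' $ j')" for i' j'
      using assms(2) by (cases "j' = i") (simp_all del: Ck_on.simps add: Ck_on_const)
  qed
  then show ?thesis
    by (subst Ck_on_cong[OF assms(1)]) (auto simp: matrix_inv_cramer[OF assms(3)] field_simps)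
qed

section \<open>Compactly supported functions on Euclidean space\<close>

lemma partial_eq_0_off_support:
  fixes f :: "real ^ 'n::finite \<Rightarrow> 'b::real_normed_vector"
  assumes "closed K" "\<And>y. y \<notin> K \<Longrightarrow> f y = 0" "y \<notin> K"
  shows "partial i f y = 0"
proof -
  have "partial i f y = partial i (\<lambda>y. 0) y"
    by (rule partial_cong[of "- K"]) (use assms in auto)
  then show ?thesis by (simp add: partial_def frechet_derivative_const)
qed

lemma integrable_compact_support:
  fixes f :: "'a::euclidean_space \<Rightarrow> 'b::{banach, second_countable_topology}"
  assumes "continuous_on UNIV f" "compact K" "\<And>y. y \<notin> K \<Longrightarrow> f y = 0"
  shows "integrable lborel f"
proof -
  have "integrable lborel (\<lambda>y. indicator K y *\<^sub>R f y)"
    using assms(1,2) by (intro borel_integrable_compact) (auto intro: continuous_on_subset)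
  also have "(\<lambda>y. indicator K y *\<^sub>R f y) = f"
    using assms(3) by (auto simp: indicator_def)
  finally show ?thesis .
qed

lemma lborel_integral_translate:
  fixes f :: "'a::euclidean_space \<Rightarrow> 'b::{banach, second_countable_topology}"
  assumes "f \<in> borel_measurable borel"
  shows "(LINT y|lborel. f (c + y)) = (LINT y|lborel. f y)"
  using integral_distr[of "(+) c" lborel borel f] assms by (simp add: lborel_distr_plus)

lemma lborel_integrable_translate:
  fixes f :: "'a::euclidean_space \<Rightarrow> 'b::{banach, second_countable_topology}"
  assumes "integrable lborel f"
  shows "integrable lborel (\<lambda>y. f (c + y))"
proof -
  have "f \<in> borel_measurable borel" using borel_measurable_integrable[OF assms] by simp
  then show ?thesis
    using assms integrable_distr_eq[of "(+) c" lborel borel f] by (simp add: lborel_distr_plus)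
qed

lemma lborel_nn_integral_translate:
  fixes f :: "'a::euclidean_space \<Rightarrow> ennreal"
  assumes "f \<in> borel_measurable borel"
  shows "(\<integral>\<^sup>+y. f (c + y) \<partial>lborel) = (\<integral>\<^sup>+y. f y \<partial>lborel)"
  using nn_integral_distr[of "(+) c" lborel borel f] assms by (simp add: lborel_distr_plus)

text \<open>The partial derivatives are continuous with compact support, hence bounded.\<close>

lemma C1_compact_support_lipschitz:
  fixes f :: "real ^ 'n::finite \<Rightarrow> 'b::real_normed_vector"
  assumes "C1_on UNIV f" "compact K" "\<And>y. y \<notin> K \<Longrightarrow> f y = 0"
  obtains B where "B \<ge> 0" "\<And>x y. norm (f x - f y) \<le> B * norm (x - y)"
proof -
  have "\<exists>b. \<forall>y. norm (partial i f y) \<le> b" for i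
  proof -
    have "bounded (partial i f ` K)"
      using assms by (intro compact_imp_bounded compact_continuous_image)
        (auto intro: continuous_on_subset)
    then obtain b where b: "\<And>y. y \<in> K \<Longrightarrow> norm (partial i f y) \<le> b"
      by (auto simp: bounded_iff)
    have "norm (partial i f y) \<le> max b 0" for y
      using b[of y] partial_eq_0_off_support[of K f, OF compact_imp_closed[OF assms(2)] assms(3)]
      by (cases "y \<in> K") (auto simp: max.coboundedI1)
    then show ?thesis by blast
  qed
  then obtain b where b: "\<And>i y. norm (partial i f y) \<le> b i" by metis
  have b0: "b i \<ge> 0" for i using b[of i 0] norm_ge_zero order_trans by blast
  have "norm (f x - f y) \<le> (\<Sum>i\<in>UNIV. b i) * norm (x - y)" for x y
  proof (rule differentiable_bound[of UNIV f "\<lambda>x. frechet_derivative f (at x)"])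
    fix x
    show d: "(f has_derivative frechet_derivative f (at x)) (at x)"
      using C1_on_has_derivative assms(1) by blast
    show "onorm (frechet_derivative f (at x)) \<le> (\<Sum>i\<in>UNIV. b i)"
    proof (rule onorm_le)
      fix v
      have "norm (frechet_derivative f (at x) v) \<le> (\<Sum>i\<in>UNIV. norm (v $ i *\<^sub>R partial i f x))"
        unfolding has_derivative_expansion[OF d] by (rule norm_sum)
      also have "\<dots> \<le> (\<Sum>i\<in>UNIV. norm v * b i)"
        using b component_le_norm_cart[of v] by (intro sum_mono) (auto intro: mult_mono)
      finally show "norm (frechet_derivative f (at x) v) \<le> (\<Sum>i\<in>UNIV. b i) * norm v"
        by (simp add: sum_distrib_left mult.commute)
    qed
  qed auto
  then show ?thesis using that[of "\<Sum>i\<in>UNIV. b i"] b0 by (simp add: sum_nonneg)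
qed

definition diff_quotient :: "(real ^ 'n::finite \<Rightarrow> 'b::real_normed_vector) \<Rightarrow> real ^ 'n \<Rightarrow> nat \<Rightarrow> real ^ 'n \<Rightarrow> 'b" where
  "diff_quotient f s m y = real (Suc m) *\<^sub>R (f (y + s /\<^sub>R real (Suc m)) - f y)"

lemma diff_quotient_tendsto:
  fixes f :: "real ^ 'n::finite \<Rightarrow> 'b::real_normed_vector"
  assumes "C1_on UNIV f"
  shows "(\<lambda>m. diff_quotient f s m y) \<longlonglongrightarrow> frechet_derivative f (at y) s"
proof -
  have d: "(f has_derivative frechet_derivative f (at y)) (at y)"
    using C1_on_has_derivative assms by blast
  have "((\<lambda>t. f (y + t *\<^sub>R s)) has_derivative (\<lambda>t. frechet_derivative f (at y) (t *\<^sub>R s))) (at 0)"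
    by (rule has_derivative_compose[of "\<lambda>t. y + t *\<^sub>R s" _ 0 UNIV f])
      (auto intro!: derivative_eq_intros d)
  then have "((\<lambda>t. norm (f (y + t *\<^sub>R s) - f y - frechet_derivative f (at y) (t *\<^sub>R s)) / norm t) \<longlongrightarrow> 0) (at 0)"
    by (simp add: has_derivative_at)
  then have "((\<lambda>t. norm ((f (y + t *\<^sub>R s) - f y) /\<^sub>R t - frechet_derivative f (at y) s)) \<longlongrightarrow> 0) (at 0)"
  proof (rule Lim_transform_eventually)
    have "norm (f (y + t *\<^sub>R s) - f y - frechet_derivative f (at y) (t *\<^sub>R s)) / norm t
        = norm ((f (y + t *\<^sub>R s) - f y) /\<^sub>R t - frechet_derivative f (at y) s)" if "t \<noteq> 0" for t
    proof -
      have "f (y + t *\<^sub>R s) - f y - frechet_derivative f (at y) (t *\<^sub>R s)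
          = t *\<^sub>R ((f (y + t *\<^sub>R s) - f y) /\<^sub>R t - frechet_derivative f (at y) s)"
        using that linear_scale[OF has_derivative_linear[OF d]] by (simp add: scaleR_diff_right)
      then show ?thesis using that by simp
    qed
    then show "\<forall>\<^sub>F t in at 0. norm (f (y + t *\<^sub>R s) - f y - frechet_derivative f (at y) (t *\<^sub>R s)) / norm t
        = norm ((f (y + t *\<^sub>R s) - f y) /\<^sub>R t - frechet_derivative f (at y) s)"
      by (auto simp: eventually_at_filter)
  qed
  then have "((\<lambda>t. (f (y + t *\<^sub>R s) - f y) /\<^sub>R t) \<longlongrightarrow> frechet_derivative f (at y) s) (at 0)"
    by (rule LIM_zero_cancel[OF tendsto_norm_zero_cancel])
  moreover have "filterlim (\<lambda>m. inverse (real (Suc m))) (at 0) sequentially"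
    using LIMSEQ_inverse_real_of_nat by (auto simp: filterlim_at)
  ultimately have "(\<lambda>m. (f (y + inverse (real (Suc m)) *\<^sub>R s) - f y) /\<^sub>R inverse (real (Suc m)))
      \<longlonglongrightarrow> frechet_derivative f (at y) s"
    by (rule filterlim_compose)
  then show ?thesis by (simp add: diff_quotient_def divideR_right)
qed

text \<open>A single dominating function serves all difference quotients.\<close>

lemma diff_quotient_dominated:
  fixes f :: "real ^ 'n::finite \<Rightarrow> 'b::real_normed_vector"
  assumes "C1_on UNIV f" "compact K" "\<And>y. y \<notin> K \<Longrightarrow> f y = 0"
  obtains B r where "B \<ge> 0" "\<And>m y. norm (diff_quotient f s m y) \<le> B * indicator (cball 0 r) y"
proof -
  obtain L where L: "L \<ge> 0" "\<And>x y. norm (f x - f y) \<le> L * norm (x - y)"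
    using C1_compact_support_lipschitz[OF assms] by blast
  obtain r where r: "\<And>y. y \<in> K \<Longrightarrow> norm y \<le> r"
    using compact_imp_bounded[OF assms(2)] by (auto simp: bounded_iff)
  have "norm (diff_quotient f s m y) \<le> (L * norm s) * indicator (cball 0 (r + norm s)) y" for m y
  proof (cases "norm y \<le> r + norm s")
    case True
    have "norm (diff_quotient f s m y) = real (Suc m) * norm (f (y + s /\<^sub>R real (Suc m)) - f y)"
      by (simp add: diff_quotient_def)
    also have "\<dots> \<le> real (Suc m) * (L * norm (s /\<^sub>R real (Suc m)))"
      using L(2)[of "y + s /\<^sub>R real (Suc m)" y] by (intro mult_left_mono) auto
    also have "\<dots> = L * norm s" by (simp add: field_simps)
    finally show ?thesis using True by simp
  next
    case False
    have "norm (s /\<^sub>R real (Suc m)) \<le> norm s"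
      using mult_left_le_one_le[of "norm s" "inverse (real (Suc m))"] by (simp add: field_simps)
    then have "norm (y + s /\<^sub>R real (Suc m)) > r"
      using False norm_triangle_ineq2[of y "- (s /\<^sub>R real (Suc m))"] by simp
    moreover have "norm y > r" using False norm_ge_zero[of s] by linarith
    ultimately have "f (y + s /\<^sub>R real (Suc m)) = 0" "f y = 0"
      using r assms(3) by (metis not_le)+
    then show ?thesis using False by (simp add: diff_quotient_def)
  qed
  then show ?thesis using that[of "L * norm s" "r + norm s"] L(1) by simp
qed

lemma borel_measurable_diff_quotient:
  fixes f :: "real ^ 'n::finite \<Rightarrow> complex"
  assumes "continuous_on UNIV f"
  shows "diff_quotient f s m \<in> borel_measurable lborel"
proof -
  have "continuous_on UNIV (\<lambda>y. f (y + s /\<^sub>R real (Suc m)))"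
    by (rule continuous_on_compose2[OF assms]) (auto intro!: continuous_intros)
  then have "continuous_on UNIV (diff_quotient f s m)"
    unfolding diff_quotient_def using assms by (intro continuous_intros)
  then show ?thesis by (simp add: borel_measurable_continuous_onI)
qed

text \<open>The integral of a difference quotient vanishes because Lebesgue measure is translation invariant.\<close>

lemma integral_partial_eq_0:
  fixes f :: "real ^ 'n::finite \<Rightarrow> complex"
  assumes "C1_on UNIV f" "compact K" "\<And>y. y \<notin> K \<Longrightarrow> f y = 0"
  shows "(LINT y|lborel. partial i f y) = 0"
proof -
  define s :: "real ^ 'n" where "s = axis i 1"
  have c: "continuous_on UNIV f" using assms(1) by (rule C1_on_continuous)
  have m[measurable]: "f \<in> borel_measurable borel" using c by (rule borel_measurable_continuous_onI)
  have int: "integrable lborel f" by (rule integrable_compact_support[OF c assms(2,3)])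
  obtain B r where B: "B \<ge> 0" "\<And>m y. norm (diff_quotient f s m y) \<le> B * indicator (cball 0 r) y"
    using diff_quotient_dominated[OF assms] by blast
  have "(\<lambda>m. LINT y|lborel. diff_quotient f s m y) \<longlonglongrightarrow> (LINT y|lborel. frechet_derivative f (at y) s)"
  proof (rule integral_dominated_convergence)
    show "(\<lambda>y. frechet_derivative f (at y) s) \<in> borel_measurable lborel"
      using C1_on_continuous_derivative[OF open_UNIV assms(1) continuous_on_const]
      by (simp add: borel_measurable_continuous_onI)
    show "diff_quotient f s m \<in> borel_measurable lborel" for m
      by (rule borel_measurable_diff_quotient[OF c])
    show "integrable lborel (\<lambda>y. B * indicator (cball 0 r) y :: real)"
      by (intro integrable_mult_right integrable_real_indicator) (auto simp: emeasure_lborel_cball_finite[simplified])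
  qed (use B diff_quotient_tendsto[OF assms(1)] in auto)
  moreover have "(LINT y|lborel. diff_quotient f s m y) = 0" for m
  proof -
    have "integrable lborel (\<lambda>y. f (s /\<^sub>R real (Suc m) + y))"
      by (rule lborel_integrable_translate[OF int])
    then show ?thesis
      unfolding diff_quotient_def add.commute[of _ "s /\<^sub>R real (Suc m)"]
      using int by (simp add: lborel_integral_translate del: of_nat_Suc)
  qed
  ultimately have "(\<lambda>m::nat. 0) \<longlonglongrightarrow> (LINT y|lborel. frechet_derivative f (at y) s)" by simp
  then show ?thesis
    unfolding partial_def s_def by (metis LIMSEQ_const_iff)
qed

definition gradient_sq :: "(real ^ 'n::finite \<Rightarrow> complex) \<Rightarrow> real ^ 'n \<Rightarrow> real" where
  "gradient_sq f y = (\<Sum>i\<in>UNIV. (cmod (partial i f y))\<^sup>2)"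

lemma derivative_le_gradient_sq:
  fixes f :: "real ^ 'n::finite \<Rightarrow> complex"
  assumes "(f has_derivative f') (at y)"
  shows "(cmod (f' s))\<^sup>2 \<le> (norm s)\<^sup>2 * gradient_sq f y"
proof -
  have "cmod (f' s) \<le> (\<Sum>i\<in>UNIV. \<bar>s $ i\<bar> * cmod (partial i f y))"
    unfolding has_derivative_expansion[OF assms] by (rule order_trans[OF norm_sum]) simp
  then have "(cmod (f' s))\<^sup>2 \<le> (\<Sum>i\<in>UNIV. \<bar>s $ i\<bar> * cmod (partial i f y))\<^sup>2"
    by (intro power_mono) auto
  also have "\<dots> \<le> (\<Sum>i\<in>UNIV. \<bar>s $ i\<bar>\<^sup>2) * (\<Sum>i\<in>UNIV. (cmod (partial i f y))\<^sup>2)"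
    by (rule Cauchy_Schwarz_ineq_sum)
  also have "(\<Sum>i\<in>UNIV. \<bar>s $ i\<bar>\<^sup>2) = (norm s)\<^sup>2"
    by (simp add: norm_vec_def L2_set_def sum_nonneg)
  finally show ?thesis by (simp add: gradient_sq_def)
qed

lemma continuous_on_gradient_sq: "C1_on S f \<Longrightarrow> continuous_on S (gradient_sq f)"
  unfolding gradient_sq_def
  by (intro continuous_intros) (auto simp: C1_on_continuous_partial)

text \<open>The increment over \<open>s\<close> is a sum of \<open>m\<close> translated increments over \<open>s / m\<close>, each with the same
  \<open>L2\<close> norm; as \<open>m\<close> grows, the difference quotients converge to the directional derivative.\<close>

lemma L2_translation_bound:
  fixes f :: "real ^ 'n::finite \<Rightarrow> complex"
  assumes "C1_on UNIV f" "compact K" "\<And>y. y \<notin> K \<Longrightarrow> f y = 0"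
  shows "(\<integral>\<^sup>+y. ennreal ((cmod (f (y + s) - f y))\<^sup>2) \<partial>lborel)
    \<le> ennreal ((norm s)\<^sup>2 * (LINT y|lborel. gradient_sq f y))"
proof -
  have c: "continuous_on UNIV f" using assms(1) by (rule C1_on_continuous)
  then have [measurable]: "f \<in> borel_measurable borel" by (rule borel_measurable_continuous_onI)
  have [measurable]: "diff_quotient f s m \<in> borel_measurable lborel" for m
    by (rule borel_measurable_diff_quotient[OF c])
  obtain B r where B: "B \<ge> 0" "\<And>m y. norm (diff_quotient f s m y) \<le> B * indicator (cball 0 r) y"
    using diff_quotient_dominated[OF assms] by blast
  let ?I = "\<integral>\<^sup>+y. ennreal ((cmod (f (y + s) - f y))\<^sup>2) \<partial>lborel"
  have step: "?I \<le> (\<integral>\<^sup>+y. ennreal ((cmod (diff_quotient f s m y))\<^sup>2) \<partial>lborel)" for m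
  proof -
    define n where "n = Suc m"
    define D where "D y = f (y + s /\<^sub>R real n) - f y" for y
    have [measurable]: "D \<in> borel_measurable borel" unfolding D_def by measurable
    have tele: "f (y + s) - f y = (\<Sum>k<n. D (y + (real k / real n) *\<^sub>R s))" for y
    proof -
      have "y + (real k / real n) *\<^sub>R s + s /\<^sub>R real n = y + (real (Suc k) / real n) *\<^sub>R s" for k
        by (simp add: add_divide_distrib scaleR_add_left divide_inverse algebra_simps)
      then have "(\<Sum>k<n. D (y + (real k / real n) *\<^sub>R s))
          = (\<Sum>k<n. f (y + (real (Suc k) / real n) *\<^sub>R s) - f (y + (real k / real n) *\<^sub>R s))"
        unfolding D_def by presburger
      also have "\<dots> = f (y + s) - f y"
        by (subst sum_lessThan_telescope) (simp add: n_def)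
      finally show ?thesis by simp
    qed
    have "(cmod (f (y + s) - f y))\<^sup>2 \<le> real n * (\<Sum>k<n. (cmod (D (y + (real k / real n) *\<^sub>R s)))\<^sup>2)" for y
    proof -
      have "(cmod (f (y + s) - f y))\<^sup>2 \<le> (\<Sum>k<n. cmod (D (y + (real k / real n) *\<^sub>R s)))\<^sup>2"
        unfolding tele by (intro power_mono norm_sum) auto
      also have "\<dots> \<le> (\<Sum>k<n. (cmod (D (y + (real k / real n) *\<^sub>R s)))\<^sup>2) * real (card {..<n})"
        by (rule sum_squared_le_sum_of_squares)
      finally show ?thesis by (simp add: mult.commute)
    qed
    then have "?I \<le> (\<integral>\<^sup>+y. ennreal (real n) * (\<Sum>k<n. ennreal ((cmod (D (y + (real k / real n) *\<^sub>R s)))\<^sup>2)) \<partial>lborel)"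
      by (intro nn_integral_mono) (simp add: ennreal_mult[symmetric] sum_nonneg)
    also have "\<dots> = ennreal (real n) * (\<Sum>k<n. \<integral>\<^sup>+y. ennreal ((cmod (D (y + (real k / real n) *\<^sub>R s)))\<^sup>2) \<partial>lborel)"
      by (subst nn_integral_cmult; (subst nn_integral_sum)?; measurable)
    also have "\<dots> = ennreal (real n) * (\<Sum>k<n. \<integral>\<^sup>+y. ennreal ((cmod (D y))\<^sup>2) \<partial>lborel)"
      by (subst add.commute) (subst lborel_nn_integral_translate, measurable)
    also have "\<dots> = ennreal ((real n)\<^sup>2) * (\<integral>\<^sup>+y. ennreal ((cmod (D y))\<^sup>2) \<partial>lborel)"
      by (simp add: power2_eq_square ennreal_mult mult.assoc ennreal_of_nat_eq_real_of_nat)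
    also have "\<dots> = (\<integral>\<^sup>+y. ennreal ((cmod (diff_quotient f s m y))\<^sup>2) \<partial>lborel)"
      by (subst nn_integral_cmult[symmetric], measurable)
        (simp add: diff_quotient_def D_def n_def ennreal_mult[symmetric] power_mult_distrib del: of_nat_Suc)
    finally show ?thesis .
  qed
  have "(\<lambda>m. \<integral>\<^sup>+y. ennreal ((cmod (diff_quotient f s m y))\<^sup>2) \<partial>lborel)
      \<longlonglongrightarrow> (\<integral>\<^sup>+y. ennreal ((cmod (frechet_derivative f (at y) s))\<^sup>2) \<partial>lborel)"
  proof (rule nn_integral_dominated_convergence[where w = "\<lambda>y. ennreal (B\<^sup>2) * indicator (cball 0 r) y"])
    show "(\<lambda>y. ennreal ((cmod (frechet_derivative f (at y) s))\<^sup>2)) \<in> borel_measurable lborel"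
      using borel_measurable_continuous_onI[OF C1_on_continuous_derivative[OF open_UNIV assms(1) continuous_on_const[of _ s]]]
      by measurable
    show "AE y in lborel. ennreal ((cmod (diff_quotient f s m y))\<^sup>2) \<le> ennreal (B\<^sup>2) * indicator (cball 0 r) y" for m
    proof (rule AE_I2)
      fix y :: "real ^ 'n"
      show "ennreal ((cmod (diff_quotient f s m y))\<^sup>2) \<le> ennreal (B\<^sup>2) * indicator (cball 0 r) y"
        using power_mono[OF B(2)[of m y] norm_ge_zero, of 2] by (cases "y \<in> cball 0 r") auto
    qed
    show "(\<integral>\<^sup>+y. ennreal (B\<^sup>2) * indicator (cball (0::real^'n) r) y \<partial>lborel) < \<infinity>"
      by (subst nn_integral_cmult_indicator)
        (auto simp: ennreal_mult_less_top emeasure_lborel_cball_finite[simplified])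
    show "AE y in lborel. (\<lambda>m. ennreal ((cmod (diff_quotient f s m y))\<^sup>2))
        \<longlonglongrightarrow> ennreal ((cmod (frechet_derivative f (at y) s))\<^sup>2)"
      by (intro AE_I2 tendsto_ennrealI tendsto_intros diff_quotient_tendsto assms)
    show "(\<lambda>y::real^'n. ennreal (B\<^sup>2) * indicator (cball 0 r) y) \<in> borel_measurable lborel"
      by (intro borel_measurable_times_ennreal borel_measurable_indicator) auto
  qed measurable
  then have "?I \<le> (\<integral>\<^sup>+y. ennreal ((cmod (frechet_derivative f (at y) s))\<^sup>2) \<partial>lborel)"
    by (rule LIMSEQ_le_const) (use step in auto)
  also have "\<dots> \<le> (\<integral>\<^sup>+y. ennreal ((norm s)\<^sup>2 * gradient_sq f y) \<partial>lborel)"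
    using derivative_le_gradient_sq[OF C1_on_has_derivative[OF open_UNIV assms(1) UNIV_I]]
    by (intro nn_integral_mono ennreal_leI)
  also have "\<dots> = ennreal (LINT y|lborel. (norm s)\<^sup>2 * gradient_sq f y)"
  proof (rule nn_integral_eq_integral)
    have "gradient_sq f y = 0" if "y \<notin> K" for y
      using partial_eq_0_off_support[OF compact_imp_closed[OF assms(2)] assms(3) that]
      by (simp add: gradient_sq_def)
    then show "integrable lborel (\<lambda>y. (norm s)\<^sup>2 * gradient_sq f y)"
      by (intro integrable_mult_right integrable_compact_support[OF _ assms(2)]
          continuous_on_gradient_sq assms(1))
  qed (simp add: gradient_sq_def sum_nonneg)
  finally show ?thesis by simp
qed

text \<open>Rellich compactness, for sequences that tend weakly to zero.  Averaging over balls of radius \<open>h\<close>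
  changes a function by at most \<open>h\<close> times its gradient in \<open>L2\<close>, and for fixed \<open>h\<close> the averages tend
  to zero pointwise and boundedly.\<close>

lemma weakly_null_imp_L2_null:
  fixes F :: "nat \<Rightarrow> real ^ 'n::finite \<Rightarrow> complex"
  assumes C1: "\<And>j. C1_on UNIV (F j)" and K: "compact K" "\<And>j y. y \<notin> K \<Longrightarrow> F j y = 0"
    and grad: "\<And>j. (LINT y|lborel. gradient_sq (F j) y) \<le> B"
    and L2: "\<And>j. (LINT y|lborel. (cmod (F j y))\<^sup>2) \<le> B"
    and weak: "\<And>y r. (\<lambda>j. LINT z|lborel. indicator (cball y r) z *\<^sub>R F j z) \<longlonglongrightarrow> 0"
  shows "(\<lambda>j. LINT y|lborel. (cmod (F j y))\<^sup>2) \<longlonglongrightarrow> 0"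
proof -
  have cont: "continuous_on UNIV (F j)" for j using C1 by (rule C1_on_continuous)
  then have [measurable]: "F j \<in> borel_measurable borel" for j by (rule borel_measurable_continuous_onI)
  have int2: "integrable lborel (\<lambda>y. (cmod (F j y))\<^sup>2)" for j
    by (rule integrable_compact_support[OF _ K(1)]) (auto intro!: continuous_intros cont simp: K(2))
  have nonneg2: "(LINT y|lborel. (cmod (F j y))\<^sup>2) \<ge> 0" for j by simp
  have B0: "B \<ge> 0" using order_trans[OF nonneg2 L2] .
  obtain r where r: "\<And>y. y \<in> K \<Longrightarrow> norm y \<le> r"
    using compact_imp_bounded[OF K(1)] by (auto simp: bounded_iff)
  have main: "\<exists>b. b \<longlonglongrightarrow> 0 \<and> (\<forall>j. (LINT y|lborel. (cmod (F j y))\<^sup>2) \<le> 2 * h\<^sup>2 * B + b j)" if h: "h > 0" for h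
  proof -
    define \<beta> where "\<beta> = measure lborel (cball (0::real^'n) h)"
    have \<beta>: "\<beta> > 0" unfolding \<beta>_def by (rule content_cball_pos[OF h])
    have finb: "emeasure lborel (cball (y::real^'n) t) < \<infinity>" for y t by (rule emeasure_lborel_cball_finite)
    define A where "A j y = (LINT s|lborel. indicator (cball 0 h) s *\<^sub>R F j (y + s))" for j y
    have pair: "g \<in> borel_measurable (M \<Otimes>\<^sub>M lborel)"
      if "g \<in> borel_measurable borel" "sets M = sets borel"
      for g :: "(real^'n) \<times> (real^'n) \<Rightarrow> 'c::topological_space" and M
    proof -
      have "sets (M \<Otimes>\<^sub>M (lborel :: (real^'n) measure)) = sets (borel \<Otimes>\<^sub>M borel)"
        by (intro sets_pair_measure_cong that) simp
      then show ?thesis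
        using that(1) measurable_cong_sets[of "M \<Otimes>\<^sub>M lborel" borel borel borel] borel_prod by metis
    qed
    have indm: "(\<lambda>x::(real^'n) \<times> (real^'n). indicator (cball 0 h) (snd x) :: real) \<in> borel_measurable borel"
    proof -
      have "(\<lambda>x::(real^'n) \<times> (real^'n). indicator (cball 0 h) (snd x) :: real) = indicator (UNIV \<times> cball 0 h)"
        by (auto simp: indicator_def fun_eq_iff)
      then show ?thesis by (simp add: closed_Times)
    qed
    have Fm: "(\<lambda>x. F j (fst x + snd x)) \<in> borel_measurable borel" "(\<lambda>x. F j (fst x)) \<in> borel_measurable borel"
      for j
      by (intro borel_measurable_continuous_onI continuous_on_compose2[OF cont] continuous_intros; simp)+
    have [measurable]: "A j \<in> borel_measurable borel" for j
      unfolding A_def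
      by (rule lborel.borel_measurable_lebesgue_integral)
        (use pair[OF borel_measurable_scaleR[OF indm Fm(1)], of borel] in \<open>simp add: case_prod_unfold\<close>)
    have cont_tr: "continuous_on UNIV (\<lambda>s. F j (y + s))" for j y
      by (rule continuous_on_compose2[OF cont]) (auto intro!: continuous_intros)
    have int_ball: "integrable lborel (\<lambda>s. indicator (cball 0 h) s *\<^sub>R f s)"
      if "continuous_on UNIV f" for f :: "real^'n \<Rightarrow> complex"
      using that by (intro borel_integrable_compact) (auto intro: continuous_on_subset)
    have int_ballr: "integrable lborel (\<lambda>s. indicator (cball 0 h) s *\<^sub>R f s)"
      if "continuous_on UNIV f" for f :: "real^'n \<Rightarrow> real"
      using that by (intro borel_integrable_compact) (auto intro: continuous_on_subset)
    have A_eq: "A j y = (LINT z|lborel. indicator (cball y h) z *\<^sub>R F j z)" for j y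
    proof -
      have "(LINT z|lborel. indicator (cball y h) z *\<^sub>R F j z)
          = (LINT s|lborel. indicator (cball y h) (y + s) *\<^sub>R F j (y + s))"
        by (subst lborel_integral_translate) (auto intro!: borel_measurable_scaleR borel_measurable_indicator)
      also have "\<dots> = A j y"
        unfolding A_def by (intro Bochner_Integration.integral_cong refl)
          (simp add: indicator_def dist_norm)
      finally show ?thesis by simp
    qed
    have A_bound: "cmod (A j y) \<le> (\<beta> + B) * indicator (cball 0 (r + h)) y" for j y
    proof (cases "norm y \<le> r + h")
      case True
      have "cmod (A j y) \<le> (LINT s|lborel. indicator (cball 0 h) s + (cmod (F j (y + s)))\<^sup>2)"
        unfolding A_def
      proof (rule Bochner_Integration.integral_norm_bound_integral)
        show "integrable lborel (\<lambda>s. indicator (cball 0 h) s + (cmod (F j (y + s)))\<^sup>2)"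
          using finb by (intro Bochner_Integration.integrable_add integrable_real_indicator
              lborel_integrable_translate[OF int2]) auto
        show "cmod (indicator (cball 0 h) s *\<^sub>R F j (y + s)) \<le> indicator (cball 0 h) s + (cmod (F j (y + s)))\<^sup>2" for s
        proof -
          have "t \<le> 1 + t\<^sup>2" if "t \<ge> 0" for t :: real
            using zero_le_power2[of "t - 1"] that by (simp add: power2_eq_square algebra_simps)
          then show ?thesis by (simp add: indicator_def)
        qed
      qed (use int_ball cont_tr in auto)
      also have "\<dots> = \<beta> + (LINT s|lborel. (cmod (F j (y + s)))\<^sup>2)"
        using finb lborel_integrable_translate[OF int2[of j], of y] unfolding \<beta>_def
        by (subst Bochner_Integration.integral_add) auto
      also have "\<dots> \<le> \<beta> + B"
        using L2[of j] by (subst lborel_integral_translate) auto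
      finally show ?thesis using True by simp
    next
      case False
      have "indicator (cball 0 h) s *\<^sub>R F j (y + s) = 0" for s
      proof (cases "norm s \<le> h")
        case True
        then have "norm (y + s) > r" using False norm_triangle_ineq2[of y "-s"] by simp
        then have "y + s \<notin> K" using r by force
        then show ?thesis by (simp add: K)
      qed simp
      then have "A j y = (LINT s|(lborel::(real^'n) measure). 0)" unfolding A_def by presburger
      then show ?thesis using False by simp
    qed
    have A_bound2: "(cmod (A j y))\<^sup>2 \<le> (\<beta> + B)\<^sup>2 * indicator (cball 0 (r + h)) y" for j y
      using power_mono[OF A_bound[of j y] norm_ge_zero, of 2] by (cases "y \<in> cball 0 (r + h)") auto
    have dom: "integrable lborel (\<lambda>y::real^'n. (\<beta> + B)\<^sup>2 * indicator (cball 0 (r + h)) y :: real)"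
      using finb by (intro integrable_mult_right integrable_real_indicator) auto
    have intA: "integrable lborel (\<lambda>y. (cmod (A j y))\<^sup>2)" for j
      by (rule Bochner_Integration.integrable_bound[OF dom]) (use A_bound2 in auto)
    have "(\<lambda>j. LINT y|lborel. (cmod (A j y))\<^sup>2) \<longlonglongrightarrow> (LINT y|(lborel::(real^'n) measure). 0)"
    proof (rule integral_dominated_convergence[OF _ _ dom])
      have "(\<lambda>j. (cmod (A j y))\<^sup>2) \<longlonglongrightarrow> (cmod 0)\<^sup>2" for y
        unfolding A_eq by (intro tendsto_intros weak)
      then show "AE y in lborel. (\<lambda>j. (cmod (A j y))\<^sup>2) \<longlonglongrightarrow> 0" by simp
    qed (use A_bound2 in auto)
    then have lim: "(\<lambda>j. LINT y|lborel. (cmod (A j y))\<^sup>2) \<longlonglongrightarrow> 0" by simp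
    have est: "(LINT y|lborel. (cmod (F j y))\<^sup>2) \<le> 2 * h\<^sup>2 * B + 4 / \<beta>\<^sup>2 * (LINT y|lborel. (cmod (A j y))\<^sup>2)" for j
    proof -
      \<comment> \<open>Expanding the square and absorbing the cross term avoids the Cauchy--Schwarz inequality.\<close>
      have point: "\<beta> / 2 * (cmod (F j y))\<^sup>2 \<le>
          (LINT s|lborel. indicator (cball 0 h) s *\<^sub>R (cmod (F j (y + s) - F j y))\<^sup>2)
            + 2 / \<beta> * (cmod (A j y))\<^sup>2" for y
      proof -
        define a where "a = F j y"
        have sq: "(cmod (b - a))\<^sup>2 \<ge> (cmod a)\<^sup>2 - 2 * Re (b * cnj a)" for b
        proof -
          have "(cmod (b - a))\<^sup>2 = (cmod b)\<^sup>2 + (cmod a)\<^sup>2 - 2 * Re (b * cnj a)"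
            unfolding cmod_power2 by (simp add: power2_eq_square algebra_simps)
          then show ?thesis by simp
        qed
        have "\<beta> * (cmod a)\<^sup>2 - 2 * Re (A j y * cnj a)
            = (LINT s|lborel. indicator (cball 0 h) s *\<^sub>R (cmod a)\<^sup>2
                - 2 * Re (indicator (cball 0 h) s *\<^sub>R F j (y + s) * cnj a))"
        proof (subst Bochner_Integration.integral_diff)
          have i: "integrable lborel (\<lambda>s. indicator (cball 0 h) s *\<^sub>R F j (y + s) * cnj a)"
            by (rule integrable_mult_left) (rule int_ball[OF cont_tr])
          show "integrable lborel (\<lambda>s. 2 * Re (indicator (cball 0 h) s *\<^sub>R F j (y + s) * cnj a))"
            by (intro integrable_mult_right integrable_Re i)
          have "(LINT s|lborel. 2 * Re (indicator (cball 0 h) s *\<^sub>R F j (y + s) * cnj a))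
              = 2 * Re (LINT s|lborel. indicator (cball 0 h) s *\<^sub>R F j (y + s) * cnj a)"
            using integral_Re[OF i] by simp
          also have "(LINT s|lborel. indicator (cball 0 h) s *\<^sub>R F j (y + s) * cnj a) = A j y * cnj a"
            unfolding A_def by (rule Bochner_Integration.integral_mult_left) (rule int_ball[OF cont_tr])
          finally show "\<beta> * (cmod a)\<^sup>2 - 2 * Re (A j y * cnj a) = (LINT s|lborel. indicator (cball (0::real^'n) h) s *\<^sub>R (cmod a)\<^sup>2)
              - (LINT s|lborel. 2 * Re (indicator (cball 0 h) s *\<^sub>R F j (y + s) * cnj a))"
            by (simp add: \<beta>_def)
        qed (intro int_ballr continuous_intros)
        also have "\<dots> \<le> (LINT s|lborel. indicator (cball 0 h) s *\<^sub>R (cmod (F j (y + s) - F j y))\<^sup>2)"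
        proof (rule Bochner_Integration.integral_mono)
          have i: "integrable lborel (\<lambda>s. indicator (cball 0 h) s *\<^sub>R F j (y + s) * cnj a)"
            by (rule integrable_mult_left) (rule int_ball[OF cont_tr])
          show "integrable lborel (\<lambda>s. indicator (cball 0 h) s *\<^sub>R (cmod a)\<^sup>2
                - 2 * Re (indicator (cball 0 h) s *\<^sub>R F j (y + s) * cnj a))"
            by (intro Bochner_Integration.integrable_diff integrable_mult_right integrable_Re i int_ballr
                continuous_on_const)
          show "integrable lborel (\<lambda>s. indicator (cball 0 h) s *\<^sub>R (cmod (F j (y + s) - F j y))\<^sup>2)"
            by (intro int_ballr continuous_intros cont_tr)
        qed (use sq in \<open>auto simp: indicator_def a_def\<close>)
        finally have 1: "\<beta> * (cmod a)\<^sup>2 - 2 * Re (A j y * cnj a)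
            \<le> (LINT s|lborel. indicator (cball 0 h) s *\<^sub>R (cmod (F j (y + s) - F j y))\<^sup>2)" .
        have "2 * Re (A j y * cnj a) \<le> 2 * (cmod (A j y) * cmod a)"
          using complex_Re_le_cmod[of "A j y * cnj a"] by (simp add: norm_mult)
        also have "\<dots> \<le> \<beta> / 2 * (cmod a)\<^sup>2 + 2 / \<beta> * (cmod (A j y))\<^sup>2"
        proof -
          have "0 \<le> (\<beta> * cmod a - 2 * cmod (A j y))\<^sup>2 / (2 * \<beta>)" using \<beta> by simp
          also have "\<dots> = \<beta> / 2 * (cmod a)\<^sup>2 + 2 / \<beta> * (cmod (A j y))\<^sup>2 - 2 * (cmod (A j y) * cmod a)"
            using \<beta> by (simp add: field_simps power2_eq_square)
          finally show ?thesis by simp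
        qed
        finally show ?thesis using 1 by (simp add: a_def)
      qed
      let ?\<Phi> = "\<lambda>y s. ennreal (indicator (cball 0 h) s * (cmod (F j (y + s) - F j y))\<^sup>2)"
      have Phi_m: "case_prod ?\<Phi> \<in> borel_measurable (M \<Otimes>\<^sub>M lborel)" if "sets M = sets borel" for M
        unfolding case_prod_unfold
      proof (intro pair that measurable_compose[OF _ measurable_ennreal] borel_measurable_times indm)
        show "(\<lambda>x. (cmod (F j (fst x + snd x) - F j (fst x)))\<^sup>2) \<in> borel_measurable borel"
          by (intro borel_measurable_continuous_onI continuous_intros continuous_on_compose2[OF cont]) auto
      qed
      have "(\<integral>\<^sup>+y. ennreal (\<beta> / 2 * (cmod (F j y))\<^sup>2) \<partial>lborel)
          \<le> (\<integral>\<^sup>+y. (\<integral>\<^sup>+s. ?\<Phi> y s \<partial>lborel) + ennreal (2 / \<beta> * (cmod (A j y))\<^sup>2) \<partial>lborel)"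
      proof (rule nn_integral_mono)
        fix y
        have "(\<integral>\<^sup>+s. ?\<Phi> y s \<partial>lborel)
            = ennreal (LINT s|lborel. indicator (cball 0 h) s *\<^sub>R (cmod (F j (y + s) - F j y))\<^sup>2)"
        proof -
          have "continuous_on UNIV (\<lambda>s. (cmod (F j (y + s) - F j y))\<^sup>2)"
            by (intro continuous_intros cont_tr)
          from int_ballr[OF this] show ?thesis
            by (subst nn_integral_eq_integral) auto
        qed
        then show "ennreal (\<beta> / 2 * (cmod (F j y))\<^sup>2) \<le> (\<integral>\<^sup>+s. ?\<Phi> y s \<partial>lborel) + ennreal (2 / \<beta> * (cmod (A j y))\<^sup>2)"
          using point[of y] \<beta>
          by (simp add: ennreal_plus[symmetric] ennreal_leI del: ennreal_plus)
      qed
      also have "\<dots> = (\<integral>\<^sup>+y. (\<integral>\<^sup>+s. ?\<Phi> y s \<partial>lborel) \<partial>lborel) + (\<integral>\<^sup>+y. ennreal (2 / \<beta> * (cmod (A j y))\<^sup>2) \<partial>lborel)"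
        using Phi_m[of borel] by (intro nn_integral_add lborel.borel_measurable_nn_integral) auto
      also have "(\<integral>\<^sup>+y. (\<integral>\<^sup>+s. ?\<Phi> y s \<partial>lborel) \<partial>lborel) = (\<integral>\<^sup>+s. (\<integral>\<^sup>+y. ?\<Phi> y s \<partial>lborel) \<partial>lborel)"
        using Phi_m[of lborel] by (intro lborel_pair.Fubini'[symmetric]) auto
      also have "\<dots> \<le> (\<integral>\<^sup>+s. ennreal (h\<^sup>2 * B) * indicator (cball (0::real^'n) h) s \<partial>lborel)"
      proof (rule nn_integral_mono)
        fix s :: "real^'n"
        show "(\<integral>\<^sup>+y. ?\<Phi> y s \<partial>lborel) \<le> ennreal (h\<^sup>2 * B) * indicator (cball 0 h) s"
        proof (cases "norm s \<le> h")
          case True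
          have "(\<integral>\<^sup>+y. ?\<Phi> y s \<partial>lborel) \<le> ennreal ((norm s)\<^sup>2 * (LINT y|lborel. gradient_sq (F j) y))"
            using L2_translation_bound[OF C1 K(1) K(2), of j s] True by simp
          also have "\<dots> \<le> ennreal (h\<^sup>2 * B)"
            using grad True B0 h by (intro ennreal_leI mult_mono power_mono)
              (auto simp: gradient_sq_def intro!: integral_nonneg_AE sum_nonneg)
          finally show ?thesis using True by simp
        qed simp
      qed
      also have "\<dots> = ennreal (h\<^sup>2 * B * \<beta>)"
        using finb B0 unfolding \<beta>_def
        by (subst nn_integral_cmult_indicator) (auto simp: emeasure_eq_ennreal_measure ennreal_mult less_top[symmetric])
      also have "(\<integral>\<^sup>+y. ennreal (2 / \<beta> * (cmod (A j y))\<^sup>2) \<partial>lborel) = ennreal (2 / \<beta> * (LINT y|lborel. (cmod (A j y))\<^sup>2))"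
        using \<beta> intA by (subst nn_integral_eq_integral) auto
      also have "(\<integral>\<^sup>+y. ennreal (\<beta> / 2 * (cmod (F j y))\<^sup>2) \<partial>lborel) = ennreal (\<beta> / 2 * (LINT y|lborel. (cmod (F j y))\<^sup>2))"
        using \<beta> int2 by (subst nn_integral_eq_integral) auto
      finally have "ennreal (\<beta> / 2 * (LINT y|lborel. (cmod (F j y))\<^sup>2))
          \<le> ennreal (h\<^sup>2 * B * \<beta> + 2 / \<beta> * (LINT y|lborel. (cmod (A j y))\<^sup>2))"
        using \<beta> B0 by (simp add: ennreal_plus[symmetric] add_right_mono del: ennreal_plus)
      then have "\<beta> / 2 * (LINT y|lborel. (cmod (F j y))\<^sup>2) \<le> h\<^sup>2 * B * \<beta> + 2 / \<beta> * (LINT y|lborel. (cmod (A j y))\<^sup>2)"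
        using \<beta> B0 by (subst (asm) ennreal_le_iff) auto
      then have "2 / \<beta> * (\<beta> / 2 * (LINT y|lborel. (cmod (F j y))\<^sup>2)) \<le> 2 / \<beta> * (h\<^sup>2 * B * \<beta> + 2 / \<beta> * (LINT y|lborel. (cmod (A j y))\<^sup>2))"
        using \<beta> by (intro mult_left_mono) auto
      then show ?thesis using \<beta> by (simp add: field_simps power2_eq_square)
    qed
    show ?thesis
      using est tendsto_mult_right_zero[OF lim, of "4 / \<beta>\<^sup>2"]
      by (intro exI[of _ "\<lambda>j. 4 / \<beta>\<^sup>2 * (LINT y|lborel. (cmod (A j y))\<^sup>2)"]) auto
  qed
  show ?thesis
  proof (rule LIMSEQ_I)
    fix \<epsilon> :: real assume \<epsilon>: "\<epsilon> > 0"
    define h where "h = sqrt (\<epsilon> / (4 * (B + 1)))"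
    have h: "h > 0" using \<epsilon> B0 by (simp add: h_def)
    have "2 * h\<^sup>2 * B = \<epsilon> / 2 * (B / (B + 1))" using \<epsilon> B0 by (simp add: h_def field_simps)
    also have "\<dots> \<le> \<epsilon> / 2 * 1" using \<epsilon> B0 by (intro mult_left_mono) auto
    finally have h2: "2 * h\<^sup>2 * B \<le> \<epsilon> / 2" by simp
    obtain b where b: "b \<longlonglongrightarrow> 0" "\<And>j. (LINT y|lborel. (cmod (F j y))\<^sup>2) \<le> 2 * h\<^sup>2 * B + b j"
      using main[OF h] by blast
    obtain N where N: "\<And>j. j \<ge> N \<Longrightarrow> \<bar>b j\<bar> < \<epsilon> / 2"
      using LIMSEQ_D[OF b(1), of "\<epsilon> / 2"] \<epsilon> by auto
    have "(LINT y|lborel. (cmod (F j y))\<^sup>2) < \<epsilon>" if "j \<ge> N" for j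
      using N[OF that] b(2)[of j] h2 by linarith
    then show "\<exists>N. \<forall>j\<ge>N. norm ((LINT y|lborel. (cmod (F j y))\<^sup>2) - 0) < \<epsilon>"
      using nonneg2 by auto
  qed
qed

lemma
  fixes g :: "real ^ 'n::finite \<Rightarrow> 'b::real_normed_vector"
  assumes "open S" "compact K" "K \<subseteq> S" "\<And>y. y \<in> S - K \<Longrightarrow> g y = 0"
  shows continuous_extend_by_0: "continuous_on S g \<Longrightarrow> continuous_on UNIV (\<lambda>y. if y \<in> S then g y else 0)"
    and C1_extend_by_0: "C1_on S g \<Longrightarrow> C1_on UNIV (\<lambda>y. if y \<in> S then g y else 0)"
proof -
  let ?f = "\<lambda>y. if y \<in> S then g y else 0"
  have K: "open (- K)" using assms(2) compact_imp_closed by blast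
  have U: "S \<union> - K = UNIV" using assms(3) by blast
  have f0: "?f y = 0" if "y \<in> - K" for y using that assms(4) by auto
  have ck: "Ck_on k (- K) ?f" for k
    by (subst Ck_on_cong[OF K f0]) (simp_all only: Ck_on_const)
  have cs: "Ck_on k S ?f \<longleftrightarrow> Ck_on k S g" for k
    by (rule Ck_on_cong[OF assms(1)]) simp
  show "C1_on UNIV ?f" if "C1_on S g"
    using C1_on_open_Un[OF assms(1) K, of ?f] that cs ck U by metis
  show "continuous_on UNIV ?f" if "continuous_on S g"
    using continuous_on_open_Un[OF assms(1) K, of ?f] that cs[of 0] ck[of 0] U by simp
qed

text \<open>The field times the test function, extended by zero, is C1 on the whole space, so that the integrals
  of its partial derivatives vanish.\<close>

lemma divergence_theorem:
  fixes X :: "'n::finite \<Rightarrow> real ^ 'n \<Rightarrow> complex" and k :: "real ^ 'n \<Rightarrow> complex"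
  assumes S: "open S" and X: "\<And>i. C1_on S (X i)" and k: "C1_on S k"
    and K: "compact K" "K \<subseteq> S" "\<And>y. y \<in> S - K \<Longrightarrow> k y = 0"
  shows "(LINT y|lborel. (if y \<in> S then (\<Sum>i\<in>UNIV. partial i (X i) y) * k y else 0))
       = - (LINT y|lborel. (if y \<in> S then \<Sum>i\<in>UNIV. X i y * partial i k y else 0))"
proof -
  have SK: "open (S - K)" using S K(1) compact_imp_closed by blast
  have pk: "partial i k y = 0" if "y \<in> S - K" for i y
    using partial_cong[OF SK, of k "\<lambda>y. 0"] K(3) that by (simp add: partial_def frechet_derivative_const)
  define f where "f i y = (if y \<in> S then X i y * k y else 0)" for i y
  define t1 where "t1 i y = (if y \<in> S then partial i (X i) y * k y else 0)" for i y
  define t2 where "t2 i y = (if y \<in> S then X i y * partial i k y else 0)" for i y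
  have f: "C1_on UNIV (f i)" for i unfolding f_def
    by (rule C1_extend_by_0[OF S K(1,2)]) (use K(3) C1_on_mult[OF S X k] in auto)
  have i1: "integrable lborel (t1 i)" for i unfolding t1_def
    by (rule integrable_compact_support[OF continuous_extend_by_0[OF S K(1,2)] K(1)])
      (use K(2,3) X C1_on_continuous[OF k] in \<open>auto intro!: continuous_intros\<close>)
  have i2: "integrable lborel (t2 i)" for i unfolding t2_def
    by (rule integrable_compact_support[OF continuous_extend_by_0[OF S K(1,2)] K(1)])
      (use K(2) pk k C1_on_continuous[OF X] in \<open>auto intro!: continuous_intros\<close>)
  have p: "partial i (f i) y = t1 i y + t2 i y" for i y
  proof (cases "y \<in> S")
    case True
    have "partial i (f i) y = partial i (\<lambda>y. X i y * k y) y"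
      by (rule partial_cong[OF S]) (auto simp: f_def True)
    also have "\<dots> = X i y * partial i k y + partial i (X i) y * k y"
      by (rule bounded_bilinear.partial_prod[OF bounded_bilinear_mult S X k True])
    finally show ?thesis using True by (simp add: t1_def t2_def)
  next
    case False
    then have "y \<notin> K" using K(2) by blast
    then show ?thesis
      using False partial_eq_0_off_support[OF compact_imp_closed[OF K(1)], of "f i" y i] K(3)
      by (simp add: f_def t1_def t2_def)
  qed
  have "(if y \<in> S then (\<Sum>i\<in>UNIV. partial i (X i) y) * k y else 0) = (\<Sum>i\<in>UNIV. t1 i y)"
    "(if y \<in> S then \<Sum>i\<in>UNIV. X i y * partial i k y else 0) = (\<Sum>i\<in>UNIV. t2 i y)" for y
    by (simp_all add: t1_def t2_def sum_distrib_right)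
  moreover have "(LINT y|lborel. (\<Sum>i\<in>UNIV. t1 i y)) + (LINT y|lborel. (\<Sum>i\<in>UNIV. t2 i y))
      = (\<Sum>i\<in>UNIV. LINT y|lborel. partial i (f i) y)"
    by (simp add: p i1 i2 sum.distrib)
  moreover have "(LINT y|lborel. partial i (f i) y) = 0" for i
    by (rule integral_partial_eq_0[OF f K(1)]) (use K(3) in \<open>simp add: f_def\<close>)
  ultimately show ?thesis by (simp add: add_eq_0_iff2)
qed

lemma matrix_posdef_det_pos:
  fixes A :: "real ^ 'n::finite ^ 'n"
  assumes "\<And>v. v \<noteq> 0 \<Longrightarrow> v \<bullet> (A *v v) > 0"
  shows "det A > 0"
proof (rule ccontr)
  assume n: "\<not> det A > 0"
  \<comment> \<open>The segment from the identity to \<open>A\<close> consists of positive definite, hence invertible, matrices.\<close>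
  define B where "B t = (1 - t) *\<^sub>R mat 1 + t *\<^sub>R A" for t :: real
  have nz: "det (B t) \<noteq> 0" if "0 \<le> t" "t \<le> 1" for t
  proof
    assume "det (B t) = 0"
    then obtain v where v: "v \<noteq> 0" "B t *v v = 0"
      by (metis invertible_det_nz invertible_left_inverse matrix_left_invertible_ker)
    have "v \<bullet> (B t *v v) = (1 - t) * (v \<bullet> v) + t * (v \<bullet> (A *v v))"
      by (simp add: B_def matrix_vector_mult_add_rdistrib inner_add_right scaleR_matrix_vector_assoc[symmetric])
    also have "\<dots> > 0"
      using v(1) assms[OF v(1)] that by (cases "t = 1") (auto intro: add_pos_nonneg)
    finally show False using v(2) by simp
  qed
  have "continuous_on {0..1} (\<lambda>t. det (B t))"
    unfolding B_def det_def by (intro continuous_intros)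
  moreover have "det (B 1) \<le> 0" "0 \<le> det (B 0)" using n by (auto simp: B_def)
  ultimately obtain t where "0 \<le> t" "t \<le> 1" "det (B t) = 0"
    using IVT2'[of "\<lambda>t. det (B t)" 1 0 0] by auto
  then show False using nz by blast
qed

section \<open>Charts and continuously differentiable functions on the manifold\<close>

abbreviation dom_chart :: "('a, 'n::finite) chart \<Rightarrow> 'a set" where "dom_chart c \<equiv> fst c"
abbreviation img_chart :: "('a, 'n::finite) chart \<Rightarrow> (real ^ 'n) set" where "img_chart c \<equiv> snd c ` fst c"
abbreviation inv_chart :: "('a, 'n::finite) chart \<Rightarrow> real ^ 'n \<Rightarrow> 'a" where "inv_chart c \<equiv> inv_into (fst c) (snd c)"

definition C1_fun :: "('a, 'n::finite) chart set \<Rightarrow> ('a \<Rightarrow> 'b::real_normed_vector) \<Rightarrow> bool" where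
  "C1_fun \<A> u \<longleftrightarrow> (\<forall>c\<in>\<A>. C1_on (img_chart c) (u \<circ> inv_chart c))"

lemma smooth_on_C1: "smooth_on S f \<Longrightarrow> C1_on S f"
  unfolding smooth_on_def by blast

lemma smooth_fun_chart:
  "smooth_fun \<A> u \<Longrightarrow> c \<in> \<A> \<Longrightarrow> smooth_on (img_chart c) (u \<circ> inv_chart c)"
  unfolding smooth_fun_def by (cases c) force

lemma smooth_fun_C1_fun: "smooth_fun \<A> u \<Longrightarrow> C1_fun \<A> u"
  unfolding C1_fun_def by (blast intro: smooth_on_C1 smooth_fun_chart)

context closed_riemannian_manifold
begin

lemma
  assumes "c \<in> \<A>"
  shows open_dom: "open (dom_chart c)" and open_img: "open (img_chart c)"
    and cont_chart: "continuous_on (dom_chart c) (snd c)"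
    and cont_inv_chart: "continuous_on (img_chart c) (inv_chart c)"
    and inv_chart_chart: "p \<in> dom_chart c \<Longrightarrow> inv_chart c (snd c p) = p"
    and chart_inv_chart: "y \<in> img_chart c \<Longrightarrow> snd c (inv_chart c y) = y"
    and inv_chart_in: "y \<in> img_chart c \<Longrightarrow> inv_chart c y \<in> dom_chart c"
proof -
  have "open (fst c) \<and> open (img_chart c) \<and> homeomorphism (fst c) (img_chart c) (snd c) (inv_chart c)"
    using chart_homeomorphism[of "fst c" "snd c"] assms by simp
  then show "open (dom_chart c)" "open (img_chart c)" "continuous_on (dom_chart c) (snd c)"
    "continuous_on (img_chart c) (inv_chart c)"
    "p \<in> dom_chart c \<Longrightarrow> inv_chart c (snd c p) = p"
    "y \<in> img_chart c \<Longrightarrow> snd c (inv_chart c y) = y"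
    "y \<in> img_chart c \<Longrightarrow> inv_chart c y \<in> dom_chart c"
    by (auto simp: homeomorphism_def)
qed

lemma ex_chart: obtains c where "c \<in> \<A>" "p \<in> dom_chart c"
proof -
  have "p \<in> (\<Union>(U, \<phi>)\<in>\<A>. U)" using charts_cover by simp
  then show ?thesis using that by auto
qed

lemma chart_image_eq: "c \<in> \<A> \<Longrightarrow> snd c ` (dom_chart c \<inter> W) = img_chart c \<inter> inv_chart c -` W"
  using inv_chart_chart by (auto simp: image_iff inv_into_into) 

lemma open_chart_image: "c \<in> \<A> \<Longrightarrow> open W \<Longrightarrow> open (snd c ` (dom_chart c \<inter> W))"
  unfolding chart_image_eq by (intro continuous_open_preimage cont_inv_chart open_img)

lemma transition_C1:
  assumes "c \<in> \<A>" "d \<in> \<A>"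
  shows "C1_on (snd c ` (dom_chart c \<inter> dom_chart d)) (snd d \<circ> inv_chart c)"
  using transition_smooth[of "fst c" "snd c" "fst d" "snd d"] assms by (simp only: prod.collapse smooth_on_C1)

lemma metric_C1:
  assumes "c \<in> \<A>"
  shows "C1_on (img_chart c) (\<lambda>y. G c (inv_chart c y) $ i $ j)"
proof -
  have "C1_on (img_chart c) (G c \<circ> inv_chart c)"
    using metric_smooth[of "fst c" "snd c"] assms by (simp only: prod.collapse smooth_on_C1)
  then have "C1_on (img_chart c) (\<lambda>y. (G c \<circ> inv_chart c) y $ i $ j)"
    by (intro C1_on_bounded_linear(1)[OF bounded_linear_compose[OF bounded_linear_vec_nth bounded_linear_vec_nth]]
        open_img assms)
  then show ?thesis by (simp only: o_def)
qed

lemma metric_pos: "c \<in> \<A> \<Longrightarrow> p \<in> dom_chart c \<Longrightarrow> v \<noteq> 0 \<Longrightarrow> v \<bullet> (G c p *v v) > 0"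
  using metric_positive[of "fst c" "snd c" p v] by simp

lemma metric_sym: "c \<in> \<A> \<Longrightarrow> p \<in> dom_chart c \<Longrightarrow> transpose (G c p) = G c p"
  using metric_symmetric[of "fst c" "snd c" p] by simp

lemma metric_det_pos: "c \<in> \<A> \<Longrightarrow> p \<in> dom_chart c \<Longrightarrow> det (G c p) > 0"
  by (rule matrix_posdef_det_pos) (rule metric_pos)

text \<open>The density of the Riemannian volume with respect to Lebesgue measure in a chart.\<close>

definition vol_density :: "('a, 'n) chart \<Rightarrow> real ^ 'n \<Rightarrow> real" where
  "vol_density c y = sqrt (det (G c (inv_chart c y)))"

lemma vol_density_pos: "c \<in> \<A> \<Longrightarrow> y \<in> img_chart c \<Longrightarrow> vol_density c y > 0"
  unfolding vol_density_def using metric_det_pos inv_chart_in by simp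

lemma vol_density_C1: "c \<in> \<A> \<Longrightarrow> C1_on (img_chart c) (vol_density c)"
  unfolding vol_density_def
  by (intro C1_on_sqrt C1_on_det metric_C1 open_img metric_det_pos inv_chart_in)

lemma inverse_metric_C1: "c \<in> \<A> \<Longrightarrow> C1_on (img_chart c) (\<lambda>y. matrix_inv (G c (inv_chart c y)) $ i $ j)"
  by (rule C1_on_matrix_inv[OF open_img metric_C1])
    (use metric_det_pos inv_chart_in less_irrefl in metis)+

lemma C1_fun_chart: "C1_fun \<A> u \<Longrightarrow> c \<in> \<A> \<Longrightarrow> C1_on (img_chart c) (u \<circ> inv_chart c)"
  unfolding C1_fun_def by blast

lemma continuous_on_via_charts:
  assumes "\<And>c. c \<in> \<A> \<Longrightarrow> continuous_on (img_chart c) (u \<circ> inv_chart c)"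
  shows "continuous_on UNIV u"
proof -
  have "isCont u p" for p
  proof -
    obtain c where c: "c \<in> \<A>" "p \<in> dom_chart c" by (rule ex_chart)
    have "continuous_on (dom_chart c) (\<lambda>q. (u \<circ> inv_chart c) (snd c q))"
      by (rule continuous_on_compose2[OF assms[OF c(1)] cont_chart[OF c(1)]]) simp
    then have "continuous_on (dom_chart c) u"
      by (rule continuous_on_eq) (simp add: inv_chart_chart[OF c(1)])
    then show ?thesis using c open_dom continuous_on_eq_continuous_at by blast
  qed
  then show ?thesis by (simp add: continuous_at_imp_continuous_on)
qed

lemma C1_fun_continuous: "C1_fun \<A> u \<Longrightarrow> continuous_on UNIV u"
  using continuous_on_via_charts C1_fun_chart C1_on_continuous by metis

lemma C1_fun_mult:
  fixes u v :: "'a \<Rightarrow> 'b::real_normed_algebra"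
  shows "C1_fun \<A> u \<Longrightarrow> C1_fun \<A> v \<Longrightarrow> C1_fun \<A> (\<lambda>p. u p * v p)"
  unfolding C1_fun_def o_def using C1_on_mult[OF open_img] by blast

lemma C1_fun_of_real: "C1_fun \<A> (u :: 'a \<Rightarrow> real) \<Longrightarrow> C1_fun \<A> (\<lambda>p. complex_of_real (u p))"
  unfolding C1_fun_def o_def using C1_on_bounded_linear(1)[OF bounded_linear_of_real open_img] by blast

lemma C1_fun_sum: "(\<And>k. k \<in> I \<Longrightarrow> C1_fun \<A> (u k)) \<Longrightarrow> C1_fun \<A> (\<lambda>p. \<Sum>k\<in>I. u k p)"
  unfolding C1_fun_def o_def by (intro ballI C1_on_sum open_img) blast+

lemma C1_fun_inverse: "C1_fun \<A> (u :: 'a \<Rightarrow> real) \<Longrightarrow> (\<And>p. u p \<noteq> 0) \<Longrightarrow> C1_fun \<A> (\<lambda>p. inverse (u p))"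
  unfolding C1_fun_def o_def by (intro ballI C1_on_inverse open_img) blast+

end

lemma has_field_derivative_max_0_square:
  "((\<lambda>t::real. (max 0 t)\<^sup>2) has_field_derivative 2 * max 0 t) (at t)"
proof -
  consider "t > 0" | "t < 0" | "t = 0" by linarith
  then show ?thesis
  proof cases
    case 1
    have "((\<lambda>t. t\<^sup>2) has_field_derivative 2 * t) (at t)" by (auto intro!: derivative_eq_intros)
    then show ?thesis using 1
      by (subst has_field_derivative_cong_ev[of t t UNIV _ "\<lambda>t. t\<^sup>2"])
        (auto intro!: eventually_mono[OF eventually_gt_at_top] simp: eventually_nhds max_def intro: exI[of _ "{0<..}"])
  next
    case 2
    have "((\<lambda>t. 0) has_field_derivative 0) (at t)" by simp
    then have "((\<lambda>t. (max 0 t)\<^sup>2) has_field_derivative 0) (at t)"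
      by (rule has_field_derivative_transform_within_open[of _ _ _ "{..<0}"]) (use 2 in auto)
    then show ?thesis using 2 by simp
  next
    case 3
    have "((\<lambda>h. ((max 0 (0 + h))\<^sup>2 - (max 0 0)\<^sup>2) / h) \<longlongrightarrow> 0) (at (0::real))"
    proof (rule Lim_null_comparison)
      show "\<forall>\<^sub>F h in at (0::real). norm (((max 0 (0 + h))\<^sup>2 - (max 0 0)\<^sup>2) / h) \<le> \<bar>h\<bar>"
        by (auto simp: eventually_at_filter max_def power2_eq_square)
      show "((\<lambda>h::real. \<bar>h\<bar>) \<longlongrightarrow> 0) (at 0)" by (auto intro!: tendsto_eq_intros)
    qed
    then show ?thesis using 3 by (simp add: DERIV_def)
  qed
qed

text \<open>Only one derivative is ever taken of a cutoff function, so a squared positive part will do.\<close>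

lemma C1_on_euclidean_bump:
  fixes a :: "real ^ 'n::finite"
  shows "C1_on UNIV (\<lambda>y. (max 0 (r\<^sup>2 - (y - a) \<bullet> (y - a)))\<^sup>2)"
proof (rule C1_on_compose_real[of UNIV _ "\<lambda>t. (max 0 t)\<^sup>2" "\<lambda>t. 2 * max 0 t"])
  show "C1_on UNIV (\<lambda>y. r\<^sup>2 - (y - a) \<bullet> (y - a))"
  proof (rule C1_onI)
    show "((\<lambda>y. r\<^sup>2 - (y - a) \<bullet> (y - a)) has_derivative (\<lambda>h. - 2 * ((y - a) \<bullet> h))) (at y)" for y
      by (auto intro!: derivative_eq_intros simp: inner_commute)
    show "continuous_on UNIV (\<lambda>y. - 2 * ((y - a) \<bullet> axis i 1))" for i
      by (intro continuous_intros)
  qed simp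
qed (auto intro!: has_field_derivative_max_0_square continuous_intros)

context closed_riemannian_manifold
begin

text \<open>In a second chart \<open>d\<close> the cutoff is C1 for two reasons: on the overlap with \<open>c\<close> it is the Euclidean
  bump composed with a transition map, and off the compact set \<open>K\<close> it vanishes.  \<open>K\<close> is closed because
  the manifold is Hausdorff.\<close>

lemma C1_fun_bump:
  assumes c: "c \<in> \<A>" and p: "p \<in> dom_chart c"
  obtains \<zeta> :: "'a \<Rightarrow> real" and K where "C1_fun \<A> \<zeta>" "compact K" "K \<subseteq> dom_chart c"
    "\<And>q. q \<notin> K \<Longrightarrow> \<zeta> q = 0" "\<And>q. \<zeta> q \<ge> 0" "\<zeta> p > 0"
proof -
  define a where "a = snd c p"
  obtain r where r: "r > 0" "cball a r \<subseteq> img_chart c"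
    using open_contains_cball open_img[OF c] p unfolding a_def by blast
  define b where "b y = (max 0 (r\<^sup>2 - (y - a) \<bullet> (y - a)))\<^sup>2" for y
  have b: "C1_on UNIV b" unfolding b_def by (rule C1_on_euclidean_bump)
  have b0: "b y = 0" if "y \<notin> cball a r" for y
  proof -
    have "r\<^sup>2 < (norm (y - a))\<^sup>2" using that r by (intro power_strict_mono) (auto simp: dist_norm norm_minus_commute)
    then show ?thesis by (simp add: b_def power2_norm_eq_inner)
  qed
  define K where "K = inv_chart c ` cball a r"
  have K: "compact K" unfolding K_def
    using r by (intro compact_continuous_image continuous_on_subset[OF cont_inv_chart[OF c]]) auto
  have Ksub: "K \<subseteq> dom_chart c" unfolding K_def using r inv_chart_in[OF c] by blast
  define \<zeta> where "\<zeta> q = (if q \<in> dom_chart c then b (snd c q) else 0)" for q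
  have \<zeta>0: "\<zeta> q = 0" if "q \<notin> K" for q
  proof (cases "q \<in> dom_chart c")
    case True
    then have "snd c q \<notin> cball a r" using that inv_chart_chart[OF c True] unfolding K_def by force
    then show ?thesis by (simp add: \<zeta>_def b0)
  qed (simp add: \<zeta>_def)
  have "C1_fun \<A> \<zeta>" unfolding C1_fun_def
  proof
    fix d assume d: "d \<in> \<A>"
    let ?S = "snd d ` (dom_chart d \<inter> dom_chart c)" and ?T = "snd d ` (dom_chart d \<inter> - K)"
    have S: "open ?S" by (rule open_chart_image[OF d open_dom[OF c]])
    have T: "open ?T" by (rule open_chart_image[OF d]) (use K compact_imp_closed in blast)
    have U: "?S \<union> ?T = img_chart d" using Ksub by blast
    have "C1_on ?S (b \<circ> (snd c \<circ> inv_chart d))"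
      by (rule C1_on_compose(1)[OF S open_UNIV transition_C1[OF d c] b]) simp
    then have 1: "C1_on ?S (\<zeta> \<circ> inv_chart d)"
      by (subst Ck_on_cong[OF S]) (auto simp: \<zeta>_def inv_chart_chart[OF d])
    have 2: "C1_on ?T (\<zeta> \<circ> inv_chart d)"
      by (subst Ck_on_cong[OF T, of _ "\<lambda>y. 0"]) (auto simp: \<zeta>0 inv_chart_chart[OF d] simp del: Ck_on.simps intro: Ck_on_const)
    show "C1_on (img_chart d) (\<zeta> \<circ> inv_chart d)"
      using C1_on_open_Un[OF S T 1 2] U by simp
  qed
  moreover have "\<zeta> p > 0" using p r by (simp add: \<zeta>_def b_def a_def)
  moreover have "\<zeta> q \<ge> 0" for q by (simp add: \<zeta>_def b_def)
  ultimately show ?thesis using that K Ksub \<zeta>0 by blast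
qed

text \<open>Finitely many bumps are positive somewhere at every point, by compactness; dividing them by their sum
  keeps them C1.\<close>

lemma partition_of_unity:
  obtains I :: "'a set" and c :: "'a \<Rightarrow> ('a, 'n) chart" and \<rho> :: "'a \<Rightarrow> 'a \<Rightarrow> real" and K :: "'a \<Rightarrow> 'a set"
  where "finite I" "\<And>k. k \<in> I \<Longrightarrow> c k \<in> \<A>" "\<And>k. k \<in> I \<Longrightarrow> C1_fun \<A> (\<rho> k)"
    "\<And>k. k \<in> I \<Longrightarrow> compact (K k)" "\<And>k. k \<in> I \<Longrightarrow> K k \<subseteq> dom_chart (c k)"
    "\<And>k q. k \<in> I \<Longrightarrow> q \<notin> K k \<Longrightarrow> \<rho> k q = 0" "\<And>q. (\<Sum>k\<in>I. \<rho> k q) = 1"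
proof -
  have "\<exists>c \<zeta> K. c \<in> \<A> \<and> C1_fun \<A> \<zeta> \<and> compact K \<and> K \<subseteq> dom_chart c \<and>
      (\<forall>q. q \<notin> K \<longrightarrow> \<zeta> q = (0::real)) \<and> (\<forall>q. \<zeta> q \<ge> 0) \<and> \<zeta> p > 0" for p
    by (metis ex_chart C1_fun_bump)
  then obtain c \<zeta> K where *: "\<And>p. c p \<in> \<A> \<and> C1_fun \<A> (\<zeta> p) \<and> compact (K p) \<and> K p \<subseteq> dom_chart (c p) \<and>
      (\<forall>q. q \<notin> K p \<longrightarrow> \<zeta> p q = (0::real)) \<and> (\<forall>q. \<zeta> p q \<ge> 0) \<and> \<zeta> p p > 0"
    by metis
  have "open {q. \<zeta> p q > 0}" for p
    using * C1_fun_continuous open_Collect_less[of "\<lambda>_. 0" "\<zeta> p"] by (metis continuous_on_const)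
  moreover have "UNIV \<subseteq> (\<Union>p\<in>UNIV. {q. \<zeta> p q > 0})"
    using * by auto
  ultimately obtain I where I: "finite I" "UNIV \<subseteq> (\<Union>p\<in>I. {q. \<zeta> p q > 0})"
    by (rule compactE_image[OF compact_space])
  define \<sigma> where "\<sigma> q = (\<Sum>k\<in>I. \<zeta> k q)" for q
  have \<sigma>: "\<sigma> q > 0" for q
  proof -
    have "q \<in> (\<Union>p\<in>I. {q. \<zeta> p q > 0})" using I(2) by (rule subsetD) simp
    then obtain k where "k \<in> I" "\<zeta> k q > 0" by auto
    then show ?thesis unfolding \<sigma>_def using * I(1) by (intro sum_pos2[of I k]) auto
  qed
  have \<sigma>0: "\<sigma> q \<noteq> 0" for q using \<sigma>[of q] by simp
  have "C1_fun \<A> \<sigma>" unfolding \<sigma>_def by (intro C1_fun_sum) (simp add: *)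
  then have "C1_fun \<A> (\<lambda>q. \<zeta> k q * inverse (\<sigma> q))" for k
    by (intro C1_fun_mult C1_fun_inverse \<sigma>0) (simp_all add: *)
  moreover have "(\<Sum>k\<in>I. \<zeta> k q * inverse (\<sigma> q)) = 1" for q
    using \<sigma>[of q] by (simp add: sum_distrib_right[symmetric] \<sigma>_def[symmetric])
  ultimately show ?thesis
    using that[of I c "\<lambda>k q. \<zeta> k q * inverse (\<sigma> q)" K] I(1) * by simp
qed

end

section \<open>The gradient form\<close>

lemma sum_reverse4:
  fixes t :: "'n::finite \<Rightarrow> 'n \<Rightarrow> 'n \<Rightarrow> 'n \<Rightarrow> 'b::comm_monoid_add"
  shows "(\<Sum>i\<in>UNIV. \<Sum>j\<in>UNIV. \<Sum>k\<in>UNIV. \<Sum>l\<in>UNIV. t i j k l) = (\<Sum>l\<in>UNIV. \<Sum>k\<in>UNIV. \<Sum>j\<in>UNIV. \<Sum>i\<in>UNIV. t i j k l)"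
proof -
  have rev3: "(\<Sum>j\<in>UNIV. \<Sum>k\<in>UNIV. \<Sum>l\<in>UNIV. s j k l) = (\<Sum>l\<in>UNIV. \<Sum>k\<in>UNIV. \<Sum>j\<in>UNIV. s j k l)"
    for s :: "'n \<Rightarrow> 'n \<Rightarrow> 'n \<Rightarrow> 'b"
  proof -
    have "(\<Sum>j\<in>UNIV. \<Sum>k\<in>UNIV. \<Sum>l\<in>UNIV. s j k l) = (\<Sum>j\<in>UNIV. \<Sum>l\<in>UNIV. \<Sum>k\<in>UNIV. s j k l)"
      by (rule sum.cong[OF refl], rule sum.swap)
    also have "\<dots> = (\<Sum>l\<in>UNIV. \<Sum>j\<in>UNIV. \<Sum>k\<in>UNIV. s j k l)" by (rule sum.swap)
    also have "\<dots> = (\<Sum>l\<in>UNIV. \<Sum>k\<in>UNIV. \<Sum>j\<in>UNIV. s j k l)"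
      by (rule sum.cong[OF refl], rule sum.swap)
    finally show ?thesis .
  qed
  have "(\<Sum>i\<in>UNIV. \<Sum>j\<in>UNIV. \<Sum>k\<in>UNIV. \<Sum>l\<in>UNIV. t i j k l) = (\<Sum>i\<in>UNIV. \<Sum>l\<in>UNIV. \<Sum>k\<in>UNIV. \<Sum>j\<in>UNIV. t i j k l)"
    by (rule sum.cong[OF refl], rule rev3)
  also have "\<dots> = (\<Sum>l\<in>UNIV. \<Sum>i\<in>UNIV. \<Sum>k\<in>UNIV. \<Sum>j\<in>UNIV. t i j k l)" by (rule sum.swap)
  also have "\<dots> = (\<Sum>l\<in>UNIV. \<Sum>k\<in>UNIV. \<Sum>i\<in>UNIV. \<Sum>j\<in>UNIV. t i j k l)"
    by (rule sum.cong[OF refl], rule sum.swap)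
  also have "\<dots> = (\<Sum>l\<in>UNIV. \<Sum>k\<in>UNIV. \<Sum>j\<in>UNIV. \<Sum>i\<in>UNIV. t i j k l)"
    by (rule sum.cong[OF refl], rule sum.cong[OF refl], rule sum.swap)
  finally show ?thesis .
qed

text \<open>The sesquilinear extension to complex covectors of a real bilinear form, here of an inverse metric.\<close>

definition sesqui_form :: "real ^ 'n::finite ^ 'n \<Rightarrow> ('n \<Rightarrow> complex) \<Rightarrow> ('n \<Rightarrow> complex) \<Rightarrow> complex" where
  "sesqui_form P a b = (\<Sum>i\<in>UNIV. \<Sum>j\<in>UNIV. complex_of_real (P $ i $ j) * (a j * cnj (b i)))"

lemma sesqui_form_transform:
  fixes P J :: "real ^ 'n::finite ^ 'n"
  shows "sesqui_form P (\<lambda>j. \<Sum>k\<in>UNIV. (J $ k $ j) *\<^sub>R a k) (\<lambda>i. \<Sum>l\<in>UNIV. (J $ l $ i) *\<^sub>R b l)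
       = sesqui_form (J ** P ** transpose J) a b"
proof -
  let ?t = "\<lambda>i j k l. complex_of_real (J $ l $ i * P $ i $ j * J $ k $ j) * (a k * cnj (b l))"
  have "sesqui_form P (\<lambda>j. \<Sum>k\<in>UNIV. (J $ k $ j) *\<^sub>R a k) (\<lambda>i. \<Sum>l\<in>UNIV. (J $ l $ i) *\<^sub>R b l)
      = (\<Sum>i\<in>UNIV. \<Sum>j\<in>UNIV. \<Sum>k\<in>UNIV. \<Sum>l\<in>UNIV. ?t i j k l)"
    unfolding sesqui_form_def cnj_sum sum_product
    unfolding sum_distrib_left
    by (intro sum.cong refl) (simp add: scaleR_conv_of_real mult_ac)
  also have "\<dots> = (\<Sum>l\<in>UNIV. \<Sum>k\<in>UNIV. \<Sum>j\<in>UNIV. \<Sum>i\<in>UNIV. ?t i j k l)"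
    by (rule sum_reverse4)
  also have "\<dots> = sesqui_form (J ** P ** transpose J) a b"
    unfolding sesqui_form_def matrix_matrix_mult_def transpose_def
    by (intro sum.cong refl) (simp add: sum_distrib_right)
  finally show ?thesis .
qed

lemma sesqui_form_cnj:
  assumes "transpose P = P"
  shows "cnj (sesqui_form P a b) = sesqui_form P b a"
proof -
  have "P $ i $ j = P $ j $ i" for i j
    using arg_cong[OF assms, of "\<lambda>M. M $ j $ i"] by (simp add: transpose_def)
  then have "cnj (sesqui_form P a b) = (\<Sum>i\<in>UNIV. \<Sum>j\<in>UNIV. complex_of_real (P $ j $ i) * (b i * cnj (a j)))"
    unfolding sesqui_form_def cnj_sum by (intro sum.cong refl) (simp add: mult_ac)
  then show ?thesis unfolding sesqui_form_def by (subst sum.swap)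
qed

lemma Re_sesqui_form:
  "Re (sesqui_form P a a) = (\<chi> i. Re (a i)) \<bullet> (P *v (\<chi> i. Re (a i))) + (\<chi> i. Im (a i)) \<bullet> (P *v (\<chi> i. Im (a i)))"
  unfolding sesqui_form_def matrix_vector_mult_def inner_vec_def
  by (simp add: sum_distrib_left sum.distrib[symmetric] algebra_simps)

lemma matrix_inv_posdef:
  fixes A :: "real ^ 'n::finite ^ 'n"
  assumes "\<And>v. v \<noteq> 0 \<Longrightarrow> v \<bullet> (A *v v) > 0" "v \<noteq> 0"
  shows "v \<bullet> (matrix_inv A *v v) > 0"
proof -
  have d: "det A \<noteq> 0" using matrix_posdef_det_pos[OF assms(1)] by simp
  define w where "w = matrix_inv A *v v"
  have v: "A *v w = v" by (simp add: w_def matrix_vector_mul_assoc matrix_inv_inverse[OF d])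
  have "w \<noteq> 0" using v assms(2) by auto
  from assms(1)[OF this] have "w \<bullet> v > 0" unfolding v .
  then show ?thesis unfolding w_def by (simp add: inner_commute)
qed

lemma matrix_inv_symmetric:
  fixes A :: "real ^ 'n::finite ^ 'n"
  assumes "det A \<noteq> 0" "transpose A = A"
  shows "transpose (matrix_inv A) = matrix_inv A"
proof -
  have "transpose (matrix_inv A) ** A = mat 1"
    using arg_cong[OF matrix_inv_inverse(1)[OF assms(1)], of transpose] assms(2)
    by (simp add: matrix_transpose_mul)
  then have "transpose (matrix_inv A) ** A ** matrix_inv A = matrix_inv A" by simp
  then show ?thesis by (simp add: matrix_mul_assoc[symmetric] matrix_inv_inverse[OF assms(1)])
qed

text \<open>The quotient of the form by the squared norm is homogeneous of degree zero, so that it suffices to bound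
  it on the compact set of pairs of a point and a unit vector.\<close>

lemma compact_quadratic_form_bounds:
  fixes M :: "'a::topological_space \<Rightarrow> real ^ 'n::finite ^ 'n"
  assumes K: "compact K" and M: "\<And>i j. continuous_on K (\<lambda>p. M p $ i $ j)"
  shows "\<exists>B>0. \<forall>p\<in>K. \<forall>v. v \<bullet> (M p *v v) \<le> B * (norm v)\<^sup>2"
    and "(\<And>p v. p \<in> K \<Longrightarrow> v \<noteq> 0 \<Longrightarrow> v \<bullet> (M p *v v) > 0) \<Longrightarrow>
      \<exists>b>0. \<forall>p\<in>K. \<forall>v. (norm v)\<^sup>2 \<le> b * (v \<bullet> (M p *v v))"
proof -
  define q where "q z = snd z \<bullet> (M (fst z) *v snd z)" for z :: "'a \<times> (real ^ 'n)"
  have qc: "continuous_on (K \<times> sphere 0 1) q"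
    unfolding q_def inner_vec_def matrix_vector_mult_def
    by (auto intro!: continuous_intros continuous_on_compose2[OF M continuous_on_fst[OF continuous_on_id]])
  have cp: "compact (K \<times> sphere (0::real^'n) 1)" using K by (intro compact_Times) auto
  have hom: "v \<bullet> (M p *v v) = (norm v)\<^sup>2 * q (p, v /\<^sub>R norm v)" if "v \<noteq> 0" for p v
    using that by (simp add: q_def matrix_vector_mult_scaleR power2_eq_square field_simps)
  have S: "(p, v /\<^sub>R norm v) \<in> K \<times> sphere 0 1" if "v \<noteq> 0" "p \<in> K" for p and v :: "real^'n"
    using that by (simp add: norm_mult)
  have "bounded (q ` (K \<times> sphere 0 1))"
    by (intro compact_imp_bounded compact_continuous_image qc cp)
  then obtain B where B: "\<And>z. z \<in> K \<times> sphere 0 1 \<Longrightarrow> \<bar>q z\<bar> \<le> B" by (auto simp: bounded_iff)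
  have "v \<bullet> (M p *v v) \<le> max B 1 * (norm v)\<^sup>2" if "p \<in> K" for p v
  proof (cases "v = 0")
    case False
    have "q (p, v /\<^sub>R norm v) \<le> max B 1" using B[OF S[OF False that]] by linarith
    then show ?thesis using hom[OF False] by (metis mult.commute mult_right_mono zero_le_power2)
  qed simp
  then show "\<exists>B>0. \<forall>p\<in>K. \<forall>v. v \<bullet> (M p *v v) \<le> B * (norm v)\<^sup>2"
    by (intro exI[of _ "max B 1"]) auto
  assume pos: "\<And>p v. p \<in> K \<Longrightarrow> v \<noteq> 0 \<Longrightarrow> v \<bullet> (M p *v v) > 0"
  show "\<exists>b>0. \<forall>p\<in>K. \<forall>v. (norm v)\<^sup>2 \<le> b * (v \<bullet> (M p *v v))"
  proof (cases "K \<times> sphere (0::real^'n) 1 = {}")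
    case True
    then have "K = {}" by auto
    then show ?thesis by (intro exI[of _ 1]) auto
  next
    case False
    obtain z where z: "z \<in> K \<times> sphere 0 1" "\<And>z'. z' \<in> K \<times> sphere 0 1 \<Longrightarrow> q z \<le> q z'"
      using continuous_attains_inf[OF cp False qc] by blast
    have qz: "q z > 0" unfolding q_def using z(1) by (intro pos) auto
    have "(norm v)\<^sup>2 \<le> inverse (q z) * (v \<bullet> (M p *v v))" if "p \<in> K" for p v
    proof (cases "v = 0")
      case False
      have "(norm v)\<^sup>2 * q z \<le> (norm v)\<^sup>2 * q (p, v /\<^sub>R norm v)"
        by (intro mult_left_mono z S False that) auto
      then show ?thesis unfolding hom[OF False] using qz by (simp add: field_simps)
    qed simp
    then show ?thesis using qz by (intro exI[of _ "inverse (q z)"]) auto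
  qed
qed

context closed_riemannian_manifold
begin

abbreviation cpartial :: "('a, 'n) chart \<Rightarrow> ('a \<Rightarrow> complex) \<Rightarrow> 'a \<Rightarrow> 'n \<Rightarrow> complex" where
  "cpartial c u p i \<equiv> partial i (u \<circ> inv_chart c) (snd c p)"

text \<open>The pointwise inner product \<open>g(\<nabla>u, \<nabla>w)\<close> of the gradients.\<close>

definition chart_gradient_form :: "('a, 'n) chart \<Rightarrow> ('a \<Rightarrow> complex) \<Rightarrow> ('a \<Rightarrow> complex) \<Rightarrow> 'a \<Rightarrow> complex" where
  "chart_gradient_form c u w p = sesqui_form (matrix_inv (G c p)) (cpartial c u p) (cpartial c w p)"

lemma cpartial_transform:
  assumes "c \<in> \<A>" "d \<in> \<A>" "p \<in> dom_chart c" "p \<in> dom_chart d" "C1_fun \<A> u"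
  shows "cpartial c u p j =
    (\<Sum>k\<in>UNIV. (partial j (snd d \<circ> inv_chart c) (snd c p) $ k) *\<^sub>R cpartial d u p k)"
proof -
  let ?S = "snd c ` (dom_chart c \<inter> dom_chart d)" and ?f = "snd d \<circ> inv_chart c"
  have S: "open ?S" by (rule open_chart_image[OF assms(1) open_dom[OF assms(2)]])
  have p: "snd c p \<in> ?S" using assms by blast
  have "cpartial c u p j = partial j ((u \<circ> inv_chart d) \<circ> ?f) (snd c p)"
    by (rule partial_cong[OF S _ p]) (auto simp: inv_chart_chart[OF assms(1)] inv_chart_chart[OF assms(2)])
  also have "\<dots> = (\<Sum>k\<in>UNIV. (partial j ?f (snd c p) $ k) *\<^sub>R partial k (u \<circ> inv_chart d) (?f (snd c p)))"
    by (rule C1_on_compose(2)[OF S open_img[OF assms(2)] transition_C1[OF assms(1,2)]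
          C1_fun_chart[OF assms(5,2)] _ p]) (auto simp: inv_chart_chart[OF assms(1)])
  finally show ?thesis by (simp add: inv_chart_chart[OF assms(1,3)])
qed

text \<open>The Jacobian \<open>J\<close> of the change of charts acts on the inverse metric by congruence and on the
  coordinate gradients by its transpose; the two actions cancel.\<close>

lemma chart_gradient_form_independent:
  assumes c: "c \<in> \<A>" "p \<in> dom_chart c" and d: "d \<in> \<A>" "p \<in> dom_chart d"
    and u: "C1_fun \<A> u" and w: "C1_fun \<A> w"
  shows "chart_gradient_form c u w p = chart_gradient_form d u w p"
proof -
  define J where "J = matrix (frechet_derivative (snd d \<circ> inv_chart c) (at (snd c p)))"
  have J: "J $ k $ j = partial j (snd d \<circ> inv_chart c) (snd c p) $ k" for k j
    by (simp add: J_def matrix_def partial_def)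
  have Gc: "G c p = transpose J ** G d p ** J"
    using metric_transformation[of "fst c" "snd c" "fst d" "snd d" p J] assms by (simp add: J_def)
  have dc: "det (G c p) \<noteq> 0" and dd: "det (G d p) \<noteq> 0"
    using metric_det_pos[OF c] metric_det_pos[OF d] by auto
  have dJ: "det J \<noteq> 0" using dc unfolding Gc by (auto simp: det_mul)
  have "(J ** matrix_inv (G c p) ** transpose J ** G d p) ** J = J ** (matrix_inv (G c p) ** G c p)"
    by (simp add: Gc matrix_mul_assoc)
  also have "\<dots> = J" by (simp add: matrix_inv_inverse[OF dc])
  finally have "(J ** matrix_inv (G c p) ** transpose J ** G d p) ** J ** matrix_inv J = J ** matrix_inv J" by simp
  then have "J ** matrix_inv (G c p) ** transpose J ** G d p = mat 1"
    by (simp add: matrix_mul_assoc[symmetric] matrix_inv_inverse[OF dJ])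
  then have "(J ** matrix_inv (G c p) ** transpose J ** G d p) ** matrix_inv (G d p) = matrix_inv (G d p)" by simp
  then have P: "J ** matrix_inv (G c p) ** transpose J = matrix_inv (G d p)"
    by (simp add: matrix_mul_assoc[symmetric] matrix_inv_inverse[OF dd])
  show ?thesis
    unfolding chart_gradient_form_def cpartial_transform[OF c(1) d(1) c(2) d(2) u]
      cpartial_transform[OF c(1) d(1) c(2) d(2) w] J[symmetric] sesqui_form_transform P ..
qed

definition gradient_form :: "('a \<Rightarrow> complex) \<Rightarrow> ('a \<Rightarrow> complex) \<Rightarrow> 'a \<Rightarrow> complex" where
  "gradient_form u w p = chart_gradient_form (SOME c. c \<in> \<A> \<and> p \<in> dom_chart c) u w p"

lemma gradient_form_chart:
  assumes "c \<in> \<A>" "p \<in> dom_chart c" "C1_fun \<A> u" "C1_fun \<A> w"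
  shows "gradient_form u w p = chart_gradient_form c u w p"
proof -
  have "(SOME c. c \<in> \<A> \<and> p \<in> dom_chart c) \<in> \<A> \<and> p \<in> dom_chart (SOME c. c \<in> \<A> \<and> p \<in> dom_chart c)"
    by (rule someI[of _ c]) (simp add: assms)
  then show ?thesis
    unfolding gradient_form_def using chart_gradient_form_independent assms by blast
qed

lemma gradient_form_continuous:
  assumes u: "C1_fun \<A> u" and w: "C1_fun \<A> w"
  shows "continuous_on UNIV (gradient_form u w)"
proof (rule continuous_on_via_charts)
  fix c assume c: "c \<in> \<A>"
  have "continuous_on (img_chart c) (\<lambda>y. \<Sum>i\<in>UNIV. \<Sum>j\<in>UNIV. complex_of_real (matrix_inv (G c (inv_chart c y)) $ i $ j)
      * (partial j (u \<circ> inv_chart c) y * cnj (partial i (w \<circ> inv_chart c) y)))"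
    by (intro continuous_intros C1_on_continuous[OF inverse_metric_C1[OF c]]
        C1_on_continuous_partial C1_fun_chart u w c)
  then show "continuous_on (img_chart c) (gradient_form u w \<circ> inv_chart c)"
    by (rule continuous_on_eq)
      (simp add: gradient_form_chart[OF c inv_chart_in[OF c] u w] chart_gradient_form_def sesqui_form_def
        chart_inv_chart[OF c])
qed

lemma gradient_form_cnj:
  assumes "C1_fun \<A> u" "C1_fun \<A> w"
  shows "cnj (gradient_form u w p) = gradient_form w u p"
proof -
  obtain c where c: "c \<in> \<A>" "p \<in> dom_chart c" by (rule ex_chart)
  have "det (G c p) \<noteq> 0" using metric_det_pos[OF c] by simp
  then show ?thesis
    by (simp add: gradient_form_chart[OF c] assms chart_gradient_form_def sesqui_form_cnj
        matrix_inv_symmetric metric_sym[OF c])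
qed

lemma gradient_form_sum_right:
  assumes "C1_fun \<A> u" "\<And>k. k \<in> I \<Longrightarrow> C1_fun \<A> (w k)"
  shows "gradient_form u (\<lambda>q. \<Sum>k\<in>I. w k q) p = (\<Sum>k\<in>I. gradient_form u (w k) p)"
proof -
  obtain c where c: "c \<in> \<A>" "p \<in> dom_chart c" by (rule ex_chart)
  have y: "snd c p \<in> img_chart c" using c by blast
  have "cpartial c (\<lambda>q. \<Sum>k\<in>I. w k q) p i = (\<Sum>k\<in>I. cpartial c (w k) p i)" for i
    using partial_sum[OF open_img[OF c(1)], of I "\<lambda>k. w k \<circ> inv_chart c", OF C1_fun_chart[OF assms(2) c(1)] y]
    by (simp add: o_def)
  then have "chart_gradient_form c u (\<lambda>q. \<Sum>k\<in>I. w k q) p = (\<Sum>k\<in>I. chart_gradient_form c u (w k) p)"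
    unfolding chart_gradient_form_def sesqui_form_def
    by (simp add: cnj_sum sum_distrib_left sum.swap[of _ I UNIV])
  moreover have "C1_fun \<A> (\<lambda>q. \<Sum>k\<in>I. w k q)" by (rule C1_fun_sum) (rule assms(2))
  ultimately show ?thesis by (simp add: gradient_form_chart[OF c assms(1)] assms(2))
qed

lemma gradient_form_eq_0:
  assumes "C1_fun \<A> u" "C1_fun \<A> w" "open W" "p \<in> W" "\<And>q. q \<in> W \<Longrightarrow> w q = 0"
  shows "gradient_form u w p = 0"
proof -
  obtain c where c: "c \<in> \<A>" "p \<in> dom_chart c" by (rule ex_chart)
  have "cpartial c w p i = partial i (\<lambda>y. 0) (snd c p)" for i
    by (rule partial_cong[OF open_chart_image[OF c(1) assms(3)]])
      (use assms c inv_chart_chart[OF c(1)] in auto)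
  then show ?thesis
    by (simp add: gradient_form_chart[OF c assms(1,2)] chart_gradient_form_def sesqui_form_def partial_def
        frechet_derivative_const)
qed

text \<open>The metric is comparable to the Euclidean one on a compact part of a chart.\<close>

lemma gradient_form_coercive:
  assumes c: "c \<in> \<A>" and K: "compact K" "K \<subseteq> dom_chart c"
  obtains b where "b > 0"
    "\<And>u p. C1_fun \<A> u \<Longrightarrow> p \<in> K \<Longrightarrow> gradient_sq (u \<circ> inv_chart c) (snd c p) \<le> b * Re (gradient_form u u p)"
proof -
  have "continuous_on K (\<lambda>p. matrix_inv (G c p) $ i $ j)" for i j
  proof -
    have "continuous_on K (\<lambda>p. matrix_inv (G c (inv_chart c (snd c p))) $ i $ j)"
      by (rule continuous_on_compose2[OF C1_on_continuous[OF inverse_metric_C1[OF c]]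
            continuous_on_subset[OF cont_chart[OF c] K(2)]]) (use K(2) in blast)
    then show ?thesis
      by (rule continuous_on_eq) (use K(2) inv_chart_chart[OF c] in auto)
  qed
  then obtain b where b: "b > 0" "\<And>p v. p \<in> K \<Longrightarrow> (norm v)\<^sup>2 \<le> b * (v \<bullet> (matrix_inv (G c p) *v v))"
    using compact_quadratic_form_bounds(2)[OF K(1), of "\<lambda>p. matrix_inv (G c p)"]
      matrix_inv_posdef[OF metric_pos[OF c]] K(2) by (metis subsetD)
  have "gradient_sq (u \<circ> inv_chart c) (snd c p) \<le> b * Re (gradient_form u u p)"
    if u: "C1_fun \<A> u" and p: "p \<in> K" for u p
  proof -
    let ?a = "cpartial c u p"
    let ?x = "(\<chi> i. Re (?a i)) :: real ^ 'n" and ?y = "(\<chi> i. Im (?a i)) :: real ^ 'n"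
    have "gradient_sq (u \<circ> inv_chart c) (snd c p) = (norm ?x)\<^sup>2 + (norm ?y)\<^sup>2"
      by (simp add: gradient_sq_def cmod_power2 sum.distrib norm_vec_def L2_set_def sum_nonneg)
    also have "\<dots> \<le> b * (?x \<bullet> (matrix_inv (G c p) *v ?x)) + b * (?y \<bullet> (matrix_inv (G c p) *v ?y))"
      by (intro add_mono b p)
    also have "\<dots> = b * Re (gradient_form u u p)"
      using gradient_form_chart[OF c subsetD[OF K(2) p] u u]
      by (simp add: chart_gradient_form_def Re_sesqui_form distrib_left)
    finally show ?thesis .
  qed
  then show ?thesis using that b(1) by blast
qed

end

section \<open>The Riemannian volume and Green's formula\<close>

locale riemannian_volume = closed_riemannian_manifold \<A> G
  for \<A> :: "('a::{t2_space, second_countable_topology}, 'n::finite) chart set"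
    and G :: "('a, 'n) riem_metric" +
  fixes vol :: "'a measure"
  assumes riemannian_volume: "is_riemannian_volume \<A> G vol"
begin

lemma sets_vol[measurable_cong, simp]: "sets vol = sets borel"
  using riemannian_volume unfolding is_riemannian_volume_def by blast

lemma space_vol[simp]: "space vol = UNIV"
  using sets_eq_imp_space_eq[OF sets_vol] by simp

lemma emeasure_vol_chart:
  assumes "c \<in> \<A>" "B \<in> sets borel" "B \<subseteq> dom_chart c"
  shows "emeasure vol B = (\<integral>\<^sup>+y\<in>snd c ` B. ennreal (vol_density c y) \<partial>lborel)"
proof -
  have "\<forall>(U, \<phi>)\<in>\<A>. \<forall>B\<in>sets borel. B \<subseteq> U \<longrightarrow>
        emeasure vol B = (\<integral>\<^sup>+y\<in>\<phi> ` B. ennreal (sqrt (det (G (U, \<phi>) (inv_into U \<phi> y)))) \<partial>lborel)"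
    using riemannian_volume unfolding is_riemannian_volume_def by blast
  from bspec[OF this assms(1)] show ?thesis
    using assms unfolding vol_density_def by (cases c) auto
qed

text \<open>The inverse of the chart and the density are extended to all of Euclidean space, so that the volume on
  the chart domain becomes the image of a measure with density.\<close>

definition local_param :: "('a, 'n) chart \<Rightarrow> real ^ 'n \<Rightarrow> 'a" where
  "local_param c y = (if y \<in> img_chart c then inv_chart c y else undefined)"

lemma local_param_measurable: "c \<in> \<A> \<Longrightarrow> local_param c \<in> borel_measurable borel"
  unfolding local_param_def
  by (rule borel_measurable_continuous_on_if) (auto intro: open_img cont_inv_chart borel_open)

definition local_density :: "('a, 'n) chart \<Rightarrow> real ^ 'n \<Rightarrow> real" where
  "local_density c y = (if y \<in> img_chart c then vol_density c y else 0)"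

lemma local_density_measurable: "c \<in> \<A> \<Longrightarrow> local_density c \<in> borel_measurable borel"
  unfolding local_density_def
  by (rule borel_measurable_continuous_on_if)
    (auto intro: open_img borel_open C1_on_continuous vol_density_C1 simp del: Ck_on.simps)

lemma local_density_nonneg: "c \<in> \<A> \<Longrightarrow> local_density c y \<ge> 0"
  unfolding local_density_def by (rule if_split[THEN iffD2]) (blast intro: less_imp_le vol_density_pos)

text \<open>Both sides are Borel measures on the whole manifold.  Stating the change of variables as an equality of
  measures transfers integrability and integrals of every kind at once.\<close>

lemma vol_chart:
  assumes c: "c \<in> \<A>"
  shows "density vol (\<lambda>x. ennreal (indicator (dom_chart c) x))
       = distr (density lborel (\<lambda>y. ennreal (local_density c y))) borel (local_param c)"
proof (rule measure_eqI)
  fix A assume "A \<in> sets (density vol (\<lambda>x. ennreal (indicator (dom_chart c) x)))"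
  then have A[measurable]: "A \<in> sets borel" by simp
  have D[measurable]: "dom_chart c \<in> sets borel" using open_dom[OF c] by (rule borel_open)
  note [measurable] = local_param_measurable[OF c] local_density_measurable[OF c]
  have "emeasure (density vol (\<lambda>x. ennreal (indicator (dom_chart c) x))) A
      = (\<integral>\<^sup>+x. ennreal (indicator (dom_chart c) x) * indicator A x \<partial>vol)"
    by (rule emeasure_density) (use D A in auto)
  also have "\<dots> = (\<integral>\<^sup>+x. indicator (dom_chart c \<inter> A) x \<partial>vol)"
    by (intro nn_integral_cong) (simp add: indicator_def)
  also have "\<dots> = emeasure vol (dom_chart c \<inter> A)" using A D by simp
  also have "\<dots> = (\<integral>\<^sup>+y. ennreal (vol_density c y) * indicator (snd c ` (dom_chart c \<inter> A)) y \<partial>lborel)"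
    by (rule emeasure_vol_chart[OF c]) (use A D in auto)
  also have "\<dots> = (\<integral>\<^sup>+y. ennreal (local_density c y) * indicator (local_param c -` A) y \<partial>lborel)"
    unfolding chart_image_eq[OF c]
    by (intro nn_integral_cong) (auto simp: local_density_def local_param_def indicator_def)
  also have "\<dots> = emeasure (density lborel (\<lambda>y. ennreal (local_density c y))) (local_param c -` A)"
    using measurable_sets[OF local_param_measurable[OF c] A] by (subst emeasure_density) auto
  also have "\<dots> = emeasure (distr (density lborel (\<lambda>y. ennreal (local_density c y))) borel (local_param c)) A"
    by (subst emeasure_distr) auto
  finally show "emeasure (density vol (\<lambda>x. ennreal (indicator (dom_chart c) x))) A
    = emeasure (distr (density lborel (\<lambda>y. ennreal (local_density c y))) borel (local_param c)) A" .
qed simp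

lemma integral_vol_chart:
  fixes g :: "'a \<Rightarrow> 'b::{banach, second_countable_topology}"
  assumes c: "c \<in> \<A>" and g: "g \<in> borel_measurable borel" and 0: "\<And>x. x \<notin> dom_chart c \<Longrightarrow> g x = 0"
  shows "(LINT x|vol. g x)
    = (LINT y|lborel. (if y \<in> img_chart c then vol_density c y *\<^sub>R g (inv_chart c y) else 0))"
proof -
  note m = local_param_measurable[OF c] local_density_measurable[OF c]
  have "(LINT x|vol. g x) = (LINT x|vol. indicator (dom_chart c) x *\<^sub>R g x)"
    using 0 by (intro Bochner_Integration.integral_cong refl) (auto simp: indicator_def)
  also have "\<dots> = (LINT x|density vol (\<lambda>x. ennreal (indicator (dom_chart c) x)). g x)"
    by (rule integral_density[symmetric]) (use g borel_open[OF open_dom[OF c]] in auto)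
  also have "\<dots> = (LINT y|density lborel (\<lambda>y. ennreal (local_density c y)). g (local_param c y))"
    unfolding vol_chart[OF c] by (rule integral_distr) (use m g in auto)
  also have "\<dots> = (LINT y|lborel. local_density c y *\<^sub>R g (local_param c y))"
    by (rule integral_density) (use m g local_density_nonneg[OF c] in auto)
  also have "\<dots> = (LINT y|lborel. (if y \<in> img_chart c then vol_density c y *\<^sub>R g (inv_chart c y) else 0))"
    by (intro Bochner_Integration.integral_cong refl) (simp add: local_density_def local_param_def)
  finally show ?thesis .
qed

lemma integrable_vol_chart:
  fixes g :: "'a \<Rightarrow> 'b::{banach, second_countable_topology}"
  assumes c: "c \<in> \<A>" and g: "integrable vol g"
  shows "integrable lborel (\<lambda>y. if y \<in> img_chart c then vol_density c y *\<^sub>R g (inv_chart c y) else 0)"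
proof -
  note m = local_param_measurable[OF c] local_density_measurable[OF c]
  have gm: "g \<in> borel_measurable borel" using borel_measurable_integrable[OF g] by simp
  have d: "dom_chart c \<in> sets vol" using borel_open[OF open_dom[OF c]] by simp
  have "integrable vol (\<lambda>x. indicator (dom_chart c) x *\<^sub>R g x)"
    by (rule integrable_mult_indicator[OF d g])
  then have "integrable (density vol (\<lambda>x. ennreal (indicator (dom_chart c) x))) g"
    by (subst integrable_density) (use gm d in auto)
  then have "integrable (density lborel (\<lambda>y. ennreal (local_density c y))) (\<lambda>y. g (local_param c y))"
    unfolding vol_chart[OF c] by (subst (asm) integrable_distr_eq) (use m gm in auto)
  then have "integrable lborel (\<lambda>y. local_density c y *\<^sub>R g (local_param c y))"
    by (subst (asm) integrable_density) (use m gm local_density_nonneg[OF c] in auto)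
  also have "(\<lambda>y. local_density c y *\<^sub>R g (local_param c y))
      = (\<lambda>y. if y \<in> img_chart c then vol_density c y *\<^sub>R g (inv_chart c y) else 0)"
    by (auto simp: local_density_def local_param_def fun_eq_iff)
  finally show ?thesis .
qed

lemma emeasure_vol_compact:
  assumes c: "c \<in> \<A>" and K: "compact K" "K \<subseteq> dom_chart c"
  shows "emeasure vol K < \<infinity>"
proof -
  have cK: "compact (snd c ` K)"
    by (intro compact_continuous_image K continuous_on_subset[OF cont_chart[OF c]])
  have "bounded (vol_density c ` snd c ` K)"
    by (intro compact_imp_bounded compact_continuous_image cK
        continuous_on_subset[OF C1_on_continuous[OF vol_density_C1[OF c]]]) (use K in blast)
  then obtain B where B0: "\<And>y. y \<in> snd c ` K \<Longrightarrow> norm (vol_density c y) \<le> B"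
    unfolding bounded_iff by blast
  have B: "vol_density c y \<le> B" if "y \<in> snd c ` K" for y
    using B0[OF that] unfolding real_norm_def by (rule abs_le_D1)
  have "emeasure vol K = (\<integral>\<^sup>+y. ennreal (vol_density c y) * indicator (snd c ` K) y \<partial>lborel)"
    by (rule emeasure_vol_chart[OF c borel_compact[OF K(1)] K(2)])
  also have "\<dots> \<le> (\<integral>\<^sup>+y. ennreal B * indicator (snd c ` K) y \<partial>lborel)"
    using B by (intro nn_integral_mono) (auto simp: indicator_def intro!: ennreal_leI)
  also have "\<dots> = ennreal B * emeasure lborel (snd c ` K)"
    by (rule nn_integral_cmult_indicator) (use borel_compact[OF cK] in simp)
  also have "\<dots> < \<infinity>"
    using emeasure_compact_finite[OF cK] by (simp add: ennreal_mult_less_top)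
  finally show ?thesis .
qed

lemma vol_finite: "finite_measure vol"
proof (rule finite_measureI)
  obtain I c and \<rho> :: "'a \<Rightarrow> 'a \<Rightarrow> real" and K where P: "finite I" "\<And>k. k \<in> I \<Longrightarrow> c k \<in> \<A>"
    "\<And>k. k \<in> I \<Longrightarrow> compact (K k)" "\<And>k. k \<in> I \<Longrightarrow> K k \<subseteq> dom_chart (c k)"
    "\<And>k q. k \<in> I \<Longrightarrow> q \<notin> K k \<Longrightarrow> \<rho> k q = 0" "\<And>q. (\<Sum>k\<in>I. \<rho> k q) = 1"
    by (rule partition_of_unity) blast
  have "q \<in> (\<Union>k\<in>I. K k)" for q
  proof (rule ccontr)
    assume "q \<notin> (\<Union>k\<in>I. K k)"
    then have "(\<Sum>k\<in>I. \<rho> k q) = 0" using P(5) by (intro sum.neutral) auto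
    then show False using P(6)[of q] by simp
  qed
  then have U: "UNIV = (\<Union>k\<in>I. K k)" by blast
  have Kb: "K k \<in> sets vol" if "k \<in> I" for k
    using P(3)[OF that] borel_compact by simp
  have fin: "emeasure vol (K k) < \<infinity>" if "k \<in> I" for k
    by (rule emeasure_vol_compact[OF P(2)[OF that] P(3)[OF that] P(4)[OF that]])
  have "emeasure vol (space vol) \<le> (\<Sum>k\<in>I. emeasure vol (K k))"
    unfolding space_vol U by (rule emeasure_subadditive_finite) (use P(1) Kb in auto)
  also have "\<dots> < \<infinity>"
    using fin P(1) by (simp add: ennreal_sum_less_top)
  finally show "emeasure vol (space vol) \<noteq> \<infinity>" by (rule less_imp_neq)
qed

sublocale finite_measure vol by (rule vol_finite)

lemma continuous_bounded:
  fixes g :: "'a \<Rightarrow> 'b::real_normed_vector"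
  assumes "continuous_on UNIV g"
  obtains B where "\<And>x. norm (g x) \<le> B"
  using compact_imp_bounded[OF compact_continuous_image[OF assms compact_space]] that
  by (auto simp: bounded_iff)

lemma integrable_continuous:
  fixes g :: "'a \<Rightarrow> 'b::{banach, second_countable_topology}"
  assumes "continuous_on UNIV g"
  shows "integrable vol g"
proof -
  obtain B where "\<And>x. norm (g x) \<le> B" using continuous_bounded[OF assms] by blast
  then show ?thesis
    using borel_measurable_continuous_onI[OF assms] by (intro integrable_const_bound[of _ B]) auto
qed

text \<open>The vector field whose coordinate divergence, divided by the volume density, is the Laplacian.\<close>

definition flux :: "('a, 'n) chart \<Rightarrow> ('a \<Rightarrow> complex) \<Rightarrow> 'n \<Rightarrow> real ^ 'n \<Rightarrow> complex" where
  "flux c u i y = vol_density c y *\<^sub>R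
     (\<Sum>j\<in>UNIV. (matrix_inv (G c (inv_chart c y)) $ i $ j) *\<^sub>R partial j (u \<circ> inv_chart c) y)"

lemma flux_C1:
  assumes "smooth_fun \<A> u" "c \<in> \<A>"
  shows "C1_on (img_chart c) (flux c u i)"
proof -
  have "Ck_on (Suc (Suc 0)) (img_chart c) (u \<circ> inv_chart c)"
    using smooth_fun_chart[OF assms] unfolding smooth_on_def by blast
  then have "C1_on (img_chart c) (partial j (u \<circ> inv_chart c))" for j by simp
  then show ?thesis
    unfolding flux_def
    by (intro C1_on_scaleR C1_on_sum open_img vol_density_C1 inverse_metric_C1 assms(2))
qed

lemma chart_laplacian_flux:
  assumes "c \<in> \<A>" "p \<in> dom_chart c"
  shows "chart_laplacian G c u p = (\<Sum>i\<in>UNIV. partial i (flux c u i) (snd c p)) /\<^sub>R vol_density c (snd c p)"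
  unfolding chart_laplacian_def Let_def vol_density_def flux_def by (simp add: o_def)

text \<open>The divergence theorem in one chart; note that the weight \<open>(det g)\<^bsup>1/2\<^esup>\<close> in the coordinate
  expression of the Laplacian is the density of the volume.\<close>

lemma green_in_chart:
  assumes u: "smooth_fun \<A> u" and L: "has_laplacian \<A> G u w" "continuous_on UNIV w"
    and h: "C1_fun \<A> h" and c: "c \<in> \<A>"
    and K: "compact K" "K \<subseteq> dom_chart c" "\<And>q. q \<notin> K \<Longrightarrow> h q = 0"
  shows "(LINT x|vol. w x * cnj (h x)) = - (LINT x|vol. gradient_form u h x)"
proof -
  note Cu = smooth_fun_C1_fun[OF u]
  let ?S = "img_chart c"
  define k where "k y = cnj ((h \<circ> inv_chart c) y)" for y
  define X where "X = flux c u"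
  have S: "open ?S" by (rule open_img[OF c])
  have X: "C1_on ?S (X i)" for i unfolding X_def by (rule flux_C1[OF u c])
  have k: "C1_on ?S k" unfolding k_def
    by (rule C1_on_bounded_linear(1)[OF bounded_linear_cnj S C1_fun_chart[OF h c]])
  have pk: "partial i k y = cnj (partial i (h \<circ> inv_chart c) y)" if "y \<in> ?S" for i y
    unfolding k_def by (rule C1_on_bounded_linear(2)[OF bounded_linear_cnj S C1_fun_chart[OF h c] that])
  have K': "compact (snd c ` K)" "snd c ` K \<subseteq> ?S"
    using K by (auto intro!: compact_continuous_image continuous_on_subset[OF cont_chart[OF c]])
  have k0: "k y = 0" if "y \<in> ?S - snd c ` K" for y
  proof -
    have "inv_chart c y \<notin> K" using that chart_inv_chart[OF c] by (metis DiffD1 DiffD2 imageI)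
    then show ?thesis by (simp add: k_def K(3))
  qed
  have w: "vol_density c y *\<^sub>R w (inv_chart c y) = (\<Sum>i\<in>UNIV. partial i (X i) y)" if y: "y \<in> ?S" for y
  proof -
    have "w (inv_chart c y) = chart_laplacian G c u (inv_chart c y)"
      using L(1) c inv_chart_in[OF c y] unfolding has_laplacian_def by simp
    also have "\<dots> = (\<Sum>i\<in>UNIV. partial i (X i) y) /\<^sub>R vol_density c y"
      unfolding chart_laplacian_flux[OF c inv_chart_in[OF c y]] chart_inv_chart[OF c y] X_def ..
    finally show ?thesis using vol_density_pos[OF c y] by simp
  qed
  have gf: "vol_density c y *\<^sub>R gradient_form u h (inv_chart c y) = (\<Sum>i\<in>UNIV. X i y * partial i k y)" if y: "y \<in> ?S" for y
    unfolding gradient_form_chart[OF c inv_chart_in[OF c y] Cu h] chart_gradient_form_def sesqui_form_def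
      chart_inv_chart[OF c y] X_def flux_def
    by (simp add: pk[OF y] scaleR_conv_of_real sum_distrib_left sum_distrib_right mult_ac)
  have off: "gradient_form u h x = 0" if "x \<notin> dom_chart c" for x
    using gradient_form_eq_0[OF Cu h, of "- K" x] K that compact_imp_closed by blast
  have hc: "continuous_on UNIV (\<lambda>x. w x * cnj (h x))"
    by (intro continuous_intros L C1_fun_continuous[OF h])
  have "(LINT x|vol. w x * cnj (h x))
      = (LINT y|lborel. (if y \<in> ?S then vol_density c y *\<^sub>R (w (inv_chart c y) * cnj (h (inv_chart c y))) else 0))"
    by (rule integral_vol_chart[OF c borel_measurable_continuous_onI[OF hc]]) (use K in auto)
  also have "\<dots> = (LINT y|lborel. (if y \<in> ?S then (\<Sum>i\<in>UNIV. partial i (X i) y) * k y else 0))"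
    by (intro Bochner_Integration.integral_cong refl) (auto simp: w[symmetric] k_def)
  also have "\<dots> = - (LINT y|lborel. (if y \<in> ?S then \<Sum>i\<in>UNIV. X i y * partial i k y else 0))"
    by (rule divergence_theorem[OF S X k K' k0])
  also have "(LINT y|lborel. (if y \<in> ?S then \<Sum>i\<in>UNIV. X i y * partial i k y else 0))
      = (LINT y|lborel. (if y \<in> ?S then vol_density c y *\<^sub>R gradient_form u h (inv_chart c y) else 0))"
    by (intro Bochner_Integration.integral_cong refl) (auto simp: gf)
  also have "\<dots> = (LINT x|vol. gradient_form u h x)"
    by (rule integral_vol_chart[OF c borel_measurable_continuous_onI[OF gradient_form_continuous[OF Cu h]], symmetric])
      (rule off)
  finally show ?thesis .
qed

text \<open>A partition of unity splits the test function \<open>h\<close> into pieces supported in charts; the gradient form is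
  additive in \<open>h\<close>, so that the derivatives of the partition functions cancel in the sum.\<close>

lemma green:
  assumes u: "smooth_fun \<A> u" and L: "has_laplacian \<A> G u w" "continuous_on UNIV w"
    and h: "C1_fun \<A> h"
  shows "(LINT x|vol. w x * cnj (h x)) = - (LINT x|vol. gradient_form u h x)"
proof -
  note Cu = smooth_fun_C1_fun[OF u]
  obtain I c and \<rho> :: "'a \<Rightarrow> 'a \<Rightarrow> real" and K where P: "finite I" "\<And>k. k \<in> I \<Longrightarrow> c k \<in> \<A>"
    "\<And>k. k \<in> I \<Longrightarrow> C1_fun \<A> (\<rho> k)"
    "\<And>k. k \<in> I \<Longrightarrow> compact (K k)" "\<And>k. k \<in> I \<Longrightarrow> K k \<subseteq> dom_chart (c k)"
    "\<And>k q. k \<in> I \<Longrightarrow> q \<notin> K k \<Longrightarrow> \<rho> k q = 0" "\<And>q. (\<Sum>k\<in>I. \<rho> k q) = 1"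
    by (rule partition_of_unity) blast
  define hk where "hk k q = complex_of_real (\<rho> k q) * h q" for k q
  have hk: "C1_fun \<A> (hk k)" if "k \<in> I" for k
    unfolding hk_def by (intro C1_fun_mult C1_fun_of_real P h that)
  have sum: "(\<Sum>k\<in>I. hk k q) = h q" for q
    unfolding hk_def sum_distrib_right[symmetric] of_real_sum[symmetric] P(7) by simp
  have "(LINT x|vol. w x * cnj (h x)) = (LINT x|vol. (\<Sum>k\<in>I. w x * cnj (hk k x)))"
    by (simp only: sum_distrib_left[symmetric] cnj_sum[symmetric] sum)
  also have "\<dots> = (\<Sum>k\<in>I. LINT x|vol. w x * cnj (hk k x))"
    by (intro Bochner_Integration.integral_sum integrable_continuous continuous_intros L C1_fun_continuous hk)
  also have "\<dots> = (\<Sum>k\<in>I. - (LINT x|vol. gradient_form u (hk k) x))"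
    by (intro sum.cong refl green_in_chart[OF u L hk P(2) P(4) P(5)]) (auto simp: hk_def P(6))
  also have "\<dots> = - (LINT x|vol. (\<Sum>k\<in>I. gradient_form u (hk k) x))"
    by (subst Bochner_Integration.integral_sum)
      (auto intro!: integrable_continuous gradient_form_continuous Cu hk simp: sum_negf)
  also have "(\<lambda>x. \<Sum>k\<in>I. gradient_form u (hk k) x) = gradient_form u h"
    using gradient_form_sum_right[of u I hk, OF Cu hk] by (simp add: sum fun_eq_iff)
  finally show ?thesis .
qed

end

section \<open>Square integrable functions\<close>

lemma borel_measurable_cnj[measurable]:
  "f \<in> borel_measurable M \<Longrightarrow> (\<lambda>x. cnj (f x)) \<in> borel_measurable M"
  by (rule borel_measurable_continuous_on[OF continuous_on_cnj[OF continuous_on_id]])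

lemma square_integrable_measurable: "square_integrable M f \<Longrightarrow> f \<in> borel_measurable M"
  and square_integrable_integrable: "square_integrable M f \<Longrightarrow> integrable M (\<lambda>x. (cmod (f x))\<^sup>2)"
  by (simp_all add: square_integrable_def)

lemma integrable_mult_square_integrable:
  assumes "square_integrable M f" "square_integrable M g"
  shows "integrable M (\<lambda>x. f x * cnj (g x))"
proof (rule Bochner_Integration.integrable_bound)
  show "integrable M (\<lambda>x. (cmod (f x))\<^sup>2 + (cmod (g x))\<^sup>2)"
    using assms by (simp add: square_integrable_def)
  show "AE x in M. norm (f x * cnj (g x)) \<le> norm ((cmod (f x))\<^sup>2 + (cmod (g x))\<^sup>2)"
  proof (rule AE_I2)
    fix x
    have "2 * (cmod (f x) * cmod (g x)) \<le> (cmod (f x))\<^sup>2 + (cmod (g x))\<^sup>2"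
      using sum_squares_bound[of "cmod (f x)" "cmod (g x)"] by simp
    moreover have "0 \<le> cmod (f x) * cmod (g x)" by simp
    ultimately show "norm (f x * cnj (g x)) \<le> norm ((cmod (f x))\<^sup>2 + (cmod (g x))\<^sup>2)"
      unfolding real_norm_def norm_mult complex_mod_cnj by linarith
  qed
qed (use assms in \<open>auto simp: square_integrable_def intro!: borel_measurable_times borel_measurable_cnj\<close>)

lemma square_integrable_cmult: "square_integrable M f \<Longrightarrow> square_integrable M (\<lambda>x. a * f x)"
  by (auto simp: square_integrable_def norm_mult power_mult_distrib intro: borel_measurable_times)

lemma norm_add_square_le:
  fixes p q :: "'a::real_normed_vector"
  shows "(norm (p + q))\<^sup>2 \<le> 2 * (norm p)\<^sup>2 + 2 * (norm q)\<^sup>2"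
proof -
  have "(norm (p + q))\<^sup>2 \<le> (norm p + norm q)\<^sup>2"
    by (intro power_mono norm_triangle_ineq) simp
  also have "\<dots> \<le> 2 * (norm p)\<^sup>2 + 2 * (norm q)\<^sup>2"
    using sum_squares_bound[of "norm p" "norm q"] by (simp add: power2_sum)
  finally show ?thesis .
qed

lemma square_integrable_add:
  assumes "square_integrable M f" "square_integrable M g"
  shows "square_integrable M (\<lambda>x. f x + g x)"
proof -
  have [measurable]: "f \<in> borel_measurable M" "g \<in> borel_measurable M"
    using assms by (auto simp: square_integrable_def)
  have "integrable M (\<lambda>x. (cmod (f x + g x))\<^sup>2)"
  proof (rule Bochner_Integration.integrable_bound)
    show "integrable M (\<lambda>x. 2 * (cmod (f x))\<^sup>2 + 2 * (cmod (g x))\<^sup>2)"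
      using assms by (simp add: square_integrable_def)
    show "AE x in M. norm ((cmod (f x + g x))\<^sup>2) \<le> norm (2 * (cmod (f x))\<^sup>2 + 2 * (cmod (g x))\<^sup>2)"
      by (intro AE_I2) (simp add: norm_add_square_le)
  qed measurable
  then show ?thesis by (simp add: square_integrable_def)
qed

lemma square_integrable_sum:
  "(\<And>k. k \<in> I \<Longrightarrow> square_integrable M (f k)) \<Longrightarrow> square_integrable M (\<lambda>x. \<Sum>k\<in>I. f k x)"
proof (induction I rule: infinite_finite_induct)
  case (insert k I)
  then show ?case by (simp add: square_integrable_add)
qed (simp_all add: square_integrable_def)

lemma square_integrable_diff:
  "square_integrable M f \<Longrightarrow> square_integrable M g \<Longrightarrow> square_integrable M (\<lambda>x. f x - g x)"
  using square_integrable_add[of M f "\<lambda>x. - 1 * g x"] square_integrable_cmult[of M g "- 1"] by simp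

lemma L2_inner_diff_left:
  "square_integrable M f \<Longrightarrow> square_integrable M g \<Longrightarrow> square_integrable M h \<Longrightarrow>
    L2_inner M (\<lambda>x. f x - g x) h = L2_inner M f h - L2_inner M g h"
  unfolding L2_inner_def left_diff_distrib
  by (intro Bochner_Integration.integral_diff integrable_mult_square_integrable)

lemma L2_inner_cnj: "cnj (L2_inner M f g) = L2_inner M g f"
  unfolding L2_inner_def Bochner_Integration.integral_cnj[symmetric] by (simp add: mult.commute del: Bochner_Integration.integral_cnj)

lemma L2_inner_sum_left:
  assumes "\<And>k. k \<in> I \<Longrightarrow> square_integrable M (f k)" "square_integrable M g"
  shows "L2_inner M (\<lambda>x. \<Sum>k\<in>I. a k * f k x) g = (\<Sum>k\<in>I. a k * L2_inner M (f k) g)"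
proof -
  have "L2_inner M (\<lambda>x. \<Sum>k\<in>I. a k * f k x) g = (LINT x|M. (\<Sum>k\<in>I. a k * (f k x * cnj (g x))))"
    unfolding L2_inner_def by (simp add: sum_distrib_right mult.assoc)
  also have "\<dots> = (\<Sum>k\<in>I. LINT x|M. a k * (f k x * cnj (g x)))"
    using assms by (intro Bochner_Integration.integral_sum integrable_mult_right integrable_mult_square_integrable)
  finally show ?thesis by (simp add: L2_inner_def)
qed

lemma L2_inner_sum_right:
  assumes "\<And>k. k \<in> I \<Longrightarrow> square_integrable M (f k)" "square_integrable M g"
  shows "L2_inner M g (\<lambda>x. \<Sum>k\<in>I. a k * f k x) = (\<Sum>k\<in>I. cnj (a k) * L2_inner M g (f k))"
proof -
  have "L2_inner M g (\<lambda>x. \<Sum>k\<in>I. a k * f k x) = cnj (L2_inner M (\<lambda>x. \<Sum>k\<in>I. a k * f k x) g)"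
    by (simp only: L2_inner_cnj)
  also have "\<dots> = (\<Sum>k\<in>I. cnj (a k) * L2_inner M g (f k))"
    by (subst L2_inner_sum_left[of I M f g a, OF assms]) (simp_all add: L2_inner_cnj)
  finally show ?thesis .
qed

lemma L2_inner_cong_AE_right:
  assumes "AE x in M. g x = h x" "g \<in> borel_measurable M" "h \<in> borel_measurable M" "f \<in> borel_measurable M"
  shows "L2_inner M f g = L2_inner M f h"
proof -
  note [measurable] = assms(2-4)
  show ?thesis
    unfolding L2_inner_def using assms(1) by (intro Bochner_Integration.integral_cong_AE) auto
qed

lemma L2_norm_cong_AE:
  assumes "AE x in M. g x = h x" "g \<in> borel_measurable M" "h \<in> borel_measurable M"
  shows "L2_norm M g = L2_norm M h"
  unfolding L2_norm_def using assms
  by (intro arg_cong[of _ _ sqrt] Bochner_Integration.integral_cong_AE) auto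

lemma L2_norm_square: "(L2_norm M f)\<^sup>2 = (LINT x|M. (cmod (f x))\<^sup>2)"
  unfolding L2_norm_def by simp

lemma L2_norm_square_inner: "complex_of_real ((L2_norm M f)\<^sup>2) = L2_inner M f f"
  unfolding L2_norm_square L2_inner_def integral_complex_of_real[symmetric]
  by (simp add: complex_norm_square del: of_real_power)

lemma L2_norm_nonneg: "L2_norm M f \<ge> 0" unfolding L2_norm_def by simp

lemma L2_Cauchy_Schwarz:
  assumes f: "square_integrable M f" and g: "square_integrable M g"
  shows "cmod (L2_inner M f g) \<le> L2_norm M f * L2_norm M g"
proof -
  have [measurable]: "f \<in> borel_measurable M" "g \<in> borel_measurable M"
    using f g by (auto simp: square_integrable_def)
  have i: "integrable M (\<lambda>x. cmod (f x) * cmod (g x))"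
    using integrable_norm[OF integrable_mult_square_integrable[OF f g]] by (simp add: norm_mult)
  define t where "t = (LINT x|M. cmod (f x) * cmod (g x))"
  have "cmod (L2_inner M f g) \<le> t"
    unfolding L2_inner_def t_def
    using integral_norm_bound[of M "\<lambda>x. f x * cnj (g x)"] by (simp add: norm_mult)
  also have "t\<^sup>2 \<le> (L2_norm M f * L2_norm M g)\<^sup>2"
  proof -
    have "(\<integral>\<^sup>+x. ennreal (cmod (f x)) * ennreal (cmod (g x)) \<partial>M) = ennreal t"
      unfolding t_def by (subst nn_integral_eq_integral[OF i, symmetric]) (simp_all add: ennreal_mult)
    moreover have "t \<ge> 0" unfolding t_def by simp
    ultimately have "ennreal (t\<^sup>2) = (\<integral>\<^sup>+x. ennreal (cmod (f x)) * ennreal (cmod (g x)) \<partial>M)\<^sup>2"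
      by (simp add: ennreal_power)
    also have "\<dots> \<le> (\<integral>\<^sup>+x. (ennreal (cmod (f x)))\<^sup>2 \<partial>M) * (\<integral>\<^sup>+x. (ennreal (cmod (g x)))\<^sup>2 \<partial>M)"
      by (rule Cauchy_Schwarz_nn_integral) measurable
    also have "\<dots> = ennreal ((L2_norm M f)\<^sup>2) * ennreal ((L2_norm M g)\<^sup>2)"
      using f g unfolding L2_norm_square
      by (simp add: ennreal_power nn_integral_eq_integral square_integrable_def)
    also have "\<dots> = ennreal ((L2_norm M f * L2_norm M g)\<^sup>2)"
      by (simp add: ennreal_mult[symmetric] power_mult_distrib)
    finally show ?thesis by (subst (asm) ennreal_le_iff) auto
  qed
  then have "t \<le> L2_norm M f * L2_norm M g"
    by (rule power2_le_imp_le) (simp add: L2_norm_nonneg)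
  finally show ?thesis .
qed

section \<open>Eigenspaces\<close>

lemma C1_on_lincomb:
  fixes f :: "'k \<Rightarrow> real ^ 'n::finite \<Rightarrow> complex"
  assumes "open S" "\<And>k. k \<in> I \<Longrightarrow> C1_on S (f k)"
  shows "C1_on S (\<lambda>y. \<Sum>k\<in>I. a k * f k y)"
    and "y \<in> S \<Longrightarrow> partial i (\<lambda>y. \<Sum>k\<in>I. a k * f k y) y = (\<Sum>k\<in>I. a k * partial i (f k) y)"
proof -
  have 1: "C1_on S (\<lambda>y. a k * f k y)" if "k \<in> I" for k
    by (rule C1_on_bounded_linear(1)[OF bounded_linear_mult_right assms(1) assms(2)[OF that]])
  have 2: "partial i (\<lambda>y. a k * f k y) y = a k * partial i (f k) y" if "k \<in> I" "y \<in> S" for k y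
    by (rule C1_on_bounded_linear(2)[OF bounded_linear_mult_right assms(1) assms(2)[OF that(1)] that(2)])
  show "C1_on S (\<lambda>y. \<Sum>k\<in>I. a k * f k y)"
    by (rule C1_on_sum[OF assms(1) 1])
  show "partial i (\<lambda>y. \<Sum>k\<in>I. a k * f k y) y = (\<Sum>k\<in>I. a k * partial i (f k) y)" if "y \<in> S"
    using partial_sum[where f = "\<lambda>k y. a k * f k y" and I = I and i = i, OF assms(1) 1 that] 2[OF _ that]
    by simp
qed

lemma Ck_on_continuous: "Ck_on k S f \<Longrightarrow> continuous_on S f"
  by (cases k) (simp_all add: differentiable_imp_continuous_on)

lemma Ck_on_lincomb:
  fixes f :: "'k \<Rightarrow> real ^ 'n::finite \<Rightarrow> complex"
  assumes S: "open S" and "\<And>k. k \<in> I \<Longrightarrow> Ck_on n S (f k)"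
  shows "Ck_on n S (\<lambda>y. \<Sum>k\<in>I. a k * f k y)"
  using assms(2)
proof (induction n arbitrary: f)
  case 0
  then show ?case by (auto intro!: continuous_intros)
next
  case (Suc n)
  have C1: "C1_on S (f k)" if "k \<in> I" for k
    using Suc.prems[OF that] Ck_on_continuous by auto
  have "Ck_on n S (partial i (\<lambda>y. \<Sum>k\<in>I. a k * f k y))" for i
  proof -
    have "Ck_on n S (\<lambda>y. \<Sum>k\<in>I. a k * partial i (f k) y)"
      by (rule Suc.IH) (use Suc.prems in auto)
    then show ?thesis
      by (subst Ck_on_cong[OF S C1_on_lincomb(2)[OF S C1]])
  qed
  moreover have "(\<lambda>y. \<Sum>k\<in>I. a k * f k y) differentiable_on S"
    using C1_on_lincomb(1)[of S I f a, OF S C1] by simp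
  ultimately show ?case by simp
qed

context riemannian_volume
begin

lemma borel_measurable_vol[simp]: "borel_measurable vol = borel_measurable borel"
  by (rule measurable_cong_sets[OF sets_vol refl])

lemma square_integrable_continuous: "continuous_on UNIV g \<Longrightarrow> square_integrable vol g"
  unfolding square_integrable_def
  by (auto intro!: integrable_continuous continuous_intros borel_measurable_continuous_onI)

lemma eigenspaceD:
  assumes "u \<in> eigenspace \<A> G \<nu>"
  shows "smooth_fun \<A> u" "has_laplacian \<A> G u (\<lambda>p. - (\<nu>\<^sup>2 *\<^sub>R u p))" "C1_fun \<A> u" "continuous_on UNIV u"
    "square_integrable vol u"
  using assms smooth_fun_C1_fun C1_fun_continuous square_integrable_continuous
  unfolding eigenspace_def by blast+

lemma smooth_fun_lincomb:
  assumes "\<And>k. k \<in> I \<Longrightarrow> smooth_fun \<A> (u k)"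
  shows "smooth_fun \<A> (\<lambda>x. \<Sum>k\<in>I. a k * u k x)"
  unfolding smooth_fun_def
proof (clarify)
  fix U \<phi> assume c: "(U, \<phi>) \<in> \<A>"
  have "Ck_on n (\<phi> ` U) (u k \<circ> inv_into U \<phi>)" if "k \<in> I" for k n
    using smooth_fun_chart[OF assms[OF that] c] by (simp add: smooth_on_def)
  moreover have "open (\<phi> ` U)" using open_img[OF c] by simp
  ultimately have "Ck_on n (\<phi> ` U) (\<lambda>y. \<Sum>k\<in>I. a k * (u k \<circ> inv_into U \<phi>) y)" for n
    using Ck_on_lincomb[of "\<phi> ` U" I n "\<lambda>k. u k \<circ> inv_into U \<phi>" a] by blast
  then show "smooth_on (\<phi> ` U) ((\<lambda>x. \<Sum>k\<in>I. a k * u k x) \<circ> inv_into U \<phi>)"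
    unfolding smooth_on_def by (simp add: o_def)
qed

text \<open>Linearity of the Laplacian is not immediate from its coordinate expression: the derivative of a sum is
  the sum of derivatives only because the fluxes are differentiable.\<close>

lemma eigenspace_lincomb:
  assumes "\<And>k. k \<in> I \<Longrightarrow> u k \<in> eigenspace \<A> G \<nu>"
  shows "(\<lambda>x. \<Sum>k\<in>I. a k * u k x) \<in> eigenspace \<A> G \<nu>"
proof -
  let ?u = "\<lambda>x. \<Sum>k\<in>I. a k * u k x"
  note sm = eigenspaceD(1)[OF assms]
  have *: "chart_laplacian G c ?u p = - (\<nu>\<^sup>2 *\<^sub>R ?u p)" if c: "c \<in> \<A>" and p: "p \<in> dom_chart c" for c p
  proof -
    let ?S = "img_chart c"
    have S: "open ?S" by (rule open_img[OF c])
    have y: "snd c p \<in> ?S" using p by blast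
    have fl: "flux c ?u i y = (\<Sum>k\<in>I. a k * flux c (u k) i y)" if "y \<in> ?S" for i y
    proof -
      have "partial j (?u \<circ> inv_chart c) y = (\<Sum>k\<in>I. a k * partial j (u k \<circ> inv_chart c) y)" for j
        using C1_on_lincomb(2)[OF S, of I "\<lambda>k. u k \<circ> inv_chart c", OF C1_fun_chart[OF smooth_fun_C1_fun[OF sm] c] that]
        by (simp add: o_def)
      then have "flux c ?u i y = vol_density c y *\<^sub>R
          (\<Sum>j\<in>UNIV. \<Sum>k\<in>I. a k * ((matrix_inv (G c (inv_chart c y)) $ i $ j) *\<^sub>R partial j (u k \<circ> inv_chart c) y))"
        unfolding flux_def by (simp add: scaleR_sum_right)
      also have "\<dots> = (\<Sum>k\<in>I. a k * flux c (u k) i y)"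
        unfolding flux_def by (subst sum.swap) (simp add: scaleR_sum_right sum_distrib_left)
      finally show ?thesis .
    qed
    have "partial i (flux c ?u i) (snd c p) = (\<Sum>k\<in>I. a k * partial i (flux c (u k) i) (snd c p))" for i
      using partial_cong[OF S fl y] C1_on_lincomb(2)[OF S, of I "\<lambda>k. flux c (u k) i", OF flux_C1[OF sm c] y]
      by simp
    then have "chart_laplacian G c ?u p = (\<Sum>i\<in>UNIV. \<Sum>k\<in>I. a k * partial i (flux c (u k) i) (snd c p)) /\<^sub>R vol_density c (snd c p)"
      by (simp add: chart_laplacian_flux[OF c p])
    also have "\<dots> = (\<Sum>k\<in>I. a k * chart_laplacian G c (u k) p)"
      unfolding chart_laplacian_flux[OF c p]
      by (subst sum.swap) (simp add: scaleR_sum_right sum_distrib_left)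
    also have "\<dots> = (\<Sum>k\<in>I. a k * - (\<nu>\<^sup>2 *\<^sub>R u k p))"
      using eigenspaceD(2)[OF assms] c p unfolding has_laplacian_def by (intro sum.cong refl) simp
    also have "\<dots> = - (\<nu>\<^sup>2 *\<^sub>R ?u p)"
      by (simp add: sum_negf scaleR_sum_right)
    finally show ?thesis .
  qed
  show ?thesis
    unfolding eigenspace_def has_laplacian_def
    by (intro CollectI conjI ballI smooth_fun_lincomb sm *)
qed

lemma eigenspace_energy:
  assumes u: "u \<in> eigenspace \<A> G \<nu>" and h: "C1_fun \<A> h"
  shows "(LINT x|vol. gradient_form u h x) = \<nu>\<^sup>2 *\<^sub>R L2_inner vol u h"
proof -
  have "- (\<nu>\<^sup>2 *\<^sub>R L2_inner vol u h) = (LINT x|vol. - (\<nu>\<^sup>2 *\<^sub>R u x) * cnj (h x))"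
    unfolding L2_inner_def by (simp del: integral_scaleR_right add: integral_scaleR_right[symmetric])
  also have "\<dots> = - (LINT x|vol. gradient_form u h x)"
    by (rule green[OF eigenspaceD(1,2)[OF u] _ h]) (intro continuous_intros eigenspaceD(4)[OF u])
  finally show ?thesis by simp
qed

text \<open>The Dirichlet form is Hermitian, so that \<open>\<nu>\<^sup>2\<close> and \<open>\<mu>\<^sup>2\<close> may be exchanged in front of the inner product.\<close>

lemma eigenspaces_orthogonal:
  assumes u: "u \<in> eigenspace \<A> G \<nu>" and v: "v \<in> eigenspace \<A> G \<mu>" and ne: "\<nu>\<^sup>2 \<noteq> \<mu>\<^sup>2"
  shows "L2_inner vol u v = 0"
proof -
  have "\<mu>\<^sup>2 *\<^sub>R L2_inner vol u v = cnj (LINT x|vol. gradient_form v u x)"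
    unfolding eigenspace_energy[OF v eigenspaceD(3)[OF u]] by (simp add: L2_inner_cnj)
  also have "\<dots> = (LINT x|vol. gradient_form u v x)"
    unfolding Bochner_Integration.integral_cnj[symmetric] gradient_form_cnj[OF eigenspaceD(3)[OF v] eigenspaceD(3)[OF u]] ..
  also have "\<dots> = \<nu>\<^sup>2 *\<^sub>R L2_inner vol u v" by (rule eigenspace_energy[OF u eigenspaceD(3)[OF v]])
  finally show ?thesis using ne by simp
qed

end

section \<open>Discreteness of the spectrum\<close>

context riemannian_volume
begin

lemma vol_density_nonzero: "c \<in> \<A> \<Longrightarrow> y \<in> img_chart c \<Longrightarrow> vol_density c y \<noteq> 0"
  using vol_density_pos by (metis less_irrefl)

text \<open>Replacing the Riemannian volume by Lebesgue measure in one chart costs a constant on a compact set.\<close>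

lemma lebesgue_integral_le_vol_integral:
  assumes c: "c \<in> \<A>" and K: "compact K" "K \<subseteq> dom_chart c"
  obtains b where "b > 0"
    "\<And>f g. integrable vol g \<Longrightarrow> (\<And>x. g x \<ge> (0::real)) \<Longrightarrow> (\<And>y. y \<in> snd c ` K \<Longrightarrow> f y \<le> g (inv_chart c y)) \<Longrightarrow>
      (\<And>y. y \<notin> snd c ` K \<Longrightarrow> f y = 0) \<Longrightarrow> (\<And>y. f y \<ge> 0) \<Longrightarrow> (LINT y|lborel. f y) \<le> b * (LINT x|vol. g x)"
proof -
  let ?S = "img_chart c"
  have cK: "compact (snd c ` K)"
    by (intro compact_continuous_image K continuous_on_subset[OF cont_chart[OF c]])
  have KS: "snd c ` K \<subseteq> ?S" using K by blast
  have "continuous_on (snd c ` K) (\<lambda>y. inverse (vol_density c y))"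
    by (intro continuous_intros continuous_on_subset[OF C1_on_continuous[OF vol_density_C1[OF c]] KS])
      (use vol_density_nonzero[OF c] KS in blast)
  then have "bounded ((\<lambda>y. inverse (vol_density c y)) ` snd c ` K)"
    by (intro compact_imp_bounded compact_continuous_image cK)
  then obtain b where b0: "\<And>y. y \<in> snd c ` K \<Longrightarrow> norm (inverse (vol_density c y)) \<le> b"
    unfolding bounded_iff by blast
  have b: "1 \<le> max b 1 * vol_density c y" if "y \<in> snd c ` K" for y
  proof -
    have p: "vol_density c y > 0" using vol_density_pos[OF c] KS that by blast
    have "inverse (vol_density c y) \<le> max b 1" using b0[OF that] p by simp
    then show ?thesis using p by (simp add: field_simps)
  qed
  have Km: "K \<in> sets vol" using borel_compact[OF K(1)] by simp
  have "(LINT y|lborel. f y) \<le> max b 1 * (LINT x|vol. g x)"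
    if g: "integrable vol g" "\<And>x. g x \<ge> (0::real)" and f: "\<And>y. y \<in> snd c ` K \<Longrightarrow> f y \<le> g (inv_chart c y)"
      "\<And>y. y \<notin> snd c ` K \<Longrightarrow> f y = 0" "\<And>y. f y \<ge> 0" for f g
  proof -
    define h where "h x = max b 1 * (indicator K x *\<^sub>R g x)" for x
    have h: "integrable vol h" unfolding h_def
      by (intro integrable_mult_right integrable_mult_indicator Km g)
    have h0: "h x \<ge> 0" for x unfolding h_def using g(2)[of x] by simp
    have "(LINT y|lborel. f y) \<le> (LINT y|lborel. (if y \<in> ?S then vol_density c y *\<^sub>R h (inv_chart c y) else 0))"
    proof (rule integral_mono')
      show "integrable lborel (\<lambda>y. if y \<in> ?S then vol_density c y *\<^sub>R h (inv_chart c y) else 0)"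
        by (rule integrable_vol_chart[OF c h])
      show "0 \<le> (if y \<in> ?S then vol_density c y *\<^sub>R h (inv_chart c y) else 0)" for y
        using h0[of "inv_chart c y"] vol_density_pos[OF c, of y] less_imp_le by fastforce
      then show "f y \<le> (if y \<in> ?S then vol_density c y *\<^sub>R h (inv_chart c y) else 0)" for y
      proof (cases "y \<in> snd c ` K")
        case True
        then have yS: "y \<in> ?S" and yK: "inv_chart c y \<in> K"
          using KS K(2) inv_chart_chart[OF c] by auto
        have "f y \<le> (max b 1 * vol_density c y) * g (inv_chart c y)"
          using f(1)[OF True] mult_right_mono[OF b[OF True] g(2)[of "inv_chart c y"]] by simp
        then show ?thesis using yS yK by (simp add: h_def mult_ac)
      qed (simp add: f(2))
    qed
    also have "\<dots> = (LINT x|vol. h x)"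
    proof (rule integral_vol_chart[OF c, symmetric])
      show "h \<in> borel_measurable borel" using borel_measurable_integrable[OF h] by simp
      show "h x = 0" if "x \<notin> dom_chart c" for x
      proof -
        have "x \<notin> K" using that K(2) by blast
        then show ?thesis by (simp add: h_def)
      qed
    qed
    also have "\<dots> \<le> (LINT x|vol. max b 1 * g x)"
      by (rule Bochner_Integration.integral_mono[OF h])
        (use g in \<open>auto simp: h_def indicator_def\<close>)
    finally show ?thesis by simp
  qed
  then show ?thesis using that[of "max b 1"] by simp
qed

lemma gradient_form_nonneg:
  assumes "C1_fun \<A> u"
  shows "Re (gradient_form u u p) \<ge> 0"
proof -
  obtain c where c: "c \<in> \<A>" "p \<in> dom_chart c" by (rule ex_chart)
  obtain b where b: "b > 0" "\<And>u q. C1_fun \<A> u \<Longrightarrow> q \<in> {p} \<Longrightarrow> gradient_sq (u \<circ> inv_chart c) (snd c q) \<le> b * Re (gradient_form u u q)"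
    using gradient_form_coercive[OF c(1), of "{p}"] c(2) by (metis compact_sing empty_subsetI insert_subset)
  have "0 \<le> gradient_sq (u \<circ> inv_chart c) (snd c p)" by (simp add: gradient_sq_def sum_nonneg)
  then have "0 \<le> b * Re (gradient_form u u p)" using b(2)[OF assms] by force
  then show ?thesis using b(1) by (simp add: zero_le_mult_iff)
qed

text \<open>In the chart, the cut-off functions \<open>\<rho> u\<close> satisfy the hypotheses of \<open>weakly_null_imp_L2_null\<close>: their
  gradients are bounded by the product rule and coercivity, and their integrals over Euclidean balls are
  inner products of \<open>u\<close> with fixed bounded functions on the manifold.\<close>

lemma localized_weakly_null_imp_L2_null:
  fixes \<rho> :: "'a \<Rightarrow> real" and u :: "nat \<Rightarrow> 'a \<Rightarrow> complex"
  assumes c: "c \<in> \<A>" and K: "compact K" "K \<subseteq> dom_chart c"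
    and \<rho>: "C1_fun \<A> \<rho>" "\<And>q. q \<notin> K \<Longrightarrow> \<rho> q = 0"
    and u: "\<And>m. C1_fun \<A> (u m)"
    and L2: "\<And>m. (LINT x|vol. (cmod (u m x))\<^sup>2) \<le> B"
    and energy: "\<And>m. Re (LINT x|vol. gradient_form (u m) (u m) x) \<le> B"
    and weak: "\<And>q. square_integrable vol q \<Longrightarrow> (\<lambda>m. LINT x|vol. u m x * q x) \<longlonglongrightarrow> 0"
  shows "(\<lambda>m. LINT x|vol. (cmod (of_real (\<rho> x) * u m x))\<^sup>2) \<longlonglongrightarrow> 0"
proof -
  let ?S = "img_chart c" and ?K = "snd c ` K"
  have S: "open ?S" by (rule open_img[OF c])
  have cK: "compact ?K"
    by (intro compact_continuous_image K continuous_on_subset[OF cont_chart[OF c]])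
  have KS: "?K \<subseteq> ?S" using K by blast
  define r where "r y = complex_of_real ((\<rho> \<circ> inv_chart c) y)" for y
  define v where "v m = u m \<circ> inv_chart c" for m
  have r: "C1_on ?S r" unfolding r_def
    by (rule C1_on_bounded_linear(1)[OF bounded_linear_of_real S C1_fun_chart[OF \<rho>(1) c]])
  have v: "C1_on ?S (v m)" for m unfolding v_def by (rule C1_fun_chart[OF u c])
  have inK: "inv_chart c y \<in> K \<longleftrightarrow> y \<in> ?K" if "y \<in> ?S" for y
  proof
    assume "inv_chart c y \<in> K"
    then have "snd c (inv_chart c y) \<in> ?K" by (rule imageI)
    then show "y \<in> ?K" by (simp add: chart_inv_chart[OF c that])
  next
    assume "y \<in> ?K"
    then obtain x where "x \<in> K" "y = snd c x" by blast
    then show "inv_chart c y \<in> K" using K(2) inv_chart_chart[OF c, of x] by auto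
  qed
  have r0: "r y = 0" if "y \<in> ?S - ?K" for y
    using that inK \<rho>(2) by (simp add: r_def)
  define F where "F m y = (if y \<in> ?S then r y * v m y else 0)" for m y
  have F: "C1_on UNIV (F m)" for m unfolding F_def
    by (rule C1_extend_by_0[OF S cK KS]) (use r0 C1_on_mult[OF S r v] in auto)
  have F0: "F m y = 0" if "y \<notin> ?K" for m y using that r0 by (simp add: F_def)
  obtain R where R: "\<And>x. norm (\<rho> x) \<le> R" using continuous_bounded[OF C1_fun_continuous[OF \<rho>(1)]] by blast
  have R0: "R \<ge> 0" using order_trans[OF norm_ge_zero R] .
  have rR: "(cmod (r y))\<^sup>2 \<le> R\<^sup>2" for y
    using R unfolding r_def by (intro power_mono) auto
  have "bounded (gradient_sq r ` ?K)"
    by (intro compact_imp_bounded compact_continuous_image cK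
        continuous_on_subset[OF continuous_on_gradient_sq[OF r] KS])
  then obtain D where D0: "\<And>y. y \<in> ?K \<Longrightarrow> norm (gradient_sq r y) \<le> D"
    unfolding bounded_iff by blast
  have D: "gradient_sq r y \<le> max D 0" if "y \<in> ?K" for y using D0[OF that] by simp
  obtain b where b: "b > 0"
    "\<And>f g. integrable vol g \<Longrightarrow> (\<And>x. g x \<ge> (0::real)) \<Longrightarrow> (\<And>y. y \<in> ?K \<Longrightarrow> f y \<le> g (inv_chart c y)) \<Longrightarrow>
      (\<And>y. y \<notin> ?K \<Longrightarrow> f y = 0) \<Longrightarrow> (\<And>y. f y \<ge> 0) \<Longrightarrow> (LINT y|lborel. f y) \<le> b * (LINT x|vol. g x)"
    using lebesgue_integral_le_vol_integral[OF c K] by blast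
  obtain b' where b': "b' > 0"
    "\<And>u p. C1_fun \<A> u \<Longrightarrow> p \<in> K \<Longrightarrow> gradient_sq (u \<circ> inv_chart c) (snd c p) \<le> b' * Re (gradient_form u u p)"
    using gradient_form_coercive[OF c K] by blast
  have iu: "integrable vol (\<lambda>x. (cmod (u m x))\<^sup>2)" for m
    by (intro integrable_continuous continuous_intros C1_fun_continuous u)
  have ig: "integrable vol (gradient_form (u m) (u m))" for m
    by (intro integrable_continuous gradient_form_continuous u)
  have B0: "B \<ge> 0" by (rule order_trans[OF _ L2[of 0]]) simp
  define B1 where "B1 = b * (R\<^sup>2 * B)"
  define B2 where "B2 = b * (2 * R\<^sup>2 * b' * B + 2 * max D 0 * B)"
  have L2F: "(LINT y|lborel. (cmod (F m y))\<^sup>2) \<le> B1" for m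
  proof -
    have "(LINT y|lborel. (cmod (F m y))\<^sup>2) \<le> b * (LINT x|vol. R\<^sup>2 * (cmod (u m x))\<^sup>2)"
    proof (rule b(2))
      show "(cmod (F m y))\<^sup>2 \<le> R\<^sup>2 * (cmod (u m (inv_chart c y)))\<^sup>2" for y
        using rR[of y] by (simp add: F_def v_def norm_mult power_mult_distrib mult_right_mono)
    qed (use iu F0 in auto)
    also have "\<dots> \<le> B1" unfolding B1_def using b(1) L2[of m] by (simp add: mult_left_mono)
    finally show ?thesis .
  qed
  have gradF: "(LINT y|lborel. gradient_sq (F m) y) \<le> B2" for m
  proof -
    define g where "g x = 2 * R\<^sup>2 * b' * Re (gradient_form (u m) (u m) x) + 2 * max D 0 * (cmod (u m x))\<^sup>2" for x
    have gi: "integrable vol g" unfolding g_def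
      by (intro Bochner_Integration.integrable_add integrable_mult_right iu integrable_Re ig)
    have "(LINT y|lborel. gradient_sq (F m) y) \<le> b * (LINT x|vol. g x)"
    proof (rule b(2)[OF gi])
      show "g x \<ge> 0" for x unfolding g_def
        using gradient_form_nonneg[OF u] b'(1) by (intro add_nonneg_nonneg mult_nonneg_nonneg) auto
      show "gradient_sq (F m) y = 0" if "y \<notin> ?K" for y
        using partial_eq_0_off_support[OF compact_imp_closed[OF cK], of "F m" y] F0 that by (simp add: gradient_sq_def)
      show "gradient_sq (F m) y \<ge> 0" for y by (simp add: gradient_sq_def sum_nonneg)
      show "gradient_sq (F m) y \<le> g (inv_chart c y)" if y: "y \<in> ?K" for y
      proof -
        have yS: "y \<in> ?S" using y KS by blast
        have "partial i (F m) y = r y * partial i (v m) y + partial i r y * v m y" for i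
        proof -
          have "partial i (F m) y = partial i (\<lambda>y. r y * v m y) y"
            by (rule partial_cong[OF S _ yS]) (simp add: F_def)
          also have "\<dots> = r y * partial i (v m) y + partial i r y * v m y"
            by (rule bounded_bilinear.partial_prod[OF bounded_bilinear_mult S r v yS])
          finally show ?thesis .
        qed
        then have "gradient_sq (F m) y \<le> (\<Sum>i\<in>UNIV. 2 * (cmod (r y * partial i (v m) y))\<^sup>2 + 2 * (cmod (partial i r y * v m y))\<^sup>2)"
          unfolding gradient_sq_def by (intro sum_mono) (simp add: norm_add_square_le)
        also have "\<dots> = 2 * (cmod (r y))\<^sup>2 * gradient_sq (v m) y + 2 * gradient_sq r y * (cmod (v m y))\<^sup>2"
          by (simp add: gradient_sq_def sum.distrib sum_distrib_left sum_distrib_right norm_mult power_mult_distrib mult_ac)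
        also have "\<dots> \<le> 2 * R\<^sup>2 * (b' * Re (gradient_form (u m) (u m) (inv_chart c y))) + 2 * max D 0 * (cmod (v m y))\<^sup>2"
        proof (intro add_mono mult_mono)
          show "gradient_sq (v m) y \<le> b' * Re (gradient_form (u m) (u m) (inv_chart c y))"
            using b'(2)[OF u, of "inv_chart c y" m] inK[OF yS] y chart_inv_chart[OF c yS] by (simp add: v_def)
        qed (use rR D[OF y] in \<open>auto simp: gradient_sq_def sum_nonneg\<close>)
        finally show ?thesis by (simp add: g_def v_def mult_ac)
      qed
    qed
    also have "(LINT x|vol. g x) = 2 * R\<^sup>2 * b' * Re (LINT x|vol. gradient_form (u m) (u m) x) + 2 * max D 0 * (LINT x|vol. (cmod (u m x))\<^sup>2)"
      unfolding g_def using iu ig by (subst Bochner_Integration.integral_add) auto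
    also have "b * \<dots> \<le> B2"
      unfolding B2_def using b(1) b'(1) L2[of m] energy[of m]
      by (intro mult_left_mono add_mono) (auto intro!: mult_left_mono)
    finally show ?thesis .
  qed
  have weakF: "(\<lambda>m. LINT z|lborel. indicator (cball y t) z *\<^sub>R F m z) \<longlonglongrightarrow> 0" for y t
  proof -
    define W where "W = dom_chart c - (dom_chart c \<inter> snd c -` (- cball y t))"
    have W: "W \<in> sets borel" unfolding W_def
      by (intro sets.Diff borel_open open_dom[OF c] continuous_open_preimage[OF cont_chart[OF c] open_dom[OF c]]) auto
    define d where "d x = (if x \<in> dom_chart c then \<rho> x / vol_density c (snd c x) else 0)" for x
    have dm: "d \<in> borel_measurable borel" unfolding d_def
    proof (rule borel_measurable_continuous_on_if)
      show "continuous_on (dom_chart c) (\<lambda>x. \<rho> x / vol_density c (snd c x))"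
        by (intro continuous_intros continuous_on_subset[OF C1_fun_continuous[OF \<rho>(1)]]
            continuous_on_compose2[OF C1_on_continuous[OF vol_density_C1[OF c]] cont_chart[OF c]])
          (use vol_density_nonzero[OF c] in auto)
    qed (auto intro: borel_open open_dom[OF c])
    \<comment> \<open>The function on the manifold that represents integration of \<open>\<rho> u\<close> over a ball in the chart.\<close>
    define q where "q x = complex_of_real (d x * indicator W x)" for x
    have "continuous_on K (\<lambda>x. \<rho> x / vol_density c (snd c x))"
      by (intro continuous_intros continuous_on_subset[OF C1_fun_continuous[OF \<rho>(1)]]
          continuous_on_compose2[OF C1_on_continuous[OF vol_density_C1[OF c]] continuous_on_subset[OF cont_chart[OF c] K(2)]])
        (use vol_density_nonzero[OF c] K(2) in auto)
    then have "bounded ((\<lambda>x. \<rho> x / vol_density c (snd c x)) ` K)"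
      by (intro compact_imp_bounded compact_continuous_image K)
    then obtain M where M: "\<And>x. x \<in> K \<Longrightarrow> norm (\<rho> x / vol_density c (snd c x)) \<le> M"
      unfolding bounded_iff by blast
    have dM: "\<bar>d x\<bar> \<le> max M 0" for x
      using M[of x] \<rho>(2)[of x] K(2) by (cases "x \<in> K") (auto simp: d_def)
    have qM: "cmod (q x) \<le> max M 0" for x
      using dM[of x] unfolding q_def norm_of_real abs_mult by (cases "x \<in> W") auto
    have qm: "q \<in> borel_measurable borel"
    proof -
      note [measurable] = dm W
      show ?thesis unfolding q_def by measurable
    qed
    have "square_integrable vol q"
      unfolding square_integrable_def
    proof
      show "integrable vol (\<lambda>x. (cmod (q x))\<^sup>2)"
        by (rule integrable_const_bound[of _ "(max M 0)\<^sup>2"])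
          (use qm power_mono[OF qM norm_ge_zero, of _ 2] in auto)
    qed (use qm in simp)
    then have "(\<lambda>m. LINT x|vol. u m x * q x) \<longlonglongrightarrow> 0" by (rule weak)
    moreover have "(LINT x|vol. u m x * q x) = (LINT z|lborel. indicator (cball y t) z *\<^sub>R F m z)" for m
    proof -
      have "(LINT x|vol. u m x * q x)
          = (LINT z|lborel. (if z \<in> ?S then vol_density c z *\<^sub>R (u m (inv_chart c z) * q (inv_chart c z)) else 0))"
        by (rule integral_vol_chart[OF c borel_measurable_times[OF
                borel_measurable_continuous_onI[OF C1_fun_continuous[OF u]] qm]])
          (simp add: q_def d_def)
      also have "\<dots> = (LINT z|lborel. indicator (cball y t) z *\<^sub>R F m z)"
      proof (intro Bochner_Integration.integral_cong refl)
        fix z :: "real ^ 'n"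
        show "(if z \<in> ?S then vol_density c z *\<^sub>R (u m (inv_chart c z) * q (inv_chart c z)) else 0)
            = indicator (cball y t) z *\<^sub>R F m z"
        proof (cases "z \<in> ?S")
          case True
          have "inv_chart c z \<in> W \<longleftrightarrow> z \<in> cball y t"
            unfolding W_def using inv_chart_in[OF c True] chart_inv_chart[OF c True] by auto
          then show ?thesis
            using True inv_chart_in[OF c True] vol_density_pos[OF c True]
            by (auto simp: q_def d_def F_def r_def v_def chart_inv_chart[OF c True] indicator_def scaleR_conv_of_real)
        qed (simp add: F_def)
      qed
      finally show ?thesis .
    qed
    ultimately show ?thesis by simp
  qed
  have lim: "(\<lambda>m. LINT y|lborel. (cmod (F m y))\<^sup>2) \<longlonglongrightarrow> 0"
  proof (rule weakly_null_imp_L2_null[OF F cK F0, where B = "max B1 B2"])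
    show "(LINT y|lborel. gradient_sq (F m) y) \<le> max B1 B2" for m using gradF[of m] by simp
    show "(LINT y|lborel. (cmod (F m y))\<^sup>2) \<le> max B1 B2" for m using L2F[of m] by simp
  qed (use weakF in auto)
  have "bounded (vol_density c ` ?K)"
    by (intro compact_imp_bounded compact_continuous_image cK
        continuous_on_subset[OF C1_on_continuous[OF vol_density_C1[OF c]] KS])
  then obtain V where V: "\<And>y. y \<in> ?K \<Longrightarrow> norm (vol_density c y) \<le> V"
    unfolding bounded_iff by blast
  have le: "(LINT x|vol. (cmod (of_real (\<rho> x) * u m x))\<^sup>2) \<le> max V 0 * (LINT y|lborel. (cmod (F m y))\<^sup>2)" for m
  proof -
    have "(LINT x|vol. (cmod (of_real (\<rho> x) * u m x))\<^sup>2)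
       = (LINT y|lborel. (if y \<in> ?S then vol_density c y *\<^sub>R (cmod (of_real (\<rho> (inv_chart c y)) * u m (inv_chart c y)))\<^sup>2 else 0))"
    proof (rule integral_vol_chart[OF c borel_measurable_continuous_onI])
      show "continuous_on UNIV (\<lambda>x. (cmod (of_real (\<rho> x) * u m x))\<^sup>2)"
        by (intro continuous_intros C1_fun_continuous \<rho> u)
    qed (use \<rho>(2) K(2) in auto)
    also have "\<dots> \<le> (LINT y|lborel. max V 0 * (cmod (F m y))\<^sup>2)"
    proof (rule integral_mono')
      show "integrable lborel (\<lambda>y. max V 0 * (cmod (F m y))\<^sup>2)"
        by (rule integrable_compact_support[OF _ cK])
          (use F0 in \<open>auto intro!: continuous_intros C1_on_continuous[OF F]\<close>)
      show "(if y \<in> ?S then vol_density c y *\<^sub>R (cmod (of_real (\<rho> (inv_chart c y)) * u m (inv_chart c y)))\<^sup>2 else 0)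
          \<le> max V 0 * (cmod (F m y))\<^sup>2" for y
      proof (cases "y \<in> ?K")
        case True
        then have "vol_density c y \<le> max V 0" using V[OF True] by simp
        then show ?thesis using True KS by (auto simp: F_def r_def v_def intro!: mult_right_mono)
      next
        case False
        then have "\<rho> (inv_chart c y) = 0" if "y \<in> ?S" using inK[OF that] \<rho>(2) by blast
        then show ?thesis by simp
      qed
    qed simp
    finally show ?thesis by simp
  qed
  show ?thesis
  proof (rule tendsto_sandwich[OF _ _ tendsto_const])
    show "(\<lambda>m. max V 0 * (LINT y|lborel. (cmod (F m y))\<^sup>2)) \<longlonglongrightarrow> 0"
      by (rule tendsto_mult_right_zero[OF lim])
  qed (use le in auto)
qed

end

section \<open>Orthonormal bases of eigenfunctions\<close>

locale eigenbasis = riemannian_volume \<A> G vol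
  for \<A> :: "('a::{t2_space, second_countable_topology}, 'n::finite) chart set"
    and G :: "('a, 'n) riem_metric" and vol :: "'a measure" +
  fixes e :: "nat \<Rightarrow> 'a \<Rightarrow> complex" and l :: "nat \<Rightarrow> real"
  assumes eigenbasis: "orthonormal_eigenbasis \<A> G vol e l"
begin

lemma l_nonneg: "l j \<ge> 0"
  and e_eigenspace: "e j \<in> eigenspace \<A> G (l j)"
  and orthonormal: "L2_inner vol (e i) (e j) = (if i = j then 1 else 0)"
  and complete: "square_integrable vol f \<Longrightarrow>
    (\<lambda>n. L2_norm vol (\<lambda>x. f x - (\<Sum>j<n. L2_inner vol f (e j) * e j x))) \<longlonglongrightarrow> 0"
  using eigenbasis unfolding orthonormal_eigenbasis_def by blast+

lemma e_square_integrable: "square_integrable vol (e j)"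
  by (rule eigenspaceD(5)[OF e_eigenspace])

lemma e_L2_norm: "L2_norm vol (e j) = 1"
proof -
  have "complex_of_real ((L2_norm vol (e j))\<^sup>2) = 1"
    unfolding L2_norm_square_inner orthonormal by simp
  then have "(L2_norm vol (e j))\<^sup>2 = 1" by (simp only: of_real_eq_1_iff)
  then show ?thesis using L2_norm_nonneg[of vol "e j"] by (simp add: power2_eq_1_iff)
qed

lemma coefficient_lincomb:
  assumes "finite J"
  shows "L2_inner vol (\<lambda>x. \<Sum>j\<in>J. a j * e j x) (e i) = (if i \<in> J then a i else 0)"
proof -
  have "L2_inner vol (\<lambda>x. \<Sum>j\<in>J. a j * e j x) (e i) = (\<Sum>j\<in>J. if j = i then a j else 0)"
    by (subst L2_inner_sum_left[OF e_square_integrable e_square_integrable])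
      (intro sum.cong refl, simp add: orthonormal)
  also have "\<dots> = (if i \<in> J then a i else 0)" using assms by (simp add: sum.delta)
  finally show ?thesis .
qed

lemma lincomb_square_integrable: "square_integrable vol (\<lambda>x. \<Sum>j\<in>J. a j * e j x)"
  by (intro square_integrable_sum square_integrable_cmult e_square_integrable)

text \<open>The remainders in the expansion of \<open>f\<close> bound its coefficients, because \<open>e n\<close> is orthogonal to the
  first \<open>n\<close> basis vectors.\<close>

lemma coefficients_tendsto_0:
  assumes f: "square_integrable vol f"
  shows "(\<lambda>n. L2_inner vol f (e n)) \<longlonglongrightarrow> 0"
proof (rule Lim_null_comparison[OF _ complete[OF f]])
  have "cmod (L2_inner vol f (e n)) \<le> L2_norm vol (\<lambda>x. f x - (\<Sum>j<n. L2_inner vol f (e j) * e j x))" for n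
  proof -
    let ?S = "\<lambda>x. \<Sum>j<n. L2_inner vol f (e j) * e j x"
    have "L2_inner vol (\<lambda>x. f x - ?S x) (e n) = L2_inner vol f (e n)"
      by (subst L2_inner_diff_left[OF f lincomb_square_integrable e_square_integrable])
        (simp add: coefficient_lincomb)
    moreover have "cmod (L2_inner vol (\<lambda>x. f x - ?S x) (e n)) \<le> L2_norm vol (\<lambda>x. f x - ?S x) * L2_norm vol (e n)"
      by (rule L2_Cauchy_Schwarz[OF square_integrable_diff[OF f lincomb_square_integrable] e_square_integrable])
    ultimately show ?thesis by (simp add: e_L2_norm)
  qed
  then show "\<forall>\<^sub>F n in sequentially. norm (L2_inner vol f (e n)) \<le> L2_norm vol (\<lambda>x. f x - (\<Sum>j<n. L2_inner vol f (e j) * e j x))"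
    by simp
qed

text \<open>If only finitely many coefficients are nonzero, then the remainders of the expansion are eventually
  constant, hence zero.\<close>

lemma finite_expansion:
  assumes f: "square_integrable vol f" and J: "finite J" "\<And>j. j \<notin> J \<Longrightarrow> L2_inner vol f (e j) = 0"
  shows "AE x in vol. f x = (\<Sum>j\<in>J. L2_inner vol f (e j) * e j x)"
proof -
  let ?S = "\<lambda>x. \<Sum>j\<in>J. L2_inner vol f (e j) * e j x"
  obtain n0 where n0: "J \<subseteq> {..<n0}" using finite_nat_iff_bounded J(1) by blast
  have "(\<Sum>j<n. L2_inner vol f (e j) * e j x) = ?S x" if "n \<ge> n0" for n x
    by (rule sum.mono_neutral_right) (use n0 that J(2) in auto)
  then have "\<forall>\<^sub>F n in sequentially. L2_norm vol (\<lambda>x. f x - (\<Sum>j<n. L2_inner vol f (e j) * e j x)) = L2_norm vol (\<lambda>x. f x - ?S x)"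
    by (intro eventually_sequentiallyI[of n0]) simp
  then have "(\<lambda>n::nat. L2_norm vol (\<lambda>x. f x - ?S x)) \<longlonglongrightarrow> 0"
    using complete[OF f] by (rule Lim_transform_eventually[rotated])
  then have "L2_norm vol (\<lambda>x. f x - ?S x) = 0" by (simp add: LIMSEQ_const_iff)
  then have 0: "(LINT x|vol. (cmod (f x - ?S x))\<^sup>2) = 0" unfolding L2_norm_def by simp
  have "integrable vol (\<lambda>x. (cmod (f x - ?S x))\<^sup>2)"
    by (rule square_integrable_integrable[OF square_integrable_diff[OF f lincomb_square_integrable]])
  from integral_nonneg_eq_0_iff_AE[OF this] 0 have "AE x in vol. (cmod (f x - ?S x))\<^sup>2 = 0" by simp
  then show ?thesis by (rule AE_mp) (intro AE_I2, simp)
qed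

lemma lincomb_L2_norm:
  assumes "finite J"
  shows "(L2_norm vol (\<lambda>x. \<Sum>j\<in>J. a j * e j x))\<^sup>2 = (\<Sum>j\<in>J. (cmod (a j))\<^sup>2)"
proof -
  have "complex_of_real ((L2_norm vol (\<lambda>x. \<Sum>j\<in>J. a j * e j x))\<^sup>2) = (\<Sum>j\<in>J. cnj (a j) * a j)"
    unfolding L2_norm_square_inner
    by (subst L2_inner_sum_right[OF e_square_integrable lincomb_square_integrable])
      (simp add: coefficient_lincomb[OF assms])
  also have "\<dots> = complex_of_real (\<Sum>j\<in>J. (cmod (a j))\<^sup>2)"
    by (simp add: complex_norm_square mult.commute del: of_real_power)
  finally show ?thesis by (simp only: of_real_eq_iff)
qed

text \<open>Infinitely many basis functions with bounded eigenvalues would form a weakly null sequence of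
  unit vectors with bounded energy, against Rellich compactness.\<close>

theorem finite_eigenvalues_below: "finite {j. l j \<le> L}"
proof (rule ccontr)
  assume inf: "infinite {j. l j \<le> L}"
  define \<sigma> where "\<sigma> = enumerate {j. l j \<le> L}"
  have \<sigma>: "strict_mono \<sigma>" unfolding \<sigma>_def by (rule strict_mono_enumerate[OF inf])
  have lL: "l (\<sigma> m) \<le> L" for m using enumerate_in_set[OF inf, of m] by (simp add: \<sigma>_def)
  define u where "u m = e (\<sigma> m)" for m
  have ue: "u m \<in> eigenspace \<A> G (l (\<sigma> m))" for m unfolding u_def by (rule e_eigenspace)
  have u1: "(LINT x|vol. (cmod (u m x))\<^sup>2) = 1" for m
    using e_L2_norm[of "\<sigma> m"] by (simp add: u_def L2_norm_square[symmetric])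
  have en: "Re (LINT x|vol. gradient_form (u m) (u m) x) \<le> max (L\<^sup>2) 1" for m
  proof -
    have "(LINT x|vol. gradient_form (u m) (u m) x) = (l (\<sigma> m))\<^sup>2 *\<^sub>R 1"
      unfolding eigenspace_energy[OF ue eigenspaceD(3)[OF ue]] by (simp add: u_def orthonormal)
    moreover have "(l (\<sigma> m))\<^sup>2 \<le> L\<^sup>2" by (intro power_mono lL l_nonneg)
    ultimately show ?thesis by simp
  qed
  have weak: "(\<lambda>m. LINT x|vol. u m x * q x) \<longlonglongrightarrow> 0" if q: "square_integrable vol q" for q
  proof -
    have q': "square_integrable vol (\<lambda>x. cnj (q x))" using q by (auto simp: square_integrable_def)
    have "(\<lambda>n. cnj (L2_inner vol (\<lambda>x. cnj (q x)) (e n))) \<longlonglongrightarrow> cnj 0"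
      by (intro tendsto_cnj coefficients_tendsto_0 q')
    from LIMSEQ_subseq_LIMSEQ[OF this \<sigma>] show ?thesis
      by (simp add: o_def L2_inner_cnj) (simp add: L2_inner_def u_def)
  qed
  obtain I c and \<rho> :: "'a \<Rightarrow> 'a \<Rightarrow> real" and K where P: "finite I" "\<And>k. k \<in> I \<Longrightarrow> c k \<in> \<A>"
    "\<And>k. k \<in> I \<Longrightarrow> C1_fun \<A> (\<rho> k)"
    "\<And>k. k \<in> I \<Longrightarrow> compact (K k)" "\<And>k. k \<in> I \<Longrightarrow> K k \<subseteq> dom_chart (c k)"
    "\<And>k q. k \<in> I \<Longrightarrow> q \<notin> K k \<Longrightarrow> \<rho> k q = 0" "\<And>q. (\<Sum>k\<in>I. \<rho> k q) = 1"
    by (rule partition_of_unity) blast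
  let ?T = "\<lambda>k m. LINT x|vol. (cmod (of_real (\<rho> k x) * u m x))\<^sup>2"
  have lim: "(\<lambda>m. ?T k m) \<longlonglongrightarrow> 0" if k: "k \<in> I" for k
  proof (rule localized_weakly_null_imp_L2_null[OF P(2)[OF k] P(4)[OF k] P(5)[OF k] P(3)[OF k] P(6)[OF k] _ _ en weak])
    show "C1_fun \<A> (u m)" for m by (rule eigenspaceD(3)[OF ue])
    show "(LINT x|vol. (cmod (u m x))\<^sup>2) \<le> max (L\<^sup>2) 1" for m unfolding u1 by simp
  qed
  have "1 \<le> real (card I) * (\<Sum>k\<in>I. ?T k m)" for m
  proof -
    have i: "integrable vol (\<lambda>x. (cmod (of_real (\<rho> k x) * u m x))\<^sup>2)" if "k \<in> I" for k
      by (intro integrable_continuous continuous_intros C1_fun_continuous P(3) that eigenspaceD(4)[OF ue])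
    have "(cmod (u m x))\<^sup>2 \<le> real (card I) * (\<Sum>k\<in>I. (cmod (of_real (\<rho> k x) * u m x))\<^sup>2)" for x
    proof -
      have "u m x = (\<Sum>k\<in>I. of_real (\<rho> k x) * u m x)"
        unfolding sum_distrib_right[symmetric] of_real_sum[symmetric] P(7) by simp
      then have "cmod (u m x) \<le> (\<Sum>k\<in>I. cmod (of_real (\<rho> k x) * u m x))"
        using norm_sum[of "\<lambda>k. of_real (\<rho> k x) * u m x" I] by simp
      then have "(cmod (u m x))\<^sup>2 \<le> (\<Sum>k\<in>I. cmod (of_real (\<rho> k x) * u m x))\<^sup>2"
        by (intro power_mono) auto
      also have "\<dots> \<le> (\<Sum>k\<in>I. (cmod (of_real (\<rho> k x) * u m x))\<^sup>2) * real (card I)"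
        by (rule sum_squared_le_sum_of_squares)
      finally show ?thesis by (simp add: mult.commute)
    qed
    then have "(LINT x|vol. (cmod (u m x))\<^sup>2) \<le> (LINT x|vol. real (card I) * (\<Sum>k\<in>I. (cmod (of_real (\<rho> k x) * u m x))\<^sup>2))"
      by (intro Bochner_Integration.integral_mono integrable_mult_right Bochner_Integration.integrable_sum i
          square_integrable_integrable eigenspaceD(5)[OF ue])
    also have "\<dots> = real (card I) * (\<Sum>k\<in>I. ?T k m)"
      using Bochner_Integration.integral_sum[OF i, of I "\<lambda>k. k"] by simp
    finally show ?thesis using u1 by simp
  qed
  moreover have "(\<lambda>m. real (card I) * (\<Sum>k\<in>I. ?T k m)) \<longlonglongrightarrow> real (card I) * (\<Sum>k\<in>I. 0)"
    by (intro tendsto_mult_left tendsto_sum lim)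
  ultimately have "1 \<le> real (card I) * (\<Sum>k\<in>I. 0)"
    by (intro LIMSEQ_le_const) auto
  then show False by simp
qed

lemma finite_eigenvalue: "finite {j. l j = \<nu>}"
  by (rule finite_subset[OF _ finite_eigenvalues_below[of \<nu>]]) auto

lemma eigenspace_expansion:
  assumes v: "v \<in> eigenspace \<A> G \<nu>" and \<nu>: "\<nu> \<ge> 0"
  shows "AE x in vol. v x = (\<Sum>j | l j = \<nu>. L2_inner vol v (e j) * e j x)"
proof (rule finite_expansion[OF eigenspaceD(5)[OF v] finite_eigenvalue])
  fix j assume "j \<notin> {j. l j = \<nu>}"
  then have "\<nu>\<^sup>2 \<noteq> (l j)\<^sup>2" using \<nu> l_nonneg[of j] by (auto simp: power2_eq_iff)
  then show "L2_inner vol v (e j) = 0" by (rule eigenspaces_orthogonal[OF v e_eigenspace])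
qed

text \<open>The finite partial sum is one possible choice for the projection, and any other choice in the
  eigenspace has the same coefficients.\<close>

lemma eigenprojection_expansion:
  assumes f: "square_integrable vol f" and \<nu>: "\<nu> \<ge> 0"
  shows "AE x in vol. eigenprojection \<A> G vol \<nu> f x = (\<Sum>j | l j = \<nu>. L2_inner vol f (e j) * e j x)"
    and "eigenprojection \<A> G vol \<nu> f \<in> eigenspace \<A> G \<nu>"
proof -
  let ?J = "{j. l j = \<nu>}" and ?W = "eigenspace \<A> G \<nu>"
  let ?P = "\<lambda>x. \<Sum>j\<in>?J. L2_inner vol f (e j) * e j x"
  define E where "E = eigenprojection \<A> G vol \<nu> f"
  have eW: "e j \<in> ?W" if "j \<in> ?J" for j using e_eigenspace[of j] that by simp
  have PW: "?P \<in> ?W" by (rule eigenspace_lincomb) (rule eW)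
  have "L2_inner vol (\<lambda>x. f x - ?P x) v = 0" if v: "v \<in> ?W" for v
  proof -
    have sd: "square_integrable vol (\<lambda>x. f x - ?P x)"
      by (intro square_integrable_diff f lincomb_square_integrable)
    have c: "L2_inner vol (\<lambda>x. f x - ?P x) (e j) = 0" if "j \<in> ?J" for j
      using that by (subst L2_inner_diff_left[OF f lincomb_square_integrable e_square_integrable])
        (simp add: coefficient_lincomb[OF finite_eigenvalue])
    have "L2_inner vol (\<lambda>x. f x - ?P x) v
        = L2_inner vol (\<lambda>x. f x - ?P x) (\<lambda>x. \<Sum>j\<in>?J. L2_inner vol v (e j) * e j x)"
      by (rule L2_inner_cong_AE_right[OF eigenspace_expansion[OF v \<nu>]])
        (rule square_integrable_measurable eigenspaceD(5)[OF v] lincomb_square_integrable sd)+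
    also have "\<dots> = 0"
      by (subst L2_inner_sum_right[OF e_square_integrable sd]) (simp add: c)
    finally show ?thesis .
  qed
  with PW have "?P \<in> ?W \<and> (\<forall>v\<in>?W. L2_inner vol (\<lambda>x. f x - ?P x) v = 0)" by blast
  then have E: "E \<in> ?W \<and> (\<forall>v\<in>?W. L2_inner vol (\<lambda>x. f x - E x) v = 0)"
    unfolding E_def eigenprojection_def
    by (rule someI[where P = "\<lambda>u. u \<in> ?W \<and> (\<forall>v\<in>?W. L2_inner vol (\<lambda>x. f x - u x) v = 0)"])
  then show "eigenprojection \<A> G vol \<nu> f \<in> ?W" unfolding E_def by blast
  have "L2_inner vol E (e j) = L2_inner vol f (e j)" if "j \<in> ?J" for j
  proof -
    have "L2_inner vol (\<lambda>x. f x - E x) (e j) = 0" using E eW[OF that] by blast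
    then show ?thesis
      by (simp add: L2_inner_diff_left[OF f eigenspaceD(5)[OF conjunct1[OF E]] e_square_integrable])
  qed
  then show "AE x in vol. eigenprojection \<A> G vol \<nu> f x = ?P x"
    using eigenspace_expansion[OF conjunct1[OF E] \<nu>] unfolding E_def by simp
qed

lemma eigenprojection_L2_norm:
  assumes f: "square_integrable vol f" and \<nu>: "\<nu> \<ge> 0"
  shows "(L2_norm vol (eigenprojection \<A> G vol \<nu> f))\<^sup>2 = (\<Sum>j | l j = \<nu>. (cmod (L2_inner vol f (e j)))\<^sup>2)"
proof -
  have "L2_norm vol (eigenprojection \<A> G vol \<nu> f) = L2_norm vol (\<lambda>x. \<Sum>j | l j = \<nu>. L2_inner vol f (e j) * e j x)"
    by (rule L2_norm_cong_AE[OF eigenprojection_expansion(1)[OF f \<nu>]])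
      (rule square_integrable_measurable lincomb_square_integrable eigenspaceD(5) eigenprojection_expansion(2)[OF f \<nu>])+
  then show ?thesis by (simp add: lincomb_L2_norm[OF finite_eigenvalue])
qed

end

section \<open>Neighborhoods are open\<close>

text \<open>For functions that need not be measurable, such as the speed of a curve, the integral is a lower
  integral; it is still subadditive when one summand is measurable and finite.\<close>

lemma nn_integral_add_le:
  fixes c h :: "'a \<Rightarrow> ennreal"
  assumes [measurable]: "c \<in> borel_measurable M" and fin: "\<And>x. c x < \<infinity>"
  shows "(\<integral>\<^sup>+x. c x + h x \<partial>M) \<le> (\<integral>\<^sup>+x. c x \<partial>M) + (\<integral>\<^sup>+x. h x \<partial>M)"
  unfolding nn_integral_def[of M "\<lambda>x. c x + h x"]
proof (rule SUP_least)
  fix g assume "g \<in> {g. simple_function M g \<and> g \<le> (\<lambda>x. c x + h x)}"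
  then have g: "simple_function M g" and le: "\<And>x. g x \<le> c x + h x" by (auto simp: le_fun_def)
  have [measurable]: "g \<in> borel_measurable M" by (rule borel_measurable_simple_function[OF g])
  have "integral\<^sup>S M g = (\<integral>\<^sup>+x. g x \<partial>M)" by (rule nn_integral_eq_simple_integral[OF g, symmetric])
  also have "\<dots> \<le> (\<integral>\<^sup>+x. c x + (g x - c x) \<partial>M)"
  proof (rule nn_integral_mono)
    fix x
    show "g x \<le> c x + (g x - c x)"
    proof (cases "c x \<le> g x")
      case True
      then show ?thesis by (simp add: add_diff_inverse_ennreal)
    next
      case False
      then have "g x \<le> c x" by simp
      then show ?thesis by (rule add_increasing2[OF zero_le])
    qed
  qed
  also have "\<dots> = (\<integral>\<^sup>+x. c x \<partial>M) + (\<integral>\<^sup>+x. g x - c x \<partial>M)"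
    by (rule nn_integral_add) measurable
  also have "\<dots> \<le> (\<integral>\<^sup>+x. c x \<partial>M) + (\<integral>\<^sup>+x. h x \<partial>M)"
  proof (intro add_left_mono nn_integral_mono)
    fix x
    have "g x - c x \<le> (c x + h x) - c x" by (rule ennreal_minus_mono[OF le order_refl])
    also have "\<dots> = h x" using fin[of x] by simp
    finally show "g x - c x \<le> h x" .
  qed
  finally show "integral\<^sup>S M g \<le> (\<integral>\<^sup>+x. c x \<partial>M) + (\<integral>\<^sup>+x. h x \<partial>M)" .
qed

lemma has_vector_derivative_cong_open:
  assumes "open N" "t \<in> N" "\<And>s. s \<in> N \<Longrightarrow> f s = g s"
  shows "(f has_vector_derivative v) (at t) \<longleftrightarrow> (g has_vector_derivative v) (at t)"
  using has_vector_derivative_transform_within_open[of f v t N g]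
    has_vector_derivative_transform_within_open[of g v t N f] assms by metis

text \<open>Piecewise differentiability uses two-sided derivatives, so that agreement on a closed interval does not
  determine the derivatives at its endpoints; these are added to the exceptional points.\<close>

lemma piecewise_C1_differentiable_cong:
  fixes f g :: "real \<Rightarrow> 'a::real_normed_vector"
  assumes "f piecewise_C1_differentiable_on {\<alpha>..\<beta>}" "\<And>t. t \<in> {\<alpha>..\<beta>} \<Longrightarrow> f t = g t"
  shows "g piecewise_C1_differentiable_on {\<alpha>..\<beta>}"
proof -
  obtain S D where S: "finite S" and c: "continuous_on {\<alpha>..\<beta>} f"
    and D: "\<And>t. t \<in> {\<alpha>..\<beta>} - S \<Longrightarrow> (f has_vector_derivative D t) (at t)" "continuous_on ({\<alpha>..\<beta>} - S) D"
    using assms(1) unfolding piecewise_C1_differentiable_on_def C1_differentiable_on_def by blast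
  have "(g has_vector_derivative D t) (at t)" if "t \<in> {\<alpha>..\<beta>} - (S \<union> {\<alpha>, \<beta>})" for t
    using D(1)[of t] has_vector_derivative_cong_open[of "{\<alpha><..<\<beta>}" t f g] that assms(2) by auto
  moreover have "continuous_on ({\<alpha>..\<beta>} - (S \<union> {\<alpha>, \<beta>})) D"
    by (rule continuous_on_subset[OF D(2)]) auto
  moreover have "continuous_on {\<alpha>..\<beta>} g" using c assms(2) by (rule continuous_on_eq)
  ultimately show ?thesis
    unfolding piecewise_C1_differentiable_on_def C1_differentiable_on_def
    by (intro conjI exI[of _ "S \<union> {\<alpha>, \<beta>}"] exI[of _ D]) (use S in auto)
qed

context closed_riemannian_manifold
begin

text \<open>The speed is defined through an arbitrarily chosen chart; the transformation rule of the metric allows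
  any other.\<close>

lemma speed_in_chart:
  assumes c: "c \<in> \<A>" and N: "open N" "t \<in> N" "\<And>s. s \<in> N \<Longrightarrow> \<gamma> s \<in> dom_chart c"
    and v: "((snd c \<circ> \<gamma>) has_vector_derivative v) (at t)"
  shows "speed \<A> G \<gamma> t = sqrt (v \<bullet> (G c (\<gamma> t) *v v))"
proof -
  define d where "d = (SOME c. c \<in> \<A> \<and> \<gamma> t \<in> dom_chart c)"
  have tc: "\<gamma> t \<in> dom_chart c" by (rule N)+
  have "d \<in> \<A> \<and> \<gamma> t \<in> dom_chart d"
    unfolding d_def by (rule someI[of _ c]) (use c tc in auto)
  then have d: "d \<in> \<A>" and td: "\<gamma> t \<in> dom_chart d" by auto
  define f where "f = snd d \<circ> inv_chart c"
  define J where "J = matrix (frechet_derivative f (at (snd c (\<gamma> t))))"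
  have der: "(f has_derivative frechet_derivative f (at (snd c (\<gamma> t)))) (at (snd c (\<gamma> t)))"
    unfolding f_def
    by (rule C1_on_has_derivative[OF open_chart_image[OF c open_dom[OF d]] transition_C1[OF c d]])
      (use tc td in blast)
  have Jv: "frechet_derivative f (at (snd c (\<gamma> t))) w = J *v w" for w
    unfolding J_def using has_derivative_linear[OF der] by (simp add: matrix_works)
  have "((f \<circ> (snd c \<circ> \<gamma>)) has_vector_derivative J *v v) (at t)"
    using vector_derivative_diff_chain_within[of "snd c \<circ> \<gamma>" v t UNIV f "frechet_derivative f (at (snd c (\<gamma> t)))"]
      v has_derivative_at_withinI[OF der] by (simp add: Jv)
  then have "((snd d \<circ> \<gamma>) has_vector_derivative J *v v) (at t)"
    using has_vector_derivative_cong_open[OF N(1,2), of "f \<circ> (snd c \<circ> \<gamma>)" "snd d \<circ> \<gamma>"] N(3)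
    by (simp add: f_def inv_chart_chart[OF c])
  then have vd: "vector_derivative (snd d \<circ> \<gamma>) (at t) = J *v v" by (rule vector_derivative_at)
  have Gc: "G c (\<gamma> t) = transpose J ** G d (\<gamma> t) ** J"
    using metric_transformation[of "fst c" "snd c" "fst d" "snd d" "\<gamma> t" J] c d tc td by (simp add: J_def f_def)
  have "speed \<A> G \<gamma> t = sqrt ((J *v v) \<bullet> (G d (\<gamma> t) *v (J *v v)))"
    unfolding speed_def Let_def d_def[symmetric] vd ..
  also have "(J *v v) \<bullet> (G d (\<gamma> t) *v (J *v v)) = v \<bullet> (G c (\<gamma> t) *v v)"
  proof -
    have "v \<bullet> (transpose J *v w) = (J *v v) \<bullet> w" for w
      by (metis dot_lmul_matrix inner_commute transpose_matrix_vector)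
    then show ?thesis unfolding Gc by (simp add: matrix_vector_mul_assoc[symmetric])
  qed
  finally show ?thesis .
qed

lemma speed_cong:
  assumes "open N" "t \<in> N" "\<And>s. s \<in> N \<Longrightarrow> \<gamma> s = \<gamma>' s"
  shows "speed \<A> G \<gamma> t = speed \<A> G \<gamma>' t"
proof -
  have "vector_derivative (snd c \<circ> \<gamma>) (at t) = vector_derivative (snd c \<circ> \<gamma>') (at t)" for c :: "('a, 'n) chart"
    unfolding vector_derivative_def
    using has_vector_derivative_cong_open[OF assms(1,2), of "snd c \<circ> \<gamma>" "snd c \<circ> \<gamma>'"] assms(3) by simp
  then show ?thesis using assms(3)[OF assms(2)] by (simp add: speed_def)
qed

text \<open>A curve from \<open>x\<close> can be made to start at any nearby point \<open>x'\<close>: a short initial piece is replaced by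
  a straight line in a chart.\<close>

lemma curve_move_start:
  assumes \<gamma>: "piecewise_C1_curve \<A> \<gamma>" and \<epsilon>: "\<epsilon> > 0"
  obtains W where "open W" "\<gamma> 0 \<in> W"
    "\<And>x'. x' \<in> W \<Longrightarrow> \<exists>\<gamma>'. piecewise_C1_curve \<A> \<gamma>' \<and> \<gamma>' 0 = x' \<and> \<gamma>' 1 = \<gamma> 1 \<and>
      curve_length \<A> G \<gamma>' \<le> curve_length \<A> G \<gamma> + ennreal \<epsilon>"
proof -
  obtain c where c: "c \<in> \<A>" "\<gamma> 0 \<in> dom_chart c" by (rule ex_chart)
  define a0 where "a0 = snd c (\<gamma> 0)"
  obtain r where r: "r > 0" "cball a0 r \<subseteq> img_chart c"
    using open_contains_cball open_img[OF c(1)] c(2) unfolding a0_def by blast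
  define M where "M y = G c (inv_chart c y)" for y
  have "continuous_on (cball a0 r) (\<lambda>y. M y $ i $ j)" for i j
    unfolding M_def by (rule continuous_on_subset[OF C1_on_continuous[OF metric_C1[OF c(1)]] r(2)])
  then obtain \<Lambda> where \<Lambda>: "\<Lambda> > 0" "\<And>y v. y \<in> cball a0 r \<Longrightarrow> v \<bullet> (M y *v v) \<le> \<Lambda> * (norm v)\<^sup>2"
    using compact_quadratic_form_bounds(1)[of "cball a0 r" M, OF compact_cball] by blast
  \<comment> \<open>Points of the ball of radius \<open>\<eta>\<close> are joined by segments of Riemannian length at most \<open>\<epsilon>\<close>.\<close>
  define \<eta> where "\<eta> = min r (\<epsilon> / (2 * sqrt \<Lambda>))"
  have \<eta>: "\<eta> > 0" "\<eta> \<le> r" "2 * \<eta> * sqrt \<Lambda> \<le> \<epsilon>"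
    using r \<Lambda> \<epsilon> by (auto simp: \<eta>_def min_def field_simps)
  define W where "W = dom_chart c \<inter> snd c -` ball a0 \<eta>"
  have W: "open W" unfolding W_def
    by (rule continuous_open_preimage[OF cont_chart[OF c(1)] open_dom[OF c(1)] open_ball])
  have W0: "\<gamma> 0 \<in> W" using c(2) \<eta>(1) by (simp add: W_def a0_def)
  have path: "continuous_on {0..1} \<gamma>" using \<gamma> by (simp add: piecewise_C1_curve_def path_def)
  obtain a where a: "0 < a" "a < 1" "\<gamma> a \<in> W"
  proof -
    obtain T where T: "open T" "T \<inter> {0..1} = \<gamma> -` W \<inter> {0..1}"
      using continuous_on_open_invariant[of "{0..1}" \<gamma>] path W by metis
    then have "0 \<in> T" using W0 by auto
    then obtain s where s: "s > 0" "ball 0 s \<subseteq> T" using T(1) open_contains_ball by blast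
    define a where "a = min (s / 2) (1 / 2)"
    have "a \<in> T" using s by (intro subsetD[OF s(2)]) (auto simp: a_def)
    then have "a \<in> \<gamma> -` W \<inter> {0..1}" using T(2) s(1) by (auto simp: a_def)
    then show ?thesis using that[of a] s(1) by (auto simp: a_def)
  qed
  have "\<exists>\<gamma>'. piecewise_C1_curve \<A> \<gamma>' \<and> \<gamma>' 0 = x' \<and> \<gamma>' 1 = \<gamma> 1 \<and>
      curve_length \<A> G \<gamma>' \<le> curve_length \<A> G \<gamma> + ennreal \<epsilon>" if x': "x' \<in> W" for x'
  proof -
    define y0 where "y0 = snd c x'"
    define b where "b = snd c (\<gamma> a)"
    define v where "v = (b - y0) /\<^sub>R a"
    define L where "L t = y0 + t *\<^sub>R v" for t
    define \<gamma>' where "\<gamma>' t = (if t \<le> a then inv_chart c (L t) else \<gamma> t)" for t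
    have y0: "y0 \<in> ball a0 \<eta>" and b: "b \<in> ball a0 \<eta>" using x' a(3) by (auto simp: W_def y0_def b_def)
    have L0: "L 0 = y0" and La: "L a = b" using a by (auto simp: L_def v_def)
    have Lball: "L t \<in> ball a0 \<eta>" if "0 \<le> t" "t \<le> a" for t
    proof -
      have "L t = (1 - t / a) *\<^sub>R y0 + (t / a) *\<^sub>R b"
        using a(1) by (simp add: L_def v_def algebra_simps divide_inverse)
      then show ?thesis
        using convexD[OF convex_ball y0 b, of "1 - t / a" "t / a"] that a(1) by simp
    qed
    have ball_img: "ball a0 \<eta> \<subseteq> img_chart c" using r(2) \<eta>(2) by (meson ball_subset_cball subset_ball order_trans)
    have Limg: "L t \<in> img_chart c" if "0 \<le> t" "t \<le> a" for t using Lball[OF that] ball_img by blast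
    have Lder: "(L has_vector_derivative v) (at t)" for t
      unfolding L_def by (auto intro!: derivative_eq_intros)
    have Lcont: "continuous_on S L" for S unfolding L_def by (intro continuous_intros)
    have g0: "\<gamma>' 0 = x'" using x' a inv_chart_chart[OF c(1)] by (simp add: \<gamma>'_def L0 y0_def W_def)
    have ga: "inv_chart c (L a) = \<gamma> a" using a(3) inv_chart_chart[OF c(1)] by (simp add: La b_def W_def)
    have g1: "\<gamma>' 1 = \<gamma> 1" using a by (simp add: \<gamma>'_def)
    have pathg: "path \<gamma>'"
    proof -
      have "continuous_on {0..a} (\<lambda>t. inv_chart c (L t))"
        by (rule continuous_on_compose2[OF cont_inv_chart[OF c(1)] Lcont]) (use Limg in auto)
      moreover have "continuous_on {a..1} \<gamma>" by (rule continuous_on_subset[OF path]) (use a in auto)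
      ultimately have "continuous_on ({0..a} \<union> {a..1}) \<gamma>'"
        unfolding \<gamma>'_def by (rule continuous_on_cases[OF closed_real_atLeastAtMost closed_real_atLeastAtMost]) (use ga in auto)
      moreover have "{0..a} \<union> {a..1} = {0..1}" using a by auto
      ultimately show ?thesis by (simp add: path_def)
    qed
    have pieces: "(snd d \<circ> \<gamma>') piecewise_C1_differentiable_on {\<alpha>..\<beta>}"
      if d: "d \<in> \<A>" and ab: "0 \<le> \<alpha>" "\<alpha> \<le> \<beta>" "\<beta> \<le> 1" and sub: "\<gamma>' ` {\<alpha>..\<beta>} \<subseteq> dom_chart d" for d \<alpha> \<beta>
    proof -
      define f where "f = snd d \<circ> inv_chart c"
      let ?S = "snd c ` (dom_chart c \<inter> dom_chart d)"
      have S: "open ?S" by (rule open_chart_image[OF c(1) open_dom[OF d]])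
      have fC1: "C1_on ?S f" unfolding f_def by (rule transition_C1[OF c(1) d])
      have line: "(\<lambda>t. f (L t)) piecewise_C1_differentiable_on {s..s'}"
        if "0 \<le> s" "s' \<le> a" "\<And>t. t \<in> {s..s'} \<Longrightarrow> inv_chart c (L t) \<in> dom_chart d" for s s'
      proof -
        have LS: "L t \<in> ?S" if t: "t \<in> {s..s'}" for t
        proof -
          have i: "L t \<in> img_chart c" using t \<open>0 \<le> s\<close> \<open>s' \<le> a\<close> by (intro Limg) auto
          then have "snd c (inv_chart c (L t)) \<in> ?S"
            using inv_chart_in[OF c(1) i] \<open>\<And>t. t \<in> {s..s'} \<Longrightarrow> inv_chart c (L t) \<in> dom_chart d\<close>[OF t] by blast
          then show ?thesis by (simp add: chart_inv_chart[OF c(1) i])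
        qed
        have "(\<lambda>t. f (L t)) C1_differentiable_on {s..s'}"
          unfolding C1_differentiable_on_def
        proof (intro exI[of _ "\<lambda>t. frechet_derivative f (at (L t)) v"] conjI ballI)
          fix t assume t: "t \<in> {s..s'}"
          have "(f has_derivative frechet_derivative f (at (L t))) (at (L t))"
            by (rule C1_on_has_derivative[OF S fC1 LS[OF t]])
          then show "((\<lambda>t. f (L t)) has_vector_derivative frechet_derivative f (at (L t)) v) (at t)"
            using vector_derivative_diff_chain_within[of L v t UNIV f "frechet_derivative f (at (L t))"] Lder[of t]
            by (simp add: o_def has_derivative_at_withinI)
        next
          show "continuous_on {s..s'} (\<lambda>t. frechet_derivative f (at (L t)) v)"
            by (rule continuous_on_compose2[OF C1_on_continuous_derivative[OF S fC1 continuous_on_const[of _ v]] Lcont])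
              (use LS in auto)
        qed
        then show ?thesis by (rule C1_differentiable_imp_piecewise)
      qed
      have old: "(snd d \<circ> \<gamma>) piecewise_C1_differentiable_on {s..s'}"
        if "0 \<le> s" "s \<le> s'" "s' \<le> 1" "\<gamma> ` {s..s'} \<subseteq> dom_chart d" for s s'
        using \<gamma> d that unfolding piecewise_C1_curve_def by (cases d) force
      have sub': "\<gamma>' t \<in> dom_chart d" if "t \<in> {\<alpha>..\<beta>}" for t using sub that by blast
      consider "\<beta> \<le> a" | "a \<le> \<alpha>" | "\<alpha> < a" "a < \<beta>" by linarith
      then show ?thesis
      proof cases
        case 1
        have "(\<lambda>t. f (L t)) piecewise_C1_differentiable_on {\<alpha>..\<beta>}"
          by (rule line[OF ab(1) 1]) (use sub' 1 in \<open>force simp: \<gamma>'_def\<close>)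
        then show ?thesis
          by (rule piecewise_C1_differentiable_cong) (use 1 in \<open>auto simp: f_def \<gamma>'_def\<close>)
      next
        case 2
        have e: "\<gamma> t = \<gamma>' t" if "t \<in> {\<alpha>..\<beta>}" for t
          using 2 that ga by (cases "t = a") (auto simp: \<gamma>'_def)
        have "(snd d \<circ> \<gamma>) piecewise_C1_differentiable_on {\<alpha>..\<beta>}"
          by (rule old[OF ab]) (use sub' e in auto)
        then show ?thesis
          by (rule piecewise_C1_differentiable_cong) (simp add: e)
      next
        case 3
        have "(\<lambda>t. f (L t)) piecewise_C1_differentiable_on {\<alpha>..a}"
          by (rule line[OF ab(1) order_refl]) (use sub' 3 in \<open>force simp: \<gamma>'_def\<close>)
        moreover have "(snd d \<circ> \<gamma>) piecewise_C1_differentiable_on {a..\<beta>}"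
        proof (rule old)
          have "\<gamma> t \<in> dom_chart d" if "t \<in> {a..\<beta>}" for t
            using sub'[of t] 3 that ga by (cases "t = a") (auto simp: \<gamma>'_def)
          then show "\<gamma> ` {a..\<beta>} \<subseteq> dom_chart d" by blast
        qed (use a 3 ab in auto)
        ultimately have "(\<lambda>t. if t \<le> a then f (L t) else (snd d \<circ> \<gamma>) t) piecewise_C1_differentiable_on {\<alpha>..\<beta>}"
          by (rule piecewise_C1_differentiable_cases) (use 3 ga in \<open>auto simp: f_def\<close>)
        moreover have "(\<lambda>t. if t \<le> a then f (L t) else (snd d \<circ> \<gamma>) t) = snd d \<circ> \<gamma>'"
          by (auto simp: fun_eq_iff f_def \<gamma>'_def)
        ultimately show ?thesis by simp
      qed
    qed
    have curve: "piecewise_C1_curve \<A> \<gamma>'"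
      unfolding piecewise_C1_curve_def using pathg pieces by auto
    define C where "C = sqrt \<Lambda> * norm v"
    have C0: "C \<ge> 0" using \<Lambda>(1) by (simp add: C_def)
    have sp1: "speed \<A> G \<gamma>' t \<le> C" if t: "0 < t" "t < a" for t
    proof -
      have Lt: "L t \<in> cball a0 r" using Lball[of t] t \<eta>(2) by (auto simp: dist_commute)
      have "speed \<A> G \<gamma>' t = sqrt (v \<bullet> (G c (\<gamma>' t) *v v))"
      proof (rule speed_in_chart[OF c(1), of "{0<..<a}"])
        show "\<gamma>' s \<in> dom_chart c" if "s \<in> {0<..<a}" for s
          using that inv_chart_in[OF c(1) Limg[of s]] by (simp add: \<gamma>'_def)
        have "snd c (\<gamma>' s) = L s" if "s \<in> {0<..<a}" for s
          using that chart_inv_chart[OF c(1) Limg[of s]] by (simp add: \<gamma>'_def)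
        then show "((snd c \<circ> \<gamma>') has_vector_derivative v) (at t)"
          using has_vector_derivative_cong_open[of "{0<..<a}" t "snd c \<circ> \<gamma>'" L v] t Lder[of t] by simp
      qed (use t in auto)
      also have "\<dots> \<le> sqrt (\<Lambda> * (norm v)\<^sup>2)"
        using \<Lambda>(2)[OF Lt, of v] t by (simp add: M_def \<gamma>'_def)
      also have "\<dots> = C" by (simp add: C_def real_sqrt_mult)
      finally show ?thesis .
    qed
    have sp2: "speed \<A> G \<gamma>' t = speed \<A> G \<gamma> t" if "a < t" for t
      by (rule speed_cong[of "{a<..}"]) (use that in \<open>auto simp: \<gamma>'_def\<close>)
    have "curve_length \<A> G \<gamma>' \<le> (\<integral>\<^sup>+t. ennreal C * indicator {0..a} t + ennreal (speed \<A> G \<gamma> t) * indicator {0..1} t \<partial>lborel)"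
      unfolding curve_length_def
    proof (rule nn_integral_mono_AE)
      have "AE t in lborel. t \<notin> {0, a}"
        by (rule AE_not_in[OF finite_imp_null_set_lborel]) simp
      then show "AE t in lborel. ennreal (speed \<A> G \<gamma>' t) * indicator {0..1} t
          \<le> ennreal C * indicator {0..a} t + ennreal (speed \<A> G \<gamma> t) * indicator {0..1} t"
      proof eventually_elim
        case (elim t)
        then consider "t < 0" | "0 < t" "t < a" | "a < t" by force
        then show ?case
        proof cases
          case 2
          then have "ennreal (speed \<A> G \<gamma>' t) \<le> ennreal C" using sp1 by (intro ennreal_leI) auto
          then show ?thesis using 2 a by (simp add: add_increasing2)
        next
          case 3
          then show ?thesis using a sp2[OF 3] by (simp add: indicator_def)
        qed simp
      qed
    qed
    also have "\<dots> \<le> (\<integral>\<^sup>+t. ennreal C * indicator {0..a} t \<partial>lborel) + curve_length \<A> G \<gamma>"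
      unfolding curve_length_def
      by (rule nn_integral_add_le) (auto simp: indicator_def)
    also have "(\<integral>\<^sup>+t. ennreal C * indicator {0..a} t \<partial>lborel) = ennreal (C * a)"
      using a C0 by (subst nn_integral_cmult_indicator) (auto simp: ennreal_mult)
    also have "C * a \<le> \<epsilon>"
    proof -
      have "norm (b - y0) \<le> 2 * \<eta>"
        using y0 b norm_triangle_ineq4[of "b - a0" "y0 - a0"] by (simp add: dist_norm norm_minus_commute)
      moreover have "C * a = sqrt \<Lambda> * norm (b - y0)"
        using a(1) by (simp add: C_def v_def)
      ultimately have "C * a \<le> sqrt \<Lambda> * (2 * \<eta>)" using \<Lambda>(1) by (simp add: mult_left_mono)
      then show ?thesis using \<eta>(3) by (simp add: mult_ac)
    qed
    finally have "curve_length \<A> G \<gamma>' \<le> curve_length \<A> G \<gamma> + ennreal \<epsilon>"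
      by (simp add: add.commute add_left_mono ennreal_leI)
    then show ?thesis using curve g0 g1 by blast
  qed
  then show ?thesis using that[OF W W0] by blast
qed

lemma open_neighborhood: "open (neighborhood \<A> G \<delta> E)"
proof (subst open_subopen, intro ballI)
  fix x assume "x \<in> neighborhood \<A> G \<delta> E"
  then obtain y where y: "y \<in> E" "riemannian_dist \<A> G x y < ennreal \<delta>"
    unfolding neighborhood_def by blast
  then obtain \<gamma> where \<gamma>: "piecewise_C1_curve \<A> \<gamma>" "\<gamma> 0 = x" "\<gamma> 1 = y" "curve_length \<A> G \<gamma> < ennreal \<delta>"
    unfolding riemannian_dist_def INF_less_iff by (auto simp: pathstart_def pathfinish_def)
  define s where "s = enn2real (curve_length \<A> G \<gamma>)"
  have "curve_length \<A> G \<gamma> < top" using \<gamma>(4) ennreal_less_top by (rule order.strict_trans)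
  then have s: "curve_length \<A> G \<gamma> = ennreal s" by (simp add: s_def)
  have s0: "s \<ge> 0" by (simp add: s_def)
  have "s < \<delta>" using \<gamma>(4) s0 unfolding s by (simp add: ennreal_less_iff)
  then have "(\<delta> - s) / 2 > 0" by simp
  then obtain W where W: "open W" "\<gamma> 0 \<in> W"
    "\<And>x'. x' \<in> W \<Longrightarrow> \<exists>\<gamma>'. piecewise_C1_curve \<A> \<gamma>' \<and> \<gamma>' 0 = x' \<and> \<gamma>' 1 = \<gamma> 1 \<and>
      curve_length \<A> G \<gamma>' \<le> curve_length \<A> G \<gamma> + ennreal ((\<delta> - s) / 2)"
    using curve_move_start[OF \<gamma>(1)] by metis
  have "W \<subseteq> neighborhood \<A> G \<delta> E"
  proof
    fix x' assume "x' \<in> W"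
    then obtain \<gamma>' where g: "piecewise_C1_curve \<A> \<gamma>'" "\<gamma>' 0 = x'" "\<gamma>' 1 = y"
      "curve_length \<A> G \<gamma>' \<le> ennreal s + ennreal ((\<delta> - s) / 2)"
      using W(3) \<gamma>(3) s by metis
    have "riemannian_dist \<A> G x' y \<le> curve_length \<A> G \<gamma>'"
      unfolding riemannian_dist_def by (rule INF_lower) (use g in \<open>simp add: pathstart_def pathfinish_def\<close>)
    also have "\<dots> \<le> ennreal (s + (\<delta> - s) / 2)" using g(4) s0 \<open>s < \<delta>\<close> by simp
    also have "\<dots> < ennreal \<delta>" using s0 \<open>s < \<delta>\<close> by (simp add: ennreal_less_iff field_simps)
    finally show "x' \<in> neighborhood \<A> G \<delta> E" using y(1) unfolding neighborhood_def by blast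
  qed
  then show "\<exists>T. open T \<and> x \<in> T \<and> T \<subseteq> neighborhood \<A> G \<delta> E"
    using W(1,2) \<gamma>(2) by blast
qed

lemma subset_neighborhood:
  assumes "\<delta> > 0"
  shows "E \<subseteq> neighborhood \<A> G \<delta> E"
proof
  fix x assume x: "x \<in> E"
  have "piecewise_C1_curve \<A> (\<lambda>_. x)"
    unfolding piecewise_C1_curve_def path_def o_def by (auto intro: piecewise_C1_differentiable_const)
  then have "riemannian_dist \<A> G x x \<le> curve_length \<A> G (\<lambda>_. x)"
    unfolding riemannian_dist_def by (intro INF_lower) (simp add: pathstart_def pathfinish_def)
  also have "\<dots> = 0"
  proof -
    have "speed \<A> G (\<lambda>_. x) t = 0" for t by (simp add: speed_def o_def Let_def)
    then show ?thesis by (simp add: curve_length_def)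
  qed
  finally have "riemannian_dist \<A> G x x < ennreal \<delta>" using assms by (simp add: le_zero_eq)
  then show "x \<in> neighborhood \<A> G \<delta> E" using x unfolding neighborhood_def by blast
qed

end

section \<open>Band-limited functions\<close>

lemma ennreal_sqrt_ennreal: "x \<ge> 0 \<Longrightarrow> ennreal_sqrt (ennreal x) = ennreal (sqrt x)"
  by (simp add: ennreal_sqrt_def)

lemma infsum_ennreal_finite_support:
  assumes "finite S" "\<And>x. x \<in> T - S \<Longrightarrow> g x = 0" "\<And>x. x \<in> S \<Longrightarrow> g x \<ge> (0::real)"
  shows "(\<Sum>\<^sub>\<infinity>x\<in>T. ennreal (g x)) = ennreal (\<Sum>x\<in>T \<inter> S. g x)"
proof -
  have "(\<Sum>\<^sub>\<infinity>x\<in>T. ennreal (g x)) = (\<Sum>\<^sub>\<infinity>x\<in>T \<inter> S. ennreal (g x))"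
    by (rule infsum_cong_neutral) (use assms(2) in auto)
  also have "\<dots> = (\<Sum>x\<in>T \<inter> S. ennreal (g x))" using assms(1) by simp
  also have "\<dots> = ennreal (\<Sum>x\<in>T \<inter> S. g x)" using assms(3) by (intro sum_ennreal) auto
  finally show ?thesis .
qed

text \<open>The part of the sum outside \<open>F\<close> is at most the fraction \<open>\<eta>\<close> of the whole, and Cauchy--Schwarz bounds the
  rest.\<close>

lemma L1_concentration:
  fixes a :: "'b \<Rightarrow> real"
  assumes S: "finite S" and F: "finite F" and a: "\<And>x. x \<in> S \<Longrightarrow> a x \<ge> 0"
    and conc: "(\<Sum>x\<in>S - F. a x) \<le> \<eta> * (\<Sum>x\<in>S. a x)"
  shows "(1 - \<eta>) * (\<Sum>x\<in>S. a x) \<le> sqrt (real (card F)) * sqrt (\<Sum>x\<in>S. (a x)\<^sup>2)"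
proof -
  have split: "(\<Sum>x\<in>S. a x) = (\<Sum>x\<in>S \<inter> F. a x) + (\<Sum>x\<in>S - F. a x)"
    using S by (metis sum.Int_Diff)
  have "(\<Sum>x\<in>S \<inter> F. a x)\<^sup>2 \<le> (\<Sum>x\<in>S \<inter> F. (a x)\<^sup>2) * real (card (S \<inter> F))"
    by (rule sum_squared_le_sum_of_squares)
  also have "\<dots> \<le> (\<Sum>x\<in>S. (a x)\<^sup>2) * real (card F)"
    using S F by (intro mult_mono sum_mono2 of_nat_mono card_mono) (auto simp: sum_nonneg)
  finally have "(\<Sum>x\<in>S \<inter> F. a x)\<^sup>2 \<le> real (card F) * (\<Sum>x\<in>S. (a x)\<^sup>2)"
    by (simp add: mult.commute)
  then have "sqrt ((\<Sum>x\<in>S \<inter> F. a x)\<^sup>2) \<le> sqrt (real (card F) * (\<Sum>x\<in>S. (a x)\<^sup>2))"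
    by (rule real_sqrt_le_mono)
  then have "(\<Sum>x\<in>S \<inter> F. a x) \<le> sqrt (real (card F)) * sqrt (\<Sum>x\<in>S. (a x)\<^sup>2)"
    using a by (simp add: real_sqrt_mult sum_nonneg)
  then show ?thesis using split conc by (simp add: left_diff_distrib)
qed

context eigenbasis
begin

abbreviation component_norm :: "('a \<Rightarrow> complex) \<Rightarrow> real \<Rightarrow> real" where
  "component_norm f \<nu> \<equiv> L2_norm vol (eigenprojection \<A> G vol \<nu> f)"

lemma finite_spectrum_below: "finite {\<nu> \<in> range l. \<nu> \<le> L}"
proof -
  have "{\<nu> \<in> range l. \<nu> \<le> L} = l ` {j. l j \<le> L}" by auto
  then show ?thesis using finite_eigenvalues_below by simp
qed

lemma sum_over_spectrum:
  "(\<Sum>j | l j \<le> L. g j) = (\<Sum>\<nu> | \<nu> \<in> range l \<and> \<nu> \<le> L. \<Sum>j | l j = \<nu>. g j)"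
proof -
  have img: "l ` {j. l j \<le> L} = {\<nu> \<in> range l. \<nu> \<le> L}" by auto
  have "(\<Sum>j | l j \<le> L. g j) = (\<Sum>\<nu>\<in>l ` {j. l j \<le> L}. \<Sum>j | j \<in> {j. l j \<le> L} \<and> l j = \<nu>. g j)"
    by (rule sum.image_gen[OF finite_eigenvalues_below])
  also have "\<dots> = (\<Sum>\<nu>\<in>l ` {j. l j \<le> L}. \<Sum>j | l j = \<nu>. g j)"
    by (intro sum.cong refl) auto
  finally show ?thesis unfolding img .
qed

context
  fixes f :: "'a \<Rightarrow> complex" and L :: real
  assumes f: "square_integrable vol f"
    and band: "\<And>\<nu>. \<nu> \<in> range l \<Longrightarrow> \<nu> > L \<Longrightarrow> AE x in vol. eigenprojection \<A> G vol \<nu> f x = 0"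
begin

lemma component_norm_above:
  assumes "\<nu> \<in> range l" "\<nu> > L"
  shows "component_norm f \<nu> = 0"
proof -
  have nn: "\<nu> \<ge> 0" using assms(1) l_nonneg by auto
  have "component_norm f \<nu> = L2_norm vol (\<lambda>x. 0)"
    by (rule L2_norm_cong_AE[OF band[OF assms]])
      (simp_all add: square_integrable_measurable[OF eigenspaceD(5)[OF eigenprojection_expansion(2)[OF f nn]], simplified])
  then show ?thesis by (simp add: L2_norm_def)
qed

lemma coefficient_above:
  assumes "l j > L"
  shows "L2_inner vol f (e j) = 0"
proof -
  have "(\<Sum>i | l i = l j. (cmod (L2_inner vol f (e i)))\<^sup>2) = 0"
    using eigenprojection_L2_norm[OF f l_nonneg, of j] component_norm_above[of "l j"] assms by simp
  then have "(cmod (L2_inner vol f (e j)))\<^sup>2 = 0"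
    by (subst (asm) sum_nonneg_eq_0_iff[OF finite_eigenvalue]) auto
  then show ?thesis by simp
qed

lemma band_limited_expansion:
  "AE x in vol. f x = (\<Sum>j | l j \<le> L. L2_inner vol f (e j) * e j x)"
  by (rule finite_expansion[OF f finite_eigenvalues_below]) (use coefficient_above in auto)

lemma band_limited_L2_norm:
  "(L2_norm vol f)\<^sup>2 = (\<Sum>\<nu> | \<nu> \<in> range l \<and> \<nu> \<le> L. (component_norm f \<nu>)\<^sup>2)"
proof -
  have "L2_norm vol f = L2_norm vol (\<lambda>x. \<Sum>j | l j \<le> L. L2_inner vol f (e j) * e j x)"
    by (rule L2_norm_cong_AE[OF band_limited_expansion])
      (rule square_integrable_measurable f lincomb_square_integrable)+
  then have "(L2_norm vol f)\<^sup>2 = (\<Sum>j | l j \<le> L. (cmod (L2_inner vol f (e j)))\<^sup>2)"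
    by (simp add: lincomb_L2_norm[OF finite_eigenvalues_below])
  also have "\<dots> = (\<Sum>\<nu> | \<nu> \<in> range l \<and> \<nu> \<le> L. \<Sum>j | l j = \<nu>. (cmod (L2_inner vol f (e j)))\<^sup>2)"
    by (rule sum_over_spectrum)
  also have "\<dots> = (\<Sum>\<nu> | \<nu> \<in> range l \<and> \<nu> \<le> L. (component_norm f \<nu>)\<^sup>2)"
    by (intro sum.cong refl eigenprojection_L2_norm[symmetric] f) (use l_nonneg in auto)
  finally show ?thesis .
qed

text \<open>Cauchy--Schwarz within each eigenspace turns the bound on the sum of squares of its basis functions into
  a bound on the component of \<open>f\<close>.\<close>

lemma band_limited_sup_bound:
  assumes A: "\<And>x \<nu>. \<nu> \<in> range l \<Longrightarrow> (\<Sum>j | l j = \<nu>. (cmod (e j x))\<^sup>2) \<le> (A \<nu>)\<^sup>2"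
    and A0: "\<And>\<nu>. \<nu> \<in> range l \<Longrightarrow> A \<nu> \<ge> 0"
  shows "AE x in vol. cmod (f x) \<le> (\<Sum>\<nu> | \<nu> \<in> range l \<and> \<nu> \<le> L. A \<nu> * component_norm f \<nu>)"
  using band_limited_expansion
proof eventually_elim
  case (elim x)
  have "cmod (f x) \<le> (\<Sum>j | l j \<le> L. cmod (L2_inner vol f (e j)) * cmod (e j x))"
    unfolding elim by (rule order_trans[OF norm_sum]) (simp add: norm_mult)
  also have "\<dots> = (\<Sum>\<nu> | \<nu> \<in> range l \<and> \<nu> \<le> L. \<Sum>j | l j = \<nu>. cmod (L2_inner vol f (e j)) * cmod (e j x))"
    by (rule sum_over_spectrum)
  also have "\<dots> \<le> (\<Sum>\<nu> | \<nu> \<in> range l \<and> \<nu> \<le> L. A \<nu> * component_norm f \<nu>)"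
  proof (rule sum_mono)
    fix \<nu> assume "\<nu> \<in> {\<nu>. \<nu> \<in> range l \<and> \<nu> \<le> L}"
    then have \<nu>: "\<nu> \<in> range l" "\<nu> \<ge> 0" using l_nonneg by auto
    have "(\<Sum>j | l j = \<nu>. cmod (L2_inner vol f (e j)) * cmod (e j x))\<^sup>2
        \<le> (\<Sum>j | l j = \<nu>. (cmod (L2_inner vol f (e j)))\<^sup>2) * (\<Sum>j | l j = \<nu>. (cmod (e j x))\<^sup>2)"
      by (rule Cauchy_Schwarz_ineq_sum)
    also have "\<dots> \<le> (component_norm f \<nu>)\<^sup>2 * (A \<nu>)\<^sup>2"
      unfolding eigenprojection_L2_norm[OF f \<nu>(2)]
      by (rule mult_left_mono[OF A[OF \<nu>(1)]]) (simp add: sum_nonneg)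
    also have "\<dots> = (A \<nu> * component_norm f \<nu>)\<^sup>2" by (simp add: power_mult_distrib)
    finally show "(\<Sum>j | l j = \<nu>. cmod (L2_inner vol f (e j)) * cmod (e j x)) \<le> A \<nu> * component_norm f \<nu>"
      by (rule power2_le_imp_le) (intro mult_nonneg_nonneg A0 \<nu> L2_norm_nonneg)
  qed
  finally show ?case .
qed

end

lemma eigenfunction_bound_real:
  assumes "ennreal_sqrt (\<Sum>\<^sub>\<infinity>j\<in>{j. l j = \<nu>}. ennreal ((cmod (e j x))\<^sup>2)) \<le> ennreal a" "a > 0"
  shows "(\<Sum>j | l j = \<nu>. (cmod (e j x))\<^sup>2) \<le> a\<^sup>2"
proof -
  let ?s = "\<Sum>j | l j = \<nu>. (cmod (e j x))\<^sup>2"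
  have s0: "?s \<ge> 0" by (simp add: sum_nonneg)
  have "(\<Sum>\<^sub>\<infinity>j\<in>{j. l j = \<nu>}. ennreal ((cmod (e j x))\<^sup>2)) = ennreal ?s"
    using infsum_ennreal_finite_support[OF finite_eigenvalue[of \<nu>], of "{j. l j = \<nu>}" "\<lambda>j. (cmod (e j x))\<^sup>2"] by simp
  then have "ennreal (sqrt ?s) \<le> ennreal a"
    using assms(1) s0 by (simp add: ennreal_sqrt_ennreal)
  then have "sqrt ?s \<le> a" using assms(2) by (simp add: ennreal_le_iff)
  then have "(sqrt ?s)\<^sup>2 \<le> a\<^sup>2" using s0 by (intro power_mono) auto
  then show ?thesis using s0 by simp
qed

end

section \<open>The Fourier ratio and the size of the support\<close>

theorem theorem1p18:
  fixes \<A> :: "('a::{t2_space, second_countable_topology}, 'n::finite) chart set"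
    and G :: "('a, 'n) riem_metric"
    and vol :: "'a measure"
    and \<psi> :: "real \<Rightarrow> complex"
    and C\<^sub>\<psi> c\<^sub>\<psi> :: real
  assumes "closed_riemannian_manifold \<A> G"
    and "is_riemannian_volume \<A> G vol"
    and "schwartz \<psi>"
    and "\<forall>t. \<psi> (- t) = \<psi> t"
    and "compact (closure {\<xi>. fourier_transform \<psi> \<xi> \<noteq> 0})"
    and "C\<^sub>\<psi> > 0" and "c\<^sub>\<psi> > 0"
    and "\<forall>t. \<bar>t\<bar> \<le> C\<^sub>\<psi> \<longrightarrow> cmod (\<psi> t) \<ge> c\<^sub>\<psi>"
  shows "\<exists>c\<^sub>0 C\<^sub>0 :: real. c\<^sub>0 > 0 \<and> C\<^sub>0 > 0 \<and>
    (\<forall>(e :: nat \<Rightarrow> 'a \<Rightarrow> complex) (l :: nat \<Rightarrow> real) (A :: real \<Rightarrow> real).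
      orthonormal_eigenbasis \<A> G vol e l \<longrightarrow>
      (\<forall>t\<ge>0. A t > 0) \<longrightarrow>
      mono_on {0..} A \<longrightarrow>
      (\<forall>x. \<forall>\<nu>\<in>range l.
         ennreal_sqrt (\<Sum>\<^sub>\<infinity>j\<in>{j. l j = \<nu>}. ennreal ((cmod (e j x))\<^sup>2)) \<le> ennreal (A \<nu>)) \<longrightarrow>
      (\<forall>(R :: real) (f :: 'a \<Rightarrow> complex) (E :: 'a set).
        R \<ge> 1 \<longrightarrow>
        square_integrable vol f \<longrightarrow>
        \<not> (AE x in vol. f x = 0) \<longrightarrow>
        E \<in> sets (completion vol) \<longrightarrow>
        (AE x in vol. x \<notin> E \<longrightarrow> f x = 0) \<longrightarrow>
        (\<forall>\<nu>\<in>range l. \<bar>\<nu>\<bar> > C\<^sub>\<psi> * R \<longrightarrow> (AE x in vol. eigenprojection \<A> G vol \<nu> f x = 0)) \<longrightarrow>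
        (\<forall>(\<eta> :: real) (\<Sigma>\<^sub>R :: real set).
          0 < \<eta> \<longrightarrow> \<eta> < 1 \<longrightarrow>
          \<Sigma>\<^sub>R \<subseteq> range l \<longrightarrow>
          spectral_mass \<A> G vol \<psi> R f {\<nu>\<in>range l. cmod (\<psi> (\<nu> / R)) \<noteq> 0 \<and> \<nu> \<notin> \<Sigma>\<^sub>R}
            \<le> ennreal \<eta> * spectral_mass \<A> G vol \<psi> R f (range l) \<longrightarrow>
          fourier_ratio \<A> G vol (range l) \<psi> R f
            \<le> ennreal_sqrt (localized_count \<psi> R \<Sigma>\<^sub>R) / ennreal (1 - \<eta>) \<and>
          localized_count \<psi> R \<Sigma>\<^sub>R * emeasure vol (neighborhood \<A> G (C\<^sub>0 / R) E)
            \<ge> ennreal (c\<^sub>0\<^sup>2 / ((growth_parameter A (range l) C\<^sub>\<psi> R)\<^sup>2 * R ^ CARD('n)) * (1 - \<eta>)\<^sup>2))))"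
proof -
  interpret riemannian_volume \<A> G vol
    by (intro riemannian_volume.intro riemannian_volume_axioms.intro assms(1,2))
  have "bounded (range \<psi>)"
    using assms(3) unfolding schwartz_def by (metis (mono_tags, lifting) funpow_0 power_0 scaleR_one range_eqI image_cong)
  then obtain B where B: "\<And>t. cmod (\<psi> t) \<le> B" by (auto simp: bounded_iff)
  have "0 < cmod (\<psi> 0)" using assms(6,7,8) by (metis abs_zero less_imp_le order_less_le_trans)
  then have B0: "B > 0" using B[of 0] by linarith
  have main: "fourier_ratio \<A> G vol (range l) \<psi> R f
        \<le> ennreal_sqrt (localized_count \<psi> R \<Sigma>\<^sub>R) / ennreal (1 - \<eta>) \<and>
      localized_count \<psi> R \<Sigma>\<^sub>R * emeasure vol (neighborhood \<A> G (1 / R) E)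
        \<ge> ennreal ((c\<^sub>\<psi> / B)\<^sup>2 / ((growth_parameter A (range l) C\<^sub>\<psi> R)\<^sup>2 * R ^ CARD('n)) * (1 - \<eta>)\<^sup>2)"
    if basis: "orthonormal_eigenbasis \<A> G vol e l"
      and Apos: "\<forall>t\<ge>0. A t > 0" and Amono: "mono_on {0..} A"
      and Abound: "\<forall>x. \<forall>\<nu>\<in>range l.
         ennreal_sqrt (\<Sum>\<^sub>\<infinity>j\<in>{j. l j = \<nu>}. ennreal ((cmod (e j x))\<^sup>2)) \<le> ennreal (A \<nu>)"
      and R: "R \<ge> 1" and f: "square_integrable vol f" and fnz: "\<not> (AE x in vol. f x = 0)"
      and supp: "AE x in vol. x \<notin> E \<longrightarrow> f x = 0"
      and band: "\<forall>\<nu>\<in>range l. \<bar>\<nu>\<bar> > C\<^sub>\<psi> * R \<longrightarrow> (AE x in vol. eigenprojection \<A> G vol \<nu> f x = 0)"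
      and \<eta>: "0 < \<eta>" "\<eta> < 1" and \<Sigma>: "\<Sigma>\<^sub>R \<subseteq> range l"
      and conc: "spectral_mass \<A> G vol \<psi> R f {\<nu>\<in>range l. cmod (\<psi> (\<nu> / R)) \<noteq> 0 \<and> \<nu> \<notin> \<Sigma>\<^sub>R}
            \<le> ennreal \<eta> * spectral_mass \<A> G vol \<psi> R f (range l)"
    for e :: "nat \<Rightarrow> 'a \<Rightarrow> complex" and l A R f E \<eta> \<Sigma>\<^sub>R
  proof -
    interpret eigenbasis \<A> G vol e l
      by (intro eigenbasis.intro eigenbasis_axioms.intro riemannian_volume_axioms basis) unfold_locales
    define L where "L = C\<^sub>\<psi> * R"
    \<comment> \<open>The finite set of parameters that contribute to \<open>f\<close>; frequencies above \<open>L\<close> are absent by hypothesis.\<close>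
    define S where "S = {\<nu>. \<nu> \<in> range l \<and> \<nu> \<le> L}"
    define w where "w \<nu> = cmod (\<psi> (\<nu> / R))" for \<nu>
    define N where "N \<nu> = component_norm f \<nu>" for \<nu>
    define O' where "O' = neighborhood \<A> G (1 / R) E"
    define A\<^sub>R where "A\<^sub>R = growth_parameter A (range l) C\<^sub>\<psi> R"
    define P where "P = (\<Sum>\<nu>\<in>S. w \<nu> * N \<nu>)"
    define Q where "Q = (\<Sum>\<nu>\<in>S. (w \<nu> * N \<nu>)\<^sup>2)"
    have R0: "R > 0" using R by simp
    have L0: "L > 0" unfolding L_def using R0 assms(6) by simp
    have range_nn: "\<nu> \<ge> 0" if "\<nu> \<in> range l" for \<nu> using that l_nonneg by auto
    have band': "AE x in vol. eigenprojection \<A> G vol \<nu> f x = 0" if "\<nu> \<in> range l" "\<nu> > L" for \<nu>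
      using bspec[OF band that(1)] that(2) range_nn[OF that(1)] by (simp add: L_def)
    have S: "finite S" unfolding S_def using finite_spectrum_below by simp
    have N0: "N \<nu> \<ge> 0" for \<nu> unfolding N_def by (rule L2_norm_nonneg)
    have w0: "w \<nu> \<ge> 0" and wB: "w \<nu> \<le> B" for \<nu> using B by (simp_all add: w_def)
    have wc: "w \<nu> \<ge> c\<^sub>\<psi>" if "\<nu> \<in> S" for \<nu>
    proof -
      have "\<bar>\<nu> / R\<bar> \<le> C\<^sub>\<psi>" using that range_nn R0 by (auto simp: S_def L_def field_simps)
      then show ?thesis using assms(8) by (simp add: w_def)
    qed
    have Noff: "N \<nu> = 0" if "\<nu> \<in> range l - S" for \<nu>
      unfolding N_def by (rule component_norm_above[where L = L, OF f band']) (use that in \<open>auto simp: S_def\<close>)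
    have norm_f: "(L2_norm vol f)\<^sup>2 = (\<Sum>\<nu>\<in>S. (N \<nu>)\<^sup>2)"
      unfolding S_def N_def by (rule band_limited_L2_norm[where L = L, OF f band'])
    have f_pos: "(L2_norm vol f)\<^sup>2 > 0"
    proof (rule ccontr)
      assume "\<not> (L2_norm vol f)\<^sup>2 > 0"
      then have 0: "(LINT x|vol. (cmod (f x))\<^sup>2) = 0"
        unfolding L2_norm_square[symmetric] by simp
      have "AE x in vol. (cmod (f x))\<^sup>2 = 0"
        using integral_nonneg_eq_0_iff_AE[OF square_integrable_integrable[OF f]] 0 by simp
      then show False using fnz by simp
    qed
    have Q_lower: "c\<^sub>\<psi>\<^sup>2 * (L2_norm vol f)\<^sup>2 \<le> Q"
      unfolding norm_f Q_def sum_distrib_left power_mult_distrib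
      using wc assms(7) by (intro sum_mono mult_right_mono power_mono) auto
    have Q_upper: "Q \<le> B\<^sup>2 * (L2_norm vol f)\<^sup>2"
      unfolding norm_f Q_def sum_distrib_left power_mult_distrib
      using wB w0 by (intro sum_mono mult_right_mono power_mono) auto
    have Q0: "Q > 0" using Q_lower f_pos assms(7) by (smt (verit) mult_pos_pos zero_less_power)
    have P0: "P > 0"
    proof -
      have "P \<ge> 0" unfolding P_def using w0 N0 by (simp add: sum_nonneg)
      moreover have "P \<noteq> 0"
      proof
        assume "P = 0"
        then have "w \<nu> * N \<nu> = 0" if "\<nu> \<in> S" for \<nu>
          using that S w0 N0 unfolding P_def by (subst (asm) sum_nonneg_eq_0_iff) auto
        then have "Q = 0" unfolding Q_def by (auto intro!: sum.neutral)
        then show False using Q0 by simp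
      qed
      ultimately show ?thesis by simp
    qed
    have mass: "spectral_mass \<A> G vol \<psi> R f T = ennreal (\<Sum>\<nu>\<in>T \<inter> S. w \<nu> * N \<nu>)" if "T \<subseteq> range l" for T
      unfolding spectral_mass_def w_def[symmetric] N_def[symmetric]
      by (rule infsum_ennreal_finite_support[OF S]) (use Noff that w0 N0 in auto)
    have mass_all: "spectral_mass \<A> G vol \<psi> R f (range l) = ennreal P"
    proof -
      have "range l \<inter> S = S" by (auto simp: S_def)
      then show ?thesis using mass[of "range l"] by (simp add: P_def)
    qed
    have FR: "fourier_ratio \<A> G vol (range l) \<psi> R f = ennreal (P / sqrt Q)"
    proof -
      have "(\<Sum>\<^sub>\<infinity>\<nu>\<in>range l. ennreal ((w \<nu>)\<^sup>2 * (N \<nu>)\<^sup>2)) = ennreal (\<Sum>\<nu>\<in>range l \<inter> S. (w \<nu>)\<^sup>2 * (N \<nu>)\<^sup>2)"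
        by (rule infsum_ennreal_finite_support[OF S]) (use Noff in auto)
      also have "range l \<inter> S = S" by (auto simp: S_def)
      also have "(\<Sum>\<nu>\<in>S. (w \<nu>)\<^sup>2 * (N \<nu>)\<^sup>2) = Q" by (simp add: Q_def power_mult_distrib)
      finally have "(\<Sum>\<^sub>\<infinity>\<nu>\<in>range l. ennreal ((w \<nu>)\<^sup>2 * (N \<nu>)\<^sup>2)) = ennreal Q" .
      then show ?thesis
        unfolding fourier_ratio_def mass_all w_def[symmetric] N_def[symmetric]
        using P0 Q0 by (simp add: ennreal_sqrt_ennreal divide_ennreal)
    qed
    define V where "V = measure vol O'"
    have O'_open: "open O'" unfolding O'_def by (rule open_neighborhood)
    have O'_sets: "O' \<in> sets vol" using borel_open[OF O'_open] by simp
    have EO: "E \<subseteq> O'" unfolding O'_def by (rule subset_neighborhood) (use R0 in simp)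
    have emV: "emeasure vol O' = ennreal V" unfolding V_def by (rule emeasure_eq_measure)
    have A_le: "A \<nu> \<le> A\<^sub>R" if "\<nu> \<in> S" for \<nu>
    proof -
      have e: "{\<nu> \<in> range l. \<bar>\<nu>\<bar> \<le> C\<^sub>\<psi> * R} = S" using range_nn by (auto simp: S_def L_def)
      show ?thesis unfolding A\<^sub>R_def growth_parameter_def e
        by (rule cSUP_upper[OF that]) (use S in simp)
    qed
    have "S \<noteq> {}" using P0 by (auto simp: P_def)
    then obtain \<nu>0 where \<nu>0: "\<nu>0 \<in> S" by blast
    have "0 < A \<nu>0" using Apos range_nn \<nu>0 by (auto simp: S_def)
    then have AR0: "A\<^sub>R > 0" using A_le[OF \<nu>0] by linarith
    \<comment> \<open>The supremum of \<open>f\<close> is controlled by its localized \<open>L1\<close> spectral mass.\<close>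
    have sup: "AE x in vol. cmod (f x) \<le> A\<^sub>R / c\<^sub>\<psi> * P"
    proof -
      have "AE x in vol. cmod (f x) \<le> (\<Sum>\<nu>\<in>S. A \<nu> * N \<nu>)"
        unfolding S_def N_def
      proof (rule band_limited_sup_bound[where L = L, OF f band'])
        show "(\<Sum>j | l j = \<nu>. (cmod (e j x))\<^sup>2) \<le> (A \<nu>)\<^sup>2" if "\<nu> \<in> range l" for x \<nu>
          by (rule eigenfunction_bound_real) (use Abound Apos range_nn that in auto)
        show "A \<nu> \<ge> 0" if "\<nu> \<in> range l" for \<nu>
          using Apos range_nn[OF that] less_imp_le by blast
      qed
      moreover have "(\<Sum>\<nu>\<in>S. A \<nu> * N \<nu>) \<le> A\<^sub>R / c\<^sub>\<psi> * P"
        unfolding P_def sum_distrib_left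
      proof (rule sum_mono)
        fix \<nu> assume \<nu>: "\<nu> \<in> S"
        have "A \<nu> * N \<nu> \<le> A\<^sub>R * N \<nu>" using A_le[OF \<nu>] N0 by (rule mult_right_mono)
        also have "\<dots> \<le> A\<^sub>R / c\<^sub>\<psi> * (w \<nu> * N \<nu>)"
        proof -
          have "1 * (A\<^sub>R * N \<nu>) \<le> w \<nu> / c\<^sub>\<psi> * (A\<^sub>R * N \<nu>)"
            using wc[OF \<nu>] assms(7) AR0 N0 by (intro mult_right_mono) auto
          then show ?thesis by (simp add: mult_ac)
        qed
        finally show "A \<nu> * N \<nu> \<le> A\<^sub>R / c\<^sub>\<psi> * (w \<nu> * N \<nu>)" .
      qed
      ultimately show ?thesis by (auto elim!: eventually_mono intro: order_trans)
    qed
    have f_le: "(L2_norm vol f)\<^sup>2 \<le> (A\<^sub>R / c\<^sub>\<psi> * P)\<^sup>2 * V"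
    proof -
      have "(L2_norm vol f)\<^sup>2 = (LINT x|vol. (cmod (f x))\<^sup>2)" by (rule L2_norm_square)
      also have "\<dots> \<le> (LINT x|vol. (A\<^sub>R / c\<^sub>\<psi> * P)\<^sup>2 * indicator O' x)"
      proof (rule integral_mono_AE[OF square_integrable_integrable[OF f]])
        show "integrable vol (\<lambda>x. (A\<^sub>R / c\<^sub>\<psi> * P)\<^sup>2 * indicator O' x :: real)"
          using O'_sets by (intro integrable_mult_right integrable_real_indicator) (auto simp: emV)
        show "AE x in vol. (cmod (f x))\<^sup>2 \<le> (A\<^sub>R / c\<^sub>\<psi> * P)\<^sup>2 * indicator O' x"
          using sup supp
        proof eventually_elim
          case (elim x)
          show ?case
          proof (cases "x \<in> O'")
            case True
            then show ?thesis using power_mono[OF elim(1) norm_ge_zero, of 2] by simp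
          next
            case False
            then have "f x = 0" using elim(2) EO by blast
            then show ?thesis by simp
          qed
        qed
      qed
      also have "\<dots> = (A\<^sub>R / c\<^sub>\<psi> * P)\<^sup>2 * V" using O'_sets by (simp add: V_def)
      finally show ?thesis .
    qed
    have V0: "V > 0"
    proof (rule ccontr)
      assume "\<not> V > 0"
      then have "V = 0" using measure_nonneg[of vol O'] unfolding V_def by linarith
      then show False using f_le f_pos by simp
    qed
    define F where "F = {\<nu> \<in> \<Sigma>\<^sub>R. w \<nu> \<noteq> 0}"
    have count: "localized_count \<psi> R \<Sigma>\<^sub>R = (if finite F then ennreal (real (card F)) else top)"
      unfolding localized_count_def w_def[symmetric] F_def[symmetric]
      by (simp add: emeasure_count_space ennreal_of_nat_eq_real_of_nat)
    show ?thesis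
    proof (cases "finite F")
      \<comment> \<open>Both right-hand sides are infinite, the second because \<open>f\<close> is nonzero on \<open>O'\<close>.\<close>
      case False
      then have top: "localized_count \<psi> R \<Sigma>\<^sub>R = top" using count by simp
      have "fourier_ratio \<A> G vol (range l) \<psi> R f \<le> ennreal_sqrt (localized_count \<psi> R \<Sigma>\<^sub>R) / ennreal (1 - \<eta>)"
        unfolding top by (simp add: ennreal_sqrt_def ennreal_top_divide)
      moreover have "localized_count \<psi> R \<Sigma>\<^sub>R * emeasure vol O' = top"
        unfolding top emV using V0 by (simp add: ennreal_top_mult)
      ultimately show ?thesis unfolding O'_def by simp
    next
      case True
      define m where "m = real (card F)"
      have cm: "localized_count \<psi> R \<Sigma>\<^sub>R = ennreal m" using count True by (simp add: m_def)
      have m0: "m \<ge> 0" by (simp add: m_def)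
      have "(1 - \<eta>) * P \<le> sqrt m * sqrt Q"
        unfolding P_def Q_def m_def
      proof (rule L1_concentration[OF S True])
        have "{\<nu> \<in> range l. cmod (\<psi> (\<nu> / R)) \<noteq> 0 \<and> \<nu> \<notin> \<Sigma>\<^sub>R} \<inter> S = {\<nu> \<in> S. w \<nu> \<noteq> 0 \<and> \<nu> \<notin> \<Sigma>\<^sub>R}"
          by (auto simp: S_def w_def)
        then have "ennreal (\<Sum>\<nu> | \<nu> \<in> S \<and> w \<nu> \<noteq> 0 \<and> \<nu> \<notin> \<Sigma>\<^sub>R. w \<nu> * N \<nu>) \<le> ennreal \<eta> * ennreal P"
          using conc mass[of "{\<nu> \<in> range l. cmod (\<psi> (\<nu> / R)) \<noteq> 0 \<and> \<nu> \<notin> \<Sigma>\<^sub>R}"] mass_all by auto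
        also have "\<dots> = ennreal (\<eta> * P)" using \<eta> P0 by (simp add: ennreal_mult)
        finally have "(\<Sum>\<nu> | \<nu> \<in> S \<and> w \<nu> \<noteq> 0 \<and> \<nu> \<notin> \<Sigma>\<^sub>R. w \<nu> * N \<nu>) \<le> \<eta> * P"
          using \<eta> P0 by (subst (asm) ennreal_le_iff) auto
        moreover have "(\<Sum>\<nu> | \<nu> \<in> S \<and> w \<nu> \<noteq> 0 \<and> \<nu> \<notin> \<Sigma>\<^sub>R. w \<nu> * N \<nu>) = (\<Sum>\<nu>\<in>S - F. w \<nu> * N \<nu>)"
          by (rule sum.mono_neutral_left) (use S in \<open>auto simp: F_def\<close>)
        ultimately show "(\<Sum>\<nu>\<in>S - F. w \<nu> * N \<nu>) \<le> \<eta> * (\<Sum>\<nu>\<in>S. w \<nu> * N \<nu>)"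
          by (simp add: P_def)
      qed (use w0 N0 in auto)
      then have PQ: "(1 - \<eta>) * P \<le> sqrt m * sqrt Q" .
      have 1: "P / sqrt Q \<le> sqrt m / (1 - \<eta>)"
        using PQ Q0 \<eta> by (simp add: field_simps)
      have part1: "fourier_ratio \<A> G vol (range l) \<psi> R f \<le> ennreal_sqrt (localized_count \<psi> R \<Sigma>\<^sub>R) / ennreal (1 - \<eta>)"
        unfolding FR cm using 1 \<eta> m0 by (simp add: ennreal_sqrt_ennreal divide_ennreal ennreal_leI)
      have "((1 - \<eta>) * P)\<^sup>2 \<le> (sqrt m * sqrt Q)\<^sup>2"
        using PQ \<eta> P0 by (intro power_mono) auto
      also have "\<dots> = m * Q" using m0 Q0 by (simp add: power_mult_distrib)
      also have "\<dots> \<le> m * (B\<^sup>2 * ((A\<^sub>R / c\<^sub>\<psi> * P)\<^sup>2 * V))"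
        using Q_upper f_le m0 by (intro mult_left_mono order_trans[OF Q_upper] f_le) auto
      finally have "(1 - \<eta>)\<^sup>2 * P\<^sup>2 \<le> (m * V * (B * A\<^sub>R / c\<^sub>\<psi>)\<^sup>2) * P\<^sup>2"
        by (simp add: power_mult_distrib power_divide mult_ac)
      then have "(1 - \<eta>)\<^sup>2 \<le> m * V * (B * A\<^sub>R / c\<^sub>\<psi>)\<^sup>2"
        using P0 by (simp add: mult_le_cancel_right)
      then have 2: "(c\<^sub>\<psi> / B)\<^sup>2 / A\<^sub>R\<^sup>2 * (1 - \<eta>)\<^sup>2 \<le> m * V"
        using B0 AR0 assms(7) by (simp add: power_mult_distrib power_divide field_simps)
      \<comment> \<open>Here \<open>R \<ge> 1\<close> enters.\<close>
      have "(c\<^sub>\<psi> / B)\<^sup>2 / (A\<^sub>R\<^sup>2 * R ^ CARD('n)) * (1 - \<eta>)\<^sup>2 \<le> (c\<^sub>\<psi> / B)\<^sup>2 / A\<^sub>R\<^sup>2 * (1 - \<eta>)\<^sup>2"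
      proof (intro mult_right_mono divide_left_mono)
        show "A\<^sub>R\<^sup>2 \<le> A\<^sub>R\<^sup>2 * R ^ CARD('n)"
          using R by (simp add: mult_le_cancel_left1 one_le_power)
      qed (use AR0 R0 in auto)
      then have "ennreal ((c\<^sub>\<psi> / B)\<^sup>2 / (A\<^sub>R\<^sup>2 * R ^ CARD('n)) * (1 - \<eta>)\<^sup>2) \<le> ennreal (m * V)"
        using 2 by (intro ennreal_leI) linarith
      also have "\<dots> = localized_count \<psi> R \<Sigma>\<^sub>R * emeasure vol O'"
        unfolding cm emV using m0 V0 by (simp add: ennreal_mult)
      finally show ?thesis using part1 unfolding A\<^sub>R_def O'_def by blast
    qed
  qed
  show ?thesis
  proof (rule exI[of _ "c\<^sub>\<psi> / B"], rule exI[of _ 1], intro conjI)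
    show "c\<^sub>\<psi> / B > 0" using assms(7) B0 by simp
  qed (simp, (intro allI impI, rule main; assumption))
qed

end
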